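(* Let $(M,g)$ be a compact (connected, finite-dimensional) Lorentzian manifold, let $F$ be a smooth $(1,1)$ tensor field on $M$ which is skew-adjoint with respect to $g$, and let $V : M \to \mathbb{R}$ be a smooth function (potential). If there exists a timelike conformal Killing vector field $K$ on $M$ such that $F(K)=0$, then each inextensible solution $\gamma$ of the second order differential equation $$\frac{D\dot\gamma}{dt}(t) = F_{\gamma(t)}(\dot\gamma(t)) - \nabla V(\gamma(t))$$ is complete, i.e. is defined on all of $\mathbb{R}$.
   Context: A Lorentzian manifold $(M,g)$ is a smooth manifold with a smooth metric tensor $g$ of signature $(-,+,\dots,+)$. Here $D/dt$ is the covariant derivative along $\gamma$ induced by the Levi-Civita connection of $g$, $\dot\gamma$ is the velocity of $\gamma$, and $\nabla V$ is the $g$-gradient of $V$. The tensor field $F$ is regarded as a field of endomorphisms $F_p : T_pM \to T_pM$; it is skew-adjoint if $g(F(Y),W) = -g(Y,F(W))$ for all vector fields $Y,W$. A vector field $K$ is timelike if $g(K,K)<0$ at every point of $M$. A (smooth) vector field $K$ is conformal Killing if $\mathcal{L}_K g = 2\sigma g$ for some $\sigma\in C^\infty(M)$, where $\mathcal{L}_K$ is the Lie derivative. For each $p\in M$, $v\in T_pM$ there is a unique inextensible (i.e. having maximal interval of definition) smooth solution $\gamma: I\to M$, $0\in I$, of the equation with $\gamma(0)=p$, $\dot\gamma(0)=v$; it is called complete if $I=\mathbb{R}$. *)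

theory Defs
  imports "HOL-Analysis.Analysis"
begin

section \<open>Smooth maps between normed spaces\<close>

text \<open>Meant for open sets \<open>S\<close> of a finite-dimensional space: the derivative is taken at interior points.\<close>

fun higher_differentiable_on ::
  "'a::real_normed_vector set \<Rightarrow> ('a \<Rightarrow> 'b::real_normed_vector) \<Rightarrow> nat \<Rightarrow> bool" where
  "higher_differentiable_on S f 0 \<longleftrightarrow> continuous_on S f"
| "higher_differentiable_on S f (Suc n) \<longleftrightarrow>
     (\<forall>x\<in>S. f differentiable (at x)) \<and>
     (\<forall>v. higher_differentiable_on S (\<lambda>x. frechet_derivative f (at x) v) n)"

definition smooth_on ::
  "'a::real_normed_vector set \<Rightarrow> ('a \<Rightarrow> 'b::real_normed_vector) \<Rightarrow> bool" where
  "smooth_on S f \<longleftrightarrow> (\<forall>n. higher_differentiable_on S f n)"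


section \<open>Smooth manifolds\<close>

text \<open>The manifold is a whole type \<open>'a\<close>, modelled on a Euclidean space \<open>'e\<close>. A chart is a domain
  together with a coordinate map, whose values outside the domain are irrelevant.\<close>

type_synonym ('a, 'e) chart = "'a set \<times> ('a \<Rightarrow> 'e)"

abbreviation chart_dom :: "('a, 'e) chart \<Rightarrow> 'a set" where
  "chart_dom c \<equiv> fst c"

abbreviation chart_map :: "('a, 'e) chart \<Rightarrow> 'a \<Rightarrow> 'e" where
  "chart_map c \<equiv> snd c"

definition chart_inv :: "('a, 'e) chart \<Rightarrow> 'e \<Rightarrow> 'a" where
  "chart_inv c = inv_into (chart_dom c) (chart_map c)"

abbreviation chart_image :: "('a, 'e) chart \<Rightarrow> 'e set" where
  "chart_image c \<equiv> chart_map c ` chart_dom c"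

definition is_chart :: "('a::topological_space, 'e::euclidean_space) chart \<Rightarrow> bool" where
  "is_chart c \<longleftrightarrow> open (chart_dom c) \<and> open (chart_image c) \<and>
     homeomorphism (chart_dom c) (chart_image c) (chart_map c) (chart_inv c)"

text \<open>An atlas need not be maximal; the notions below depend only on the smooth structure it
  generates.\<close>

definition smooth_atlas :: "('a::topological_space, 'e::euclidean_space) chart set \<Rightarrow> bool" where
  "smooth_atlas A \<longleftrightarrow>
     (\<forall>c\<in>A. is_chart c) \<and> (\<Union>c\<in>A. chart_dom c) = UNIV \<and>
     (\<forall>c\<in>A. \<forall>d\<in>A. smooth_on (chart_map c ` (chart_dom c \<inter> chart_dom d))
                             (chart_map d \<circ> chart_inv c))"

definition smooth_function ::
  "('a, 'e::euclidean_space) chart set \<Rightarrow> ('a \<Rightarrow> real) \<Rightarrow> bool" where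
  "smooth_function A f \<longleftrightarrow> (\<forall>c\<in>A. smooth_on (chart_image c) (f \<circ> chart_inv c))"


section \<open>Tangent vectors\<close>

text \<open>A tangent vector at \<open>p\<close> is the family of its coordinate vectors in all charts around \<open>p\<close>,
  related by the derivatives of the transition maps; entries at other indices are 0.
  For every chart \<open>c\<close> around \<open>p\<close> the map \<open>v \<mapsto> v c\<close> is a bijection from the tangent
  space onto \<open>'e\<close>, and the vector space structure of the tangent space is the one transported along
  it, that is, the pointwise one.\<close>

type_synonym ('a, 'e) tvec = "('a, 'e) chart \<Rightarrow> 'e"

definition tangent_space ::
  "('a, 'e::euclidean_space) chart set \<Rightarrow> 'a \<Rightarrow> ('a, 'e) tvec set" where
  "tangent_space A p = {v.
     (\<forall>c\<in>A. \<forall>d\<in>A. p \<in> chart_dom c \<longrightarrow> p \<in> chart_dom d \<longrightarrow>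
        v d = frechet_derivative (chart_map d \<circ> chart_inv c) (at (chart_map c p)) (v c)) \<and>
     (\<forall>c. \<not> (c \<in> A \<and> p \<in> chart_dom c) \<longrightarrow> v c = 0)}"

text \<open>The tangent vector at \<open>p\<close> whose coordinates in the chart \<open>c\<close> are \<open>u\<close>. For fixed \<open>u\<close> this is a
  vector field on the domain of \<open>c\<close> with constant coefficients in the coordinate frame.\<close>

definition of_coords ::
  "('a, 'e::euclidean_space) chart set \<Rightarrow> ('a, 'e) chart \<Rightarrow> 'a \<Rightarrow> 'e \<Rightarrow> ('a, 'e) tvec" where
  "of_coords A c p u = inv_into (tangent_space A p) (\<lambda>v. v c) u"


section \<open>Vector fields and tensor fields\<close>

definition vector_field_rep ::
  "('a, 'e) chart \<Rightarrow> ('a \<Rightarrow> ('a, 'e) tvec) \<Rightarrow> 'e \<Rightarrow> 'e" where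
  "vector_field_rep c X x = X (chart_inv c x) c"

definition smooth_vector_field ::
  "('a, 'e::euclidean_space) chart set \<Rightarrow> ('a \<Rightarrow> ('a, 'e) tvec) \<Rightarrow> bool" where
  "smooth_vector_field A X \<longleftrightarrow>
     (\<forall>p. X p \<in> tangent_space A p) \<and>
     (\<forall>c\<in>A. smooth_on (chart_image c) (vector_field_rep c X))"

text \<open>A field of endomorphisms or of bilinear forms only matters on the tangent spaces. Its local
  representative in a chart is a field of endomorphisms or bilinear forms on \<open>'e\<close>.\<close>

definition endo_rep ::
  "('a, 'e::euclidean_space) chart set \<Rightarrow> ('a \<Rightarrow> ('a, 'e) tvec \<Rightarrow> ('a, 'e) tvec) \<Rightarrow>
   ('a, 'e) chart \<Rightarrow> 'e \<Rightarrow> 'e \<Rightarrow> 'e" where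
  "endo_rep A F c x u = F (chart_inv c x) (of_coords A c (chart_inv c x) u) c"

definition smooth_endo_field ::
  "('a, 'e::euclidean_space) chart set \<Rightarrow> ('a \<Rightarrow> ('a, 'e) tvec \<Rightarrow> ('a, 'e) tvec) \<Rightarrow> bool" where
  "smooth_endo_field A F \<longleftrightarrow>
     (\<forall>p. \<forall>v\<in>tangent_space A p. F p v \<in> tangent_space A p) \<and>
     (\<forall>c\<in>A. (\<forall>x\<in>chart_image c. linear (endo_rep A F c x)) \<and>
             (\<forall>u. smooth_on (chart_image c) (\<lambda>x. endo_rep A F c x u)))"

definition metric_rep ::
  "('a, 'e::euclidean_space) chart set \<Rightarrow> ('a \<Rightarrow> ('a, 'e) tvec \<Rightarrow> ('a, 'e) tvec \<Rightarrow> real) \<Rightarrow>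
   ('a, 'e) chart \<Rightarrow> 'e \<Rightarrow> 'e \<Rightarrow> 'e \<Rightarrow> real" where
  "metric_rep A g c x u v =
     g (chart_inv c x) (of_coords A c (chart_inv c x) u) (of_coords A c (chart_inv c x) v)"

text \<open>Signature \<open>(-,+,...,+)\<close>: there is an orthonormal basis with exactly one timelike vector.\<close>

definition lorentz_form :: "('e::euclidean_space \<Rightarrow> 'e \<Rightarrow> real) \<Rightarrow> bool" where
  "lorentz_form b \<longleftrightarrow>
     bilinear b \<and> (\<forall>u v. b u v = b v u) \<and>
     (\<exists>B e0. independent B \<and> span B = UNIV \<and> e0 \<in> B \<and> b e0 e0 = -1 \<and>
        (\<forall>e\<in>B - {e0}. b e e = 1) \<and>
        (\<forall>e\<in>B. \<forall>e'\<in>B. e \<noteq> e' \<longrightarrow> b e e' = 0))"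

definition lorentzian_metric ::
  "('a, 'e::euclidean_space) chart set \<Rightarrow>
   ('a \<Rightarrow> ('a, 'e) tvec \<Rightarrow> ('a, 'e) tvec \<Rightarrow> real) \<Rightarrow> bool" where
  "lorentzian_metric A g \<longleftrightarrow>
     (\<forall>c\<in>A. (\<forall>x\<in>chart_image c. lorentz_form (metric_rep A g c x)) \<and>
             (\<forall>u v. smooth_on (chart_image c) (\<lambda>x. metric_rep A g c x u v)))"

definition skew_adjoint ::
  "('a, 'e::euclidean_space) chart set \<Rightarrow>
   ('a \<Rightarrow> ('a, 'e) tvec \<Rightarrow> ('a, 'e) tvec \<Rightarrow> real) \<Rightarrow>
   ('a \<Rightarrow> ('a, 'e) tvec \<Rightarrow> ('a, 'e) tvec) \<Rightarrow> bool" where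
  "skew_adjoint A g F \<longleftrightarrow>
     (\<forall>p. \<forall>v\<in>tangent_space A p. \<forall>w\<in>tangent_space A p. g p (F p v) w = - g p v (F p w))"

definition timelike_field ::
  "('a \<Rightarrow> ('a, 'e) tvec \<Rightarrow> ('a, 'e) tvec \<Rightarrow> real) \<Rightarrow> ('a \<Rightarrow> ('a, 'e) tvec) \<Rightarrow> bool" where
  "timelike_field g K \<longleftrightarrow> (\<forall>p. g p (K p) (K p) < 0)"


section \<open>Conformal Killing fields\<close>

definition lie_bracket ::
  "('e::euclidean_space \<Rightarrow> 'e) \<Rightarrow> ('e \<Rightarrow> 'e) \<Rightarrow> 'e \<Rightarrow> 'e" where
  "lie_bracket X Y x = frechet_derivative Y (at x) (X x) - frechet_derivative X (at x) (Y x)"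

text \<open>The Lie derivative of the metric,
  \<open>(L_K g)(X,Y) = K (g(X,Y)) - g([K,X],Y) - g(X,[K,Y])\<close>, in a chart. Being a tensor,
  it is determined by its values on the constant coordinate fields \<open>X = u\<close>, \<open>Y = v\<close>.\<close>

definition lie_derivative_metric_rep ::
  "('a, 'e::euclidean_space) chart set \<Rightarrow>
   ('a \<Rightarrow> ('a, 'e) tvec \<Rightarrow> ('a, 'e) tvec \<Rightarrow> real) \<Rightarrow>
   ('a \<Rightarrow> ('a, 'e) tvec) \<Rightarrow> ('a, 'e) chart \<Rightarrow> 'e \<Rightarrow> 'e \<Rightarrow> 'e \<Rightarrow> real" where
  "lie_derivative_metric_rep A g K c x u v =
     (let k = vector_field_rep c K in
        frechet_derivative (\<lambda>y. metric_rep A g c y u v) (at x) (k x)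
        - metric_rep A g c x (lie_bracket k (\<lambda>_. u) x) v
        - metric_rep A g c x u (lie_bracket k (\<lambda>_. v) x))"

definition conformal_killing ::
  "('a, 'e::euclidean_space) chart set \<Rightarrow>
   ('a \<Rightarrow> ('a, 'e) tvec \<Rightarrow> ('a, 'e) tvec \<Rightarrow> real) \<Rightarrow> ('a \<Rightarrow> ('a, 'e) tvec) \<Rightarrow> bool" where
  "conformal_killing A g K \<longleftrightarrow> smooth_vector_field A K \<and>
     (\<exists>\<sigma>. smooth_function A \<sigma> \<and>
        (\<forall>c\<in>A. \<forall>x\<in>chart_image c. \<forall>u v.
           lie_derivative_metric_rep A g K c x u v =
             2 * \<sigma> (chart_inv c x) * metric_rep A g c x u v))"


section \<open>Gradient\<close>

text \<open>The differential of a function, computed in an arbitrary chart around \<open>p\<close>.\<close>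

definition differential ::
  "('a, 'e::euclidean_space) chart set \<Rightarrow> ('a \<Rightarrow> real) \<Rightarrow> 'a \<Rightarrow> ('a, 'e) tvec \<Rightarrow> real" where
  "differential A f p v =
     (let c = (SOME c. c \<in> A \<and> p \<in> chart_dom c)
      in frechet_derivative (f \<circ> chart_inv c) (at (chart_map c p)) (v c))"

definition gradient ::
  "('a, 'e::euclidean_space) chart set \<Rightarrow>
   ('a \<Rightarrow> ('a, 'e) tvec \<Rightarrow> ('a, 'e) tvec \<Rightarrow> real) \<Rightarrow> ('a \<Rightarrow> real) \<Rightarrow> 'a \<Rightarrow> ('a, 'e) tvec" where
  "gradient A g f p =
     (THE z. z \<in> tangent_space A p \<and>
             (\<forall>w\<in>tangent_space A p. g p z w = differential A f p w))"


section \<open>Levi-Civita connection and covariant derivative along curves\<close>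

text \<open>In a chart a connection is given by its Christoffel symbols, a bilinear map \<open>\<Gamma>\<close> at each
  point, with \<open>\<nabla>\<^sub>u v = \<Gamma> u v\<close> for constant coordinate fields \<open>u\<close>, \<open>v\<close>. The Levi-Civita connection
  is the one that is torsion-free, \<open>\<nabla>\<^sub>u v - \<nabla>\<^sub>v u = [u, v] = 0\<close>, and metric,
  \<open>u (g(v,w)) = g(\<nabla>\<^sub>u v, w) + g(v, \<nabla>\<^sub>u w)\<close>.\<close>

definition levi_civita_rep ::
  "('a, 'e::euclidean_space) chart set \<Rightarrow>
   ('a \<Rightarrow> ('a, 'e) tvec \<Rightarrow> ('a, 'e) tvec \<Rightarrow> real) \<Rightarrow>
   ('a, 'e) chart \<Rightarrow> 'e \<Rightarrow> 'e \<Rightarrow> 'e \<Rightarrow> 'e" where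
  "levi_civita_rep A g c x =
     (THE \<Gamma>. bilinear \<Gamma> \<and> (\<forall>u v. \<Gamma> u v = \<Gamma> v u) \<and>
        (\<forall>u v w. frechet_derivative (\<lambda>y. metric_rep A g c y v w) (at x) u =
           metric_rep A g c x (\<Gamma> u v) w + metric_rep A g c x v (\<Gamma> u w)))"

definition smooth_curve ::
  "('a::topological_space, 'e::euclidean_space) chart set \<Rightarrow> real set \<Rightarrow> (real \<Rightarrow> 'a) \<Rightarrow> bool" where
  "smooth_curve A I \<gamma> \<longleftrightarrow> continuous_on I \<gamma> \<and>
     (\<forall>c\<in>A. smooth_on {t\<in>I. \<gamma> t \<in> chart_dom c} (chart_map c \<circ> \<gamma>))"

definition velocity ::
  "('a, 'e::euclidean_space) chart set \<Rightarrow> (real \<Rightarrow> 'a) \<Rightarrow> real \<Rightarrow> ('a, 'e) tvec" where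
  "velocity A \<gamma> t =
     (\<lambda>c. if c \<in> A \<and> \<gamma> t \<in> chart_dom c
          then vector_derivative (chart_map c \<circ> \<gamma>) (at t) else 0)"

text \<open>The covariant derivative \<open>DY/dt\<close> of a vector field \<open>Y\<close> along the curve \<open>\<gamma>\<close>.\<close>

definition covariant_derivative ::
  "('a, 'e::euclidean_space) chart set \<Rightarrow>
   ('a \<Rightarrow> ('a, 'e) tvec \<Rightarrow> ('a, 'e) tvec \<Rightarrow> real) \<Rightarrow>
   (real \<Rightarrow> 'a) \<Rightarrow> (real \<Rightarrow> ('a, 'e) tvec) \<Rightarrow> real \<Rightarrow> ('a, 'e) tvec" where
  "covariant_derivative A g \<gamma> Y t =
     (\<lambda>c. if c \<in> A \<and> \<gamma> t \<in> chart_dom c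
          then vector_derivative (\<lambda>s. Y s c) (at t) +
               levi_civita_rep A g c (chart_map c (\<gamma> t)) (velocity A \<gamma> t c) (Y t c)
          else 0)"


section \<open>Trajectories\<close>

definition trajectory_on ::
  "('a::topological_space, 'e::euclidean_space) chart set \<Rightarrow>
   ('a \<Rightarrow> ('a, 'e) tvec \<Rightarrow> ('a, 'e) tvec \<Rightarrow> real) \<Rightarrow>
   ('a \<Rightarrow> ('a, 'e) tvec \<Rightarrow> ('a, 'e) tvec) \<Rightarrow> ('a \<Rightarrow> real) \<Rightarrow>
   real set \<Rightarrow> (real \<Rightarrow> 'a) \<Rightarrow> bool" where
  "trajectory_on A g F V I \<gamma> \<longleftrightarrow>
     open I \<and> is_interval I \<and> I \<noteq> {} \<and> smooth_curve A I \<gamma> \<and>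
     (\<forall>t\<in>I. covariant_derivative A g \<gamma> (velocity A \<gamma>) t =
        (\<lambda>c. F (\<gamma> t) (velocity A \<gamma> t) c - gradient A g V (\<gamma> t) c))"

definition inextensible_trajectory ::
  "('a::topological_space, 'e::euclidean_space) chart set \<Rightarrow>
   ('a \<Rightarrow> ('a, 'e) tvec \<Rightarrow> ('a, 'e) tvec \<Rightarrow> real) \<Rightarrow>
   ('a \<Rightarrow> ('a, 'e) tvec \<Rightarrow> ('a, 'e) tvec) \<Rightarrow> ('a \<Rightarrow> real) \<Rightarrow>
   real set \<Rightarrow> (real \<Rightarrow> 'a) \<Rightarrow> bool" where
  "inextensible_trajectory A g F V I \<gamma> \<longleftrightarrow>
     trajectory_on A g F V I \<gamma> \<and>
     (\<forall>J \<delta>. trajectory_on A g F V J \<delta> \<longrightarrow> I \<subseteq> J \<longrightarrow> (\<forall>t\<in>I. \<delta> t = \<gamma> t) \<longrightarrow> J = I)"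

end

theory Submission
  imports Defs
begin

text \<open>Along a trajectory the energy \<open>g(\<gamma>', \<gamma>') / 2 + V\<close> is constant. Since \<open>F\<close> is skew-adjoint, \<open>F K = 0\<close>
  and \<open>K\<close> is conformal Killing with factor \<open>\<sigma>\<close>, the function \<open>g(K, \<gamma>')\<close> has derivative
  \<open>\<sigma> g(\<gamma>', \<gamma>') - dV(K)\<close>. By compactness both \<open>g(\<gamma>', \<gamma>')\<close> and \<open>g(K, \<gamma>')\<close> stay bounded on bounded
  intervals, and as \<open>K\<close> is timelike this bounds \<open>\<gamma>'\<close> in coordinates. Hence at a finite end of its
  interval a trajectory converges together with its velocity, and a local solution through the limit
  extends it to the right. Reversing time, which replaces \<open>F\<close> by \<open>-F\<close>, gives the other end. No uniqueness
  of solutions is needed: the glued curve is \<open>C\<^sup>1\<close> in phase space, hence smooth by bootstrapping, and it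
  solves the equation in every chart because both sides are tangent vectors.\<close>

section \<open>Calculus of smooth maps\<close>

text \<open>The obstacle is the indefinite signature: a bound on
  \<open>g(\<gamma>', \<gamma>')\<close> still lets the velocity run off along the light cone, so
  compactness of the manifold does not confine the velocity. The second quantity
  \<open>g(K, \<gamma>')\<close> closes this gap, because the orthogonal complement of a timelike
  vector is spacelike. Its derivative contains \<open>g(\<gamma>', \<gamma>')\<close>, which the
  energy has already bounded; the resulting bound grows linearly in time, which is enough towards a
  finite end. The position need not converge a priori. It only accumulates at some point; one chart
  around that point is fixed, the speed is bounded on a closed ball of this chart, and the
  trajectory is picked up so late that the remaining time is too short to leave the ball.
  Christoffel symbols and gradient are given only as unique solutions of linear equations with a
  nondegenerate form. Their smoothness therefore rests on smooth dependence of solutions of linear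
  systems. Symmetry of second derivatives yields the coordinate change law of the connection, which
  makes the covariant acceleration a tangent vector.\<close>

lemma higher_differentiable_on_Suc_has_derivative:
  "higher_differentiable_on S f (Suc n) \<Longrightarrow> x \<in> S \<Longrightarrow>
    (f has_derivative frechet_derivative f (at x)) (at x)"
  by (metis frechet_derivative_works higher_differentiable_on.simps(2))

lemma higher_differentiable_on_imp_continuous_on:
  "higher_differentiable_on S f n \<Longrightarrow> continuous_on S f"
  by (cases n) (auto intro!: continuous_at_imp_continuous_on dest: differentiable_imp_continuous_within)

lemma higher_differentiable_on_SucD:
  "higher_differentiable_on S f (Suc n) \<Longrightarrow> higher_differentiable_on S f n"
proof (induction n arbitrary: f)
  case 0
  then show ?case by (metis higher_differentiable_on_imp_continuous_on higher_differentiable_on.simps(1))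
next
  case (Suc n)
  then show ?case by (metis higher_differentiable_on.simps(2))
qed

lemma higher_differentiable_on_subset:
  "higher_differentiable_on S f n \<Longrightarrow> T \<subseteq> S \<Longrightarrow> higher_differentiable_on T f n"
  by (induction n arbitrary: f) (auto intro: continuous_on_subset)

lemma higher_differentiable_on_cong:
  assumes "open S" and "higher_differentiable_on S f n" and "\<And>x. x \<in> S \<Longrightarrow> f x = g x"
  shows "higher_differentiable_on S g n"
  using assms(2,3)
proof (induction n arbitrary: f g)
  case 0
  then show ?case by (simp cong: continuous_on_cong)
next
  case (Suc n)
  have d: "(g has_derivative frechet_derivative f (at x)) (at x)" if "x \<in> S" for x
    by (rule has_derivative_transform_within_open
        [OF higher_differentiable_on_Suc_has_derivative[OF Suc.prems(1) that] assms(1) that])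
      (rule Suc.prems(2))
  have "higher_differentiable_on S (\<lambda>x. frechet_derivative g (at x) v) n" for v
    by (rule Suc.IH[of "\<lambda>x. frechet_derivative f (at x) v"])
      (use Suc.prems d frechet_derivative_at in \<open>fastforce+\<close>)
  then show ?case using d by (auto simp: differentiable_def)
qed

text \<open>All derivatives are taken with \<open>at x\<close>, so the function to be differentiated
  next is the same for every neighbourhood \<open>U\<close>, and the induction can treat it with the
  same local hypothesis.\<close>

lemma higher_differentiable_on_locally:
  assumes "\<And>x. x \<in> S \<Longrightarrow> \<exists>U. open U \<and> x \<in> U \<and> higher_differentiable_on U f n"
  shows "higher_differentiable_on S f n"
  using assms
proof (induction n arbitrary: f)
  case 0
  have "continuous (at x) f" if x: "x \<in> S" for x
    using 0[OF x] by (auto simp: continuous_on_eq_continuous_at)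
  then show ?case by (simp add: continuous_at_imp_continuous_on)
next
  case (Suc n)
  have "f differentiable (at x)" if "x \<in> S" for x
    using Suc.prems[OF that] by auto
  moreover have "higher_differentiable_on S (\<lambda>x. frechet_derivative f (at x) v) n" for v
    by (rule Suc.IH) (use Suc.prems in \<open>fastforce\<close>)
  ultimately show ?case by simp
qed

lemma higher_differentiable_on_SucI:
  assumes "open S" and "\<And>x. x \<in> S \<Longrightarrow> (f has_derivative D x) (at x)"
    and "\<And>v. higher_differentiable_on S (\<lambda>x. D x v) n"
  shows "higher_differentiable_on S f (Suc n)"
proof -
  have "higher_differentiable_on S (\<lambda>x. frechet_derivative f (at x) v) n" for v
    by (rule higher_differentiable_on_cong[OF assms(1) assms(3)[of v]])
      (use assms(2) frechet_derivative_at in metis)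
  then show ?thesis using assms(2) by (auto simp: differentiable_def)
qed

lemma higher_differentiable_on_const: "higher_differentiable_on S (\<lambda>x. c) n"
  by (induction n arbitrary: c) auto

lemma higher_differentiable_on_add:
  assumes "open S" and "higher_differentiable_on S f n" and "higher_differentiable_on S g n"
  shows "higher_differentiable_on S (\<lambda>x. f x + g x) n"
  using assms(2,3)
proof (induction n arbitrary: f g)
  case 0
  then show ?case by (auto intro: continuous_on_add)
next
  case (Suc n)
  show ?case
    by (rule higher_differentiable_on_SucI[OF assms(1) has_derivative_add
          [OF Suc.prems[THEN higher_differentiable_on_Suc_has_derivative]]])
      (use Suc in auto)
qed

lemma (in bounded_linear) higher_differentiable_on:
  assumes "open S" and "higher_differentiable_on S g n"
  shows "higher_differentiable_on S (\<lambda>x. f (g x)) n"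
  using assms(2)
proof (induction n arbitrary: g)
  case 0
  then show ?case by (auto intro: continuous_on)
next
  case (Suc n)
  show ?case
    by (rule higher_differentiable_on_SucI[OF assms(1) has_derivative
          [OF Suc.prems[THEN higher_differentiable_on_Suc_has_derivative]]])
      (use Suc in auto)
qed

lemma (in bounded_bilinear) higher_differentiable_on:
  assumes "open S" and "higher_differentiable_on S f n" and "higher_differentiable_on S g n"
  shows "higher_differentiable_on S (\<lambda>x. prod (f x) (g x)) n"
  using assms(2,3)
proof (induction n arbitrary: f g)
  case 0
  then show ?case by (auto intro: continuous_on)
next
  case (Suc n)
  show ?case
    by (rule higher_differentiable_on_SucI[OF assms(1) FDERIV
          [OF Suc.prems[THEN higher_differentiable_on_Suc_has_derivative]]])
      (use Suc Suc.prems[THEN higher_differentiable_on_SucD] in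
        \<open>auto intro!: higher_differentiable_on_add assms\<close>)
qed

lemma higher_differentiable_on_sum:
  assumes "open S" and "\<And>i. i \<in> I \<Longrightarrow> higher_differentiable_on S (f i) n"
  shows "higher_differentiable_on S (\<lambda>x. \<Sum>i\<in>I. f i x) n"
  using assms(2)
  by (induction I rule: infinite_finite_induct)
    (auto intro!: higher_differentiable_on_add assms(1) higher_differentiable_on_const)

lemma linear_eq_sum_Basis:
  fixes f :: "'a::euclidean_space \<Rightarrow> 'b::real_vector"
  assumes "linear f"
  shows "f x = (\<Sum>i\<in>Basis. (x \<bullet> i) *\<^sub>R f i)"
proof -
  have "f x = f (\<Sum>i\<in>Basis. (x \<bullet> i) *\<^sub>R i)" by (simp add: euclidean_representation)
  then show ?thesis using assms by (simp add: linear_sum linear_scale)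
qed

text \<open>The definition controls derivatives only in fixed directions. For a direction
  \<open>h x\<close> that moves with the point, linearity reduces to the basis directions, with the
  coordinates of \<open>h x\<close> as smooth coefficients.\<close>

lemma higher_differentiable_on_directional:
  fixes f :: "'a::euclidean_space \<Rightarrow> 'b::real_normed_vector"
  assumes "open S" and "higher_differentiable_on S f (Suc n)" and "higher_differentiable_on S h n"
  shows "higher_differentiable_on S (\<lambda>x. frechet_derivative f (at x) (h x)) n"
proof (rule higher_differentiable_on_cong[OF assms(1)])
  show "higher_differentiable_on S
      (\<lambda>x. \<Sum>i\<in>Basis. (h x \<bullet> i) *\<^sub>R frechet_derivative f (at x) i) n"
    using assms(2) by (intro higher_differentiable_on_sum assms
        bounded_linear.higher_differentiable_on[OF bounded_linear_inner_left]
        bounded_bilinear.higher_differentiable_on[OF bounded_bilinear_scaleR]) auto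
  fix x assume "x \<in> S"
  then have "linear (frechet_derivative f (at x))"
    using assms(2) by (simp add: linear_frechet_derivative)
  then show "(\<Sum>i\<in>Basis. (h x \<bullet> i) *\<^sub>R frechet_derivative f (at x) i) =
      frechet_derivative f (at x) (h x)"
    by (rule linear_eq_sum_Basis[symmetric])
qed

text \<open>For linear \<open>L\<close> the derivative of \<open>f (L x)\<close> in direction
  \<open>v\<close> is the derivative of \<open>f\<close> in the fixed direction \<open>L v\<close>,
  again composed with \<open>L\<close>. The induction thus stays within statements of the same
  shape.\<close>

lemma higher_differentiable_on_compose_linear:
  assumes "bounded_linear L" and "open S" and "higher_differentiable_on S f n"
  shows "higher_differentiable_on (L -` S) (\<lambda>x. f (L x)) n"
  using assms(3)
proof (induction n arbitrary: f)
  case 0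
  have "continuous_on (L -` S) L"
    using assms(1) by (simp add: linear_continuous_on)
  with 0 show ?case
    by (auto intro!: continuous_on_compose2[of S f])
next
  case (Suc n)
  have o: "open (L -` S)"
    using assms(1,2) linear_continuous_on open_vimage by blast
  show ?case
  proof (rule higher_differentiable_on_SucI[OF o])
    fix x assume "x \<in> L -` S"
    then have "(f has_derivative frechet_derivative f (at (L x))) (at (L x))"
      using Suc.prems by (simp add: frechet_derivative_works[symmetric])
    then show "((\<lambda>x. f (L x)) has_derivative (\<lambda>v. frechet_derivative f (at (L x)) (L v))) (at x)"
      using has_derivative_compose[OF bounded_linear_imp_has_derivative[OF assms(1)]] by blast
  next
    fix v
    show "higher_differentiable_on (L -` S) (\<lambda>x. frechet_derivative f (at (L x)) (L v)) n"
      using Suc.IH[of "\<lambda>y. frechet_derivative f (at y) (L v)"] Suc.prems by simp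
  qed
qed

section \<open>Closure rules for smooth maps\<close>

lemma smooth_onI: "(\<And>n. higher_differentiable_on S f n) \<Longrightarrow> smooth_on S f"
  by (simp add: smooth_on_def)

lemma smooth_on_higher: "smooth_on S f \<Longrightarrow> higher_differentiable_on S f n"
  by (simp add: smooth_on_def)

lemma smooth_on_continuous_on: "smooth_on S f \<Longrightarrow> continuous_on S f"
  using higher_differentiable_on_imp_continuous_on smooth_on_higher by blast

lemma smooth_on_has_derivative:
  "smooth_on S f \<Longrightarrow> x \<in> S \<Longrightarrow> (f has_derivative frechet_derivative f (at x)) (at x)"
  by (meson higher_differentiable_on_Suc_has_derivative smooth_on_higher)

lemma smooth_on_differentiable: "smooth_on S f \<Longrightarrow> x \<in> S \<Longrightarrow> f differentiable (at x)"
  using smooth_on_has_derivative differentiable_def by blast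

lemma smooth_on_frechet_derivative:
  "smooth_on S f \<Longrightarrow> smooth_on S (\<lambda>x. frechet_derivative f (at x) v)"
  unfolding smooth_on_def by (metis higher_differentiable_on.simps(2))

lemma smooth_on_subset: "smooth_on S f \<Longrightarrow> T \<subseteq> S \<Longrightarrow> smooth_on T f"
  unfolding smooth_on_def using higher_differentiable_on_subset by blast

lemma smooth_on_cong:
  "open S \<Longrightarrow> smooth_on S f \<Longrightarrow> (\<And>x. x \<in> S \<Longrightarrow> f x = g x) \<Longrightarrow> smooth_on S g"
  unfolding smooth_on_def using higher_differentiable_on_cong by blast

lemma smooth_on_locally:
  "(\<And>x. x \<in> S \<Longrightarrow> \<exists>U. open U \<and> x \<in> U \<and> smooth_on U f) \<Longrightarrow> smooth_on S f"
  by (rule smooth_onI, rule higher_differentiable_on_locally) (meson smooth_on_higher)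

lemma smooth_on_add:
  "open S \<Longrightarrow> smooth_on S f \<Longrightarrow> smooth_on S g \<Longrightarrow> smooth_on S (\<lambda>x. f x + g x)"
  by (simp add: smooth_on_def higher_differentiable_on_add)

lemma smooth_on_sum:
  "open S \<Longrightarrow> (\<And>i. i \<in> I \<Longrightarrow> smooth_on S (f i)) \<Longrightarrow> smooth_on S (\<lambda>x. \<Sum>i\<in>I. f i x)"
  by (simp add: smooth_on_def higher_differentiable_on_sum)

lemma (in bounded_linear) smooth_on:
  "open S \<Longrightarrow> smooth_on S g \<Longrightarrow> smooth_on S (\<lambda>x. f (g x))"
  by (simp add: smooth_on_def higher_differentiable_on)

lemma (in bounded_bilinear) smooth_on:
  "open S \<Longrightarrow> smooth_on S f \<Longrightarrow> smooth_on S g \<Longrightarrow> smooth_on S (\<lambda>x. prod (f x) (g x))"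
  by (simp add: smooth_on_def higher_differentiable_on)

lemma smooth_on_uminus: "open S \<Longrightarrow> smooth_on S f \<Longrightarrow> smooth_on S (\<lambda>x. - f x)"
  by (rule bounded_linear.smooth_on[OF bounded_linear_minus[OF bounded_linear_ident]])

lemma smooth_on_diff:
  "open S \<Longrightarrow> smooth_on S f \<Longrightarrow> smooth_on S g \<Longrightarrow> smooth_on S (\<lambda>x. f x - g x)"
  using smooth_on_add[of S f "\<lambda>x. - g x"] smooth_on_uminus[of S g] by simp

lemma smooth_on_directional:
  fixes f :: "'a::euclidean_space \<Rightarrow> 'b::real_normed_vector"
  shows "open S \<Longrightarrow> smooth_on S f \<Longrightarrow> smooth_on S h \<Longrightarrow>
    smooth_on S (\<lambda>x. frechet_derivative f (at x) (h x))"
  by (rule smooth_onI, rule higher_differentiable_on_directional) (simp_all only: smooth_on_higher)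

lemma smooth_on_compose_linear:
  "bounded_linear L \<Longrightarrow> open S \<Longrightarrow> smooth_on S f \<Longrightarrow> smooth_on (L -` S) (\<lambda>x. f (L x))"
  by (simp add: smooth_on_def higher_differentiable_on_compose_linear)

lemma smooth_on_ident: "open S \<Longrightarrow> smooth_on S (\<lambda>x. x)"
proof (rule smooth_onI)
  fix n assume "open S"
  then show "higher_differentiable_on S (\<lambda>x. x) n"
    by (cases n) (auto intro!: higher_differentiable_on_SucI higher_differentiable_on_const
        has_derivative_ident)
qed

section \<open>Linear systems depending smoothly on a point\<close>

text \<open>A factor tending to 0 times one of order \<open>norm h\<close> is of order less than
  \<open>norm h\<close>. Only continuity of \<open>a\<close> is required; this matters for solutions
  of linear systems, whose differentiability is still to be shown when they occur as the factor
  \<open>a\<close>.\<close>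

lemma has_derivative_mult_vanishing:
  fixes a :: "'a::real_normed_vector \<Rightarrow> real" and b :: "'a \<Rightarrow> 'b::real_normed_vector"
  assumes a: "continuous (at x) a" "a x = 0" and b: "b differentiable (at x)" "b x = 0"
  shows "((\<lambda>y. a y *\<^sub>R b y) has_derivative (\<lambda>v. 0)) (at x)"
proof -
  obtain B where B: "(b has_derivative B) (at x)" using b(1) by (auto simp: differentiable_def)
  define e where "e h = b (x + h) - b x - B h" for h
  have bl: "bounded_linear B" and
    e: "\<And>h. b (x + h) = b x + B h + e h" and el: "((\<lambda>h. norm (e h) / norm h) \<longlongrightarrow> 0) (at 0)"
    using B unfolding has_derivative_at e_def by auto
  obtain C where C: "\<And>h. norm (B h) \<le> norm h * C" using bounded_linear.bounded[OF bl] by blast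
  have "((\<lambda>h. \<bar>a (x + h)\<bar> * (C + norm (e h) / norm h)) \<longlongrightarrow> 0 * (C + 0)) (at 0)"
  proof (intro tendsto_intros el)
    have "((\<lambda>h. a (x + h)) \<longlongrightarrow> a x) (at 0)"
      using a(1) by (simp add: LIM_offset_zero continuous_at)
    then show "((\<lambda>h. \<bar>a (x + h)\<bar>) \<longlongrightarrow> 0) (at 0)" using a(2) tendsto_rabs_zero by metis
  qed
  then have lim: "((\<lambda>h. \<bar>a (x + h)\<bar> * (C + norm (e h) / norm h)) \<longlongrightarrow> 0) (at 0)" by simp
  have "((\<lambda>h. norm (a (x + h) *\<^sub>R b (x + h)) / norm h) \<longlongrightarrow> 0) (at 0)"
  proof (rule tendsto_sandwich[OF _ _ tendsto_const lim])
    show "\<forall>\<^sub>F h in at 0. norm (a (x + h) *\<^sub>R b (x + h)) / norm h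
        \<le> \<bar>a (x + h)\<bar> * (C + norm (e h) / norm h)"
    proof (rule eventually_at_filter[THEN iffD2], rule always_eventually, safe)
      fix h :: 'a assume h: "h \<noteq> 0"
      have "norm (b (x + h)) \<le> norm h * C + norm (e h)"
        using e[of h] b(2) C[of h] norm_triangle_ineq[of "B h" "e h"] by simp
      then have "norm (b (x + h)) / norm h \<le> C + norm (e h) / norm h"
        using h by (simp add: field_simps)
      then have "\<bar>a (x + h)\<bar> * (norm (b (x + h)) / norm h)
          \<le> \<bar>a (x + h)\<bar> * (C + norm (e h) / norm h)"
        by (intro mult_left_mono) auto
      then show "norm (a (x + h) *\<^sub>R b (x + h)) / norm h
          \<le> \<bar>a (x + h)\<bar> * (C + norm (e h) / norm h)" by simp
    qed
  qed auto
  then show ?thesis unfolding has_derivative_at by (simp add: b(2) bounded_linear_zero)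
qed

text \<open>Injectivity bounds \<open>M x0\<close> below by some \<open>c\<close>. Near
  \<open>x0\<close> the operator \<open>M x\<close> differs from it by less than
  \<open>c / 2\<close>, hence is bounded below by \<open>c / 2\<close>, and
  \<open>M x (h x - h x0) = k x - M x (h x0)\<close> tends to 0.\<close>

lemma linear_system_solution_continuous:
  fixes M :: "'a::real_normed_vector \<Rightarrow> 'e::euclidean_space \<Rightarrow> 'e"
  assumes S: "open S" "x0 \<in> S"
    and lin: "\<And>x. x \<in> S \<Longrightarrow> linear (M x)" and inj: "inj (M x0)"
    and M: "\<And>u. continuous (at x0) (\<lambda>x. M x u)" and k: "continuous (at x0) k"
    and h: "\<And>x. x \<in> S \<Longrightarrow> M x (h x) = k x"
  shows "continuous (at x0) h"
proof -
  obtain c where c: "c > 0" "\<And>u. c * norm u \<le> norm (M x0 u)"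
    using linear_inj_bounded_below_pos[OF lin[OF S(2)] inj] by blast
  define m where "m x = (\<Sum>i\<in>Basis. norm (M x i - M x0 i))" for x
  have "(m \<longlongrightarrow> (\<Sum>i\<in>(Basis::'e set). norm (M x0 i - M x0 i))) (at x0)"
    unfolding m_def
    by (intro tendsto_sum tendsto_norm tendsto_diff tendsto_const M[unfolded continuous_at])
  then have "(m \<longlongrightarrow> 0) (at x0)" by simp
  then have m_small: "\<forall>\<^sub>F x in at x0. m x < c / 2"
    using c(1) by (metis half_gt_zero order_tendstoD(2))
  have inS: "\<forall>\<^sub>F x in at x0. x \<in> S" using S by (simp add: eventually_at_in_open')
  have bound: "norm (M x u - M x0 u) \<le> m x * norm u" if "x \<in> S" for x u
  proof -
    have "linear (\<lambda>u. M x u - M x0 u)"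
      by (intro linear_compose_sub lin that S(2))
    then have "M x u - M x0 u = (\<Sum>i\<in>Basis. (u \<bullet> i) *\<^sub>R (M x i - M x0 i))"
      by (rule linear_eq_sum_Basis)
    also have "norm \<dots> \<le> (\<Sum>i\<in>Basis. norm ((u \<bullet> i) *\<^sub>R (M x i - M x0 i)))" by (rule norm_sum)
    also have "\<dots> \<le> (\<Sum>i\<in>Basis. norm (M x i - M x0 i) * norm u)"
      by (rule sum_mono) (metis Basis_le_norm mult.commute mult_left_mono norm_ge_zero norm_scaleR)
    finally show ?thesis by (simp add: m_def sum_distrib_right)
  qed
  have "((\<lambda>x. 2 / c * norm (k x - M x (h x0))) \<longlongrightarrow> 2 / c * norm (k x0 - M x0 (h x0))) (at x0)"
    by (intro tendsto_intros M[unfolded continuous_at] k[unfolded continuous_at])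
  then have lim: "((\<lambda>x. 2 / c * norm (k x - M x (h x0))) \<longlongrightarrow> 0) (at x0)"
    using h[OF S(2)] by simp
  have "((\<lambda>x. h x - h x0) \<longlongrightarrow> 0) (at x0)"
  proof (rule Lim_null_comparison[OF _ lim])
    show "\<forall>\<^sub>F x in at x0. norm (h x - h x0) \<le> 2 / c * norm (k x - M x (h x0))"
      using m_small inS
    proof eventually_elim
      case (elim x)
      let ?w = "h x - h x0"
      have "c * norm ?w \<le> norm (M x0 ?w)" by (rule c)
      also have "\<dots> \<le> norm (M x ?w) + norm (M x ?w - M x0 ?w)"
        by (metis norm_minus_commute norm_triangle_sub)
      also have "\<dots> \<le> norm (M x ?w) + c / 2 * norm ?w"
        using bound[OF elim(2), of ?w] mult_right_mono[of "m x" "c / 2" "norm ?w"] elim(1) by force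
      finally have "c / 2 * norm ?w \<le> norm (M x ?w)" by (simp add: field_simps)
      also have "M x ?w = k x - M x (h x0)"
        using h[OF elim(2)] lin[OF elim(2)] by (simp add: linear_diff)
      finally show ?case using c(1) by (simp add: field_simps)
    qed
  qed
  then show ?thesis by (simp add: continuous_at LIM_zero_iff)
qed

text \<open>There is the exact identity \<open>M x0 (h x - h x0) = k x - M x (h x0) - r x\<close>
  with \<open>r x = (M x - M x0) (h x - h x0)\<close>. The right-hand side is differentiable and a
  left inverse of \<open>M x0\<close> recovers \<open>h\<close>.\<close>

lemma linear_system_solution_differentiable:
  fixes M :: "'a::real_normed_vector \<Rightarrow> 'e::euclidean_space \<Rightarrow> 'e"
  assumes S: "open S" "x0 \<in> S"
    and lin: "\<And>x. x \<in> S \<Longrightarrow> linear (M x)" and inj: "inj (M x0)"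
    and M: "\<And>u. (\<lambda>x. M x u) differentiable (at x0)" and k: "k differentiable (at x0)"
    and h: "\<And>x. x \<in> S \<Longrightarrow> M x (h x) = k x"
  shows "h differentiable (at x0)"
proof -
  have cont: "continuous (at x0) h"
    by (rule linear_system_solution_continuous[where M=M and h=h and k=k, OF S lin inj _ _ h])
      (auto intro: M k differentiable_imp_continuous_within)
  obtain N where N: "linear N" "N \<circ> M x0 = id"
    using linear_injective_left_inverse[OF lin[OF S(2)] inj] by blast
  \<comment> \<open>Expanded in the basis, each summand is a continuous factor vanishing at
    \<open>x0\<close> times a differentiable one vanishing at \<open>x0\<close>, so that
    \<open>r\<close> has derivative 0 there.\<close>
  define r where
    "r x = (\<Sum>i\<in>Basis. ((h x - h x0) \<bullet> i) *\<^sub>R (M x i - M x0 i))" for x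
  have "(r has_derivative (\<lambda>v. \<Sum>i\<in>(Basis::'e set). 0)) (at x0)"
    unfolding r_def
  proof (intro has_derivative_sum has_derivative_mult_vanishing)
    show "continuous (at x0) (\<lambda>x. (h x - h x0) \<bullet> i)" for i
      by (intro continuous_intros cont)
    show "(\<lambda>x. M x i - M x0 i) differentiable at x0" for i
      by (intro differentiable_diff M) auto
  qed auto
  then have r: "r differentiable (at x0)" using differentiable_def by blast
  have "(\<lambda>x. k x - M x (h x0) - r x) differentiable (at x0)"
    by (intro differentiable_diff k M r)
  then obtain Q where Q: "((\<lambda>x. k x - M x (h x0) - r x) has_derivative Q) (at x0)"
    unfolding differentiable_def ..
  have "((\<lambda>x. h x0 + N (k x - M x (h x0) - r x)) has_derivative (\<lambda>v. 0 + N (Q v))) (at x0)"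
    by (intro has_derivative_add has_derivative_const bounded_linear.has_derivative[OF _ Q]
        linear_conv_bounded_linear[THEN iffD1, OF N(1)])
  moreover have "h x0 + N (k x - M x (h x0) - r x) = h x" if "x \<in> S" for x
  proof -
    have "linear (\<lambda>u. M x u - M x0 u)"
      by (intro linear_compose_sub lin that S(2))
    then have "r x = M x (h x - h x0) - M x0 (h x - h x0)"
      unfolding r_def by (rule linear_eq_sum_Basis[symmetric])
    then have "k x - M x (h x0) - r x = M x0 (h x - h x0)"
      using h[OF that] lin[OF that] by (simp add: linear_diff)
    moreover have "N (M x0 u) = u" for u using N(2) by (simp add: fun_eq_iff)
    ultimately show ?thesis by simp
  qed
  ultimately have "(h has_derivative (\<lambda>v. 0 + N (Q v))) (at x0)"
    using has_derivative_transform_within_open[OF _ S] by blast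
  then show ?thesis by (rule differentiableI)
qed

text \<open>Differentiating \<open>M x (h x) = k x\<close> shows that a directional derivative of
  \<open>h\<close> solves a system with the same operator \<open>M\<close> and a new right-hand
  side, built from \<open>k\<close>, \<open>h\<close> and derivatives of \<open>M\<close>. Hence the
  induction generalises over \<open>k\<close> and \<open>h\<close> only.\<close>

lemma higher_differentiable_on_linear_system:
  fixes M :: "'a::real_normed_vector \<Rightarrow> 'e::euclidean_space \<Rightarrow> 'e"
  assumes S: "open S"
    and lin: "\<And>x. x \<in> S \<Longrightarrow> linear (M x)" and inj: "\<And>x. x \<in> S \<Longrightarrow> inj (M x)"
    and "\<And>u. higher_differentiable_on S (\<lambda>x. M x u) n" and "higher_differentiable_on S k n"
    and "\<And>x. x \<in> S \<Longrightarrow> M x (h x) = k x"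
  shows "higher_differentiable_on S h n"
  using assms(4-)
proof (induction n arbitrary: k h)
  case 0
  have "continuous (at x) h" if "x \<in> S" for x
    by (rule linear_system_solution_continuous[where M=M and h=h and k=k, OF S that lin inj[OF that] _ _ 0(3)])
      (use 0 S that in \<open>auto simp: continuous_on_eq_continuous_at\<close>)
  then show ?case by (simp add: continuous_at_imp_continuous_on)
next
  case (Suc n)
  have diff: "h differentiable (at x)" if "x \<in> S" for x
    by (rule linear_system_solution_differentiable[where M=M and h=h and k=k, OF S that lin inj[OF that] _ _ Suc.prems(3)])
      (use Suc.prems that in auto)
  have hn: "higher_differentiable_on S h n"
    by (rule Suc.IH[OF higher_differentiable_on_SucD higher_differentiable_on_SucD])
      (use Suc.prems in auto)
  have "higher_differentiable_on S (\<lambda>x. frechet_derivative h (at x) v) n" for v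
  proof (rule Suc.IH)
    show "higher_differentiable_on S (\<lambda>x. M x u) n" for u
      using Suc.prems(1) higher_differentiable_on_SucD by blast
    show "higher_differentiable_on S (\<lambda>x. frechet_derivative k (at x) v +
       - (\<Sum>i\<in>Basis. (h x \<bullet> i) *\<^sub>R frechet_derivative (\<lambda>x. M x i) (at x) v)) n"
      using Suc.prems by (intro higher_differentiable_on_add S higher_differentiable_on_sum hn
        bounded_linear.higher_differentiable_on[OF bounded_linear_inner_left]
        bounded_linear.higher_differentiable_on[OF bounded_linear_minus[OF bounded_linear_ident]]
        bounded_bilinear.higher_differentiable_on[OF bounded_bilinear_scaleR]) auto
    fix x assume x: "x \<in> S"
    let ?H = "frechet_derivative h (at x)"
    let ?M = "\<lambda>i. frechet_derivative (\<lambda>x. M x i) (at x)"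
    have H: "(h has_derivative ?H) (at x)" using diff[OF x] by (simp add: frechet_derivative_works)
    have Mi: "((\<lambda>x. M x i) has_derivative ?M i) (at x)" for i
      using Suc.prems(1)[of i] x by (simp add: frechet_derivative_works[symmetric])
    have "((\<lambda>x. \<Sum>i\<in>Basis. (h x \<bullet> i) *\<^sub>R M x i) has_derivative
       (\<lambda>v. \<Sum>i\<in>Basis. (h x \<bullet> i) *\<^sub>R ?M i v + (?H v \<bullet> i) *\<^sub>R M x i)) (at x)"
      by (intro has_derivative_sum has_derivative_scaleR has_derivative_inner_left H Mi)
    then have "(k has_derivative
       (\<lambda>v. \<Sum>i\<in>Basis. (h x \<bullet> i) *\<^sub>R ?M i v + (?H v \<bullet> i) *\<^sub>R M x i)) (at x)"
      by (rule has_derivative_transform_within_open[OF _ S x])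
        (metis Suc.prems(3) lin linear_eq_sum_Basis)
    from frechet_derivative_at[OF this, symmetric] have "frechet_derivative k (at x) v =
        (\<Sum>i\<in>Basis. (h x \<bullet> i) *\<^sub>R ?M i v + (?H v \<bullet> i) *\<^sub>R M x i)"
      by simp
    also have "\<dots> = (\<Sum>i\<in>Basis. (h x \<bullet> i) *\<^sub>R ?M i v) + M x (?H v)"
      using linear_eq_sum_Basis[OF lin[OF x], of "?H v"] by (simp add: sum.distrib)
    finally show "M x (?H v) = frechet_derivative k (at x) v + - (\<Sum>i\<in>Basis. (h x \<bullet> i) *\<^sub>R ?M i v)"
      by simp
  qed
  then show ?case using diff by simp
qed

lemma smooth_on_linear_system:
  fixes M :: "'a::real_normed_vector \<Rightarrow> 'e::euclidean_space \<Rightarrow> 'e"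
  assumes "open S"
    and "\<And>x. x \<in> S \<Longrightarrow> linear (M x)" and "\<And>x. x \<in> S \<Longrightarrow> inj (M x)"
    and "\<And>u. smooth_on S (\<lambda>x. M x u)" and "smooth_on S k"
    and "\<And>x. x \<in> S \<Longrightarrow> M x (h x) = k x"
  shows "smooth_on S h"
proof (rule smooth_onI)
  fix n
  show "higher_differentiable_on S h n"
    by (rule higher_differentiable_on_linear_system[where M=M and h=h and k=k,
          OF assms(1-3) smooth_on_higher[OF assms(4)] smooth_on_higher[OF assms(5)] assms(6)])
qed

section \<open>Symmetry of second derivatives\<close>

lemma has_derivative_along_line:
  assumes "(f has_derivative D) (at (p + s *\<^sub>R u))"
  shows "((\<lambda>s. f (p + s *\<^sub>R u)) has_vector_derivative D u) (at s)"
proof -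
  have "((\<lambda>s. p + s *\<^sub>R u) has_vector_derivative u) (at s)"
    by (auto intro!: derivative_eq_intros)
  from vector_derivative_diff_chain_within[OF this, where g=f and g'=D] assms show ?thesis
    by (simp add: o_def has_derivative_at_withinI)
qed

text \<open>Second differences: both mixed derivatives are the limit of
  \<open>(f (x + hu + hv) - f (x + hu) - f (x + hv) + f x) / h\<^sup>2\<close>.\<close>

lemma second_difference_mean_value:
  fixes f :: "'a::real_normed_vector \<Rightarrow> real"
  assumes f: "\<And>y. y \<in> S \<Longrightarrow> (f has_derivative D y) (at y)"
    and D: "\<And>y. y \<in> S \<Longrightarrow> ((\<lambda>y. D y u) has_derivative Q y) (at y)"
    and h: "h > 0" and S: "\<And>s t. \<lbrakk>0 \<le> s; s \<le> h; 0 \<le> t; t \<le> h\<rbrakk> \<Longrightarrow> x + s *\<^sub>R u + t *\<^sub>R v \<in> S"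
  shows "\<exists>y\<in>S. f (x + h *\<^sub>R u + h *\<^sub>R v) - f (x + h *\<^sub>R u) - f (x + h *\<^sub>R v) + f x = h\<^sup>2 * Q y v"
proof -
  \<comment> \<open>The mean value theorem is used twice: for \<open>?\<phi>\<close> along
    \<open>u\<close>, and then, with the intermediate \<open>s\<close> fixed, for
    \<open>?\<psi>\<close> along \<open>v\<close>.\<close>
  let ?\<phi> = "\<lambda>s. f ((x + h *\<^sub>R v) + s *\<^sub>R u) - f (x + s *\<^sub>R u)"
  have "DERIV ?\<phi> s :> D (x + s *\<^sub>R u + h *\<^sub>R v) u - D (x + s *\<^sub>R u) u" if "0 \<le> s" "s \<le> h" for s
  proof -
    have "x + s *\<^sub>R u + h *\<^sub>R v \<in> S" "x + s *\<^sub>R u \<in> S"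
      using S[OF that, of h] S[OF that, of 0] h by auto
    then have "(f has_derivative D (x + s *\<^sub>R u + h *\<^sub>R v)) (at ((x + h *\<^sub>R v) + s *\<^sub>R u))"
      "(f has_derivative D (x + s *\<^sub>R u)) (at (x + s *\<^sub>R u))"
      using f[of "x + s *\<^sub>R u + h *\<^sub>R v"] f by (simp_all add: ac_simps)
    then show ?thesis
      unfolding has_real_derivative_iff_has_vector_derivative
      by (intro has_vector_derivative_diff has_derivative_along_line)
  qed
  from MVT2[OF h this] obtain s where s: "0 < s" "s < h" and
    "?\<phi> h - ?\<phi> 0 = (h - 0) * (D (x + s *\<^sub>R u + h *\<^sub>R v) u - D (x + s *\<^sub>R u) u)" by blast
  then have 1: "?\<phi> h - ?\<phi> 0 = h * (D (x + s *\<^sub>R u + h *\<^sub>R v) u - D (x + s *\<^sub>R u) u)" by simp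
  let ?\<psi> = "\<lambda>t. D ((x + s *\<^sub>R u) + t *\<^sub>R v) u"
  have "DERIV ?\<psi> t :> Q (x + s *\<^sub>R u + t *\<^sub>R v) v" if "0 \<le> t" "t \<le> h" for t
    unfolding has_real_derivative_iff_has_vector_derivative
    using has_derivative_along_line[OF D[OF S[of s t]]] s that by simp
  from MVT2[OF h this] obtain t where t: "0 < t" "t < h" and
    "?\<psi> h - ?\<psi> 0 = (h - 0) * Q (x + s *\<^sub>R u + t *\<^sub>R v) v" by blast
  with 1 have "?\<phi> h - ?\<phi> 0 = h\<^sup>2 * Q (x + s *\<^sub>R u + t *\<^sub>R v) v"
    by (simp add: power2_eq_square)
  moreover have "x + s *\<^sub>R u + t *\<^sub>R v \<in> S" using S s t by simp
  ultimately show ?thesis by (intro bexI[of _ "x + s *\<^sub>R u + t *\<^sub>R v"]) (auto simp: algebra_simps)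
qed

text \<open>The second difference is symmetric in \<open>u\<close> and \<open>v\<close>, so the mean
  value form gives points \<open>y\<close>, \<open>z\<close> arbitrarily close to \<open>x\<close>
  with \<open>Q u v y = Q v u z\<close>. Continuity of the two mixed derivatives then excludes
  different values at \<open>x\<close>.\<close>

lemma frechet_derivative_commute_real:
  fixes f :: "'a::real_normed_vector \<Rightarrow> real"
  assumes S: "open S" "x \<in> S" and f: "smooth_on S f"
  shows "frechet_derivative (\<lambda>y. frechet_derivative f (at y) u) (at x) v =
    frechet_derivative (\<lambda>y. frechet_derivative f (at y) v) (at x) u"
proof (rule ccontr)
  define Q where "Q u v y = frechet_derivative (\<lambda>y. frechet_derivative f (at y) u) (at y) v" for u v y
  assume "\<not> ?thesis"
  \<comment> \<open>Half of the supposed gap: each mixed derivative moves by less than this, so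
    together they cannot bridge it.\<close>
  then have e: "\<bar>Q u v x - Q v u x\<bar> / 2 > 0" (is "?e > 0") by (simp add: Q_def)
  have f1: "(f has_derivative frechet_derivative f (at y)) (at y)" if "y \<in> S" for y
    using smooth_on_has_derivative[OF f that] .
  have f2: "((\<lambda>y. frechet_derivative f (at y) u) has_derivative (\<lambda>v. Q u v y)) (at y)"
    if "y \<in> S" for y u
    unfolding Q_def using smooth_on_has_derivative[OF smooth_on_frechet_derivative[OF f] that] .
  have "continuous_on S (Q u v)" for u v
    unfolding Q_def by (intro smooth_on_continuous_on smooth_on_frechet_derivative f)
  then have "isCont (Q u v) x" for u v using S continuous_on_eq_continuous_at by blast
  then have "\<exists>d>0. \<forall>y. dist y x < d \<longrightarrow> dist (Q u v y) (Q u v x) < ?e" for u v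
    using e unfolding continuous_at_eps_delta by blast
  then obtain d1 d2 where d: "d1 > 0" "d2 > 0"
    and d1: "\<And>y. dist y x < d1 \<Longrightarrow> dist (Q u v y) (Q u v x) < ?e"
    and d2: "\<And>y. dist y x < d2 \<Longrightarrow> dist (Q v u y) (Q v u x) < ?e" by metis
  obtain r where r: "r > 0" "ball x r \<subseteq> S" using S openE by blast
  define R where "R = Min {d1, d2, r}"
  have R: "R > 0" "R \<le> d1" "R \<le> d2" "R \<le> r" using d r by (auto simp: R_def)
  \<comment> \<open>Small enough for the parallelogram with sides \<open>h u\<close>,
    \<open>h v\<close> to lie in \<open>ball x R\<close>; the summand 1 makes the estimate strict
    and the denominator positive.\<close>
  define h where "h = R / (norm u + norm v + 1)"
  have n0: "norm u + norm v + 1 > 0" by (simp add: add_nonneg_pos)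
  have h: "h > 0" using R n0 by (simp add: h_def)
  have inb: "x + s *\<^sub>R a + t *\<^sub>R b \<in> ball x R"
    if "0 \<le> s" "s \<le> h" "0 \<le> t" "t \<le> h" "(a, b) \<in> {(u, v), (v, u)}" for s t a b
  proof -
    have "dist x (x + s *\<^sub>R a + t *\<^sub>R b) = norm (s *\<^sub>R a + t *\<^sub>R b)"
      by (metis add.assoc add_diff_cancel_left' dist_commute dist_norm)
    also have "\<dots> \<le> s * norm a + t * norm b" using that norm_triangle_ineq[of "s *\<^sub>R a" "t *\<^sub>R b"] by simp
    also have "\<dots> \<le> h * norm a + h * norm b" using that by (intro add_mono mult_right_mono) auto
    also have "\<dots> = h * (norm u + norm v)" using that(5) by (auto simp: algebra_simps)
    also have "\<dots> < h * (norm u + norm v + 1)" using h by simp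
    also have "\<dots> = R" using n0 by (simp add: h_def)
    finally show ?thesis by simp
  qed
  have RS: "ball x R \<subseteq> S" using r(2) R(4) by (meson dual_order.trans subset_ball)
  have key: "\<exists>y\<in>ball x R. f (x + h *\<^sub>R a + h *\<^sub>R b) - f (x + h *\<^sub>R a) - f (x + h *\<^sub>R b) + f x
      = h\<^sup>2 * Q a b y" if "(a, b) \<in> {(u, v), (v, u)}" for a b
    by (rule second_difference_mean_value[where D="\<lambda>y. frechet_derivative f (at y)"])
      (use f1 f2 RS h inb that in blast)+
  obtain y where y: "y \<in> ball x R"
    "f (x + h *\<^sub>R u + h *\<^sub>R v) - f (x + h *\<^sub>R u) - f (x + h *\<^sub>R v) + f x = h\<^sup>2 * Q u v y"
    using key[of u v] by blast
  obtain z where z: "z \<in> ball x R"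
    "f (x + h *\<^sub>R v + h *\<^sub>R u) - f (x + h *\<^sub>R v) - f (x + h *\<^sub>R u) + f x = h\<^sup>2 * Q v u z"
    using key[of v u] by blast
  have "h\<^sup>2 * Q u v y = h\<^sup>2 * Q v u z"
    using y(2) z(2) by (simp add: algebra_simps)
  then have "Q u v y = Q v u z" using h by simp
  moreover have "\<bar>Q u v y - Q u v x\<bar> < ?e"
    using d1[of y] y(1) R(2) by (simp add: dist_real_def dist_commute)
  moreover have "\<bar>Q v u z - Q v u x\<bar> < ?e"
    using d2[of z] z(1) R(3) by (simp add: dist_real_def dist_commute)
  ultimately show False by (auto simp: abs_if split: if_splits)
qed

lemma frechet_derivative_bounded_linear:
  assumes "bounded_linear L" and "f differentiable (at x)"
  shows "frechet_derivative (\<lambda>y. L (f y)) (at x) v = L (frechet_derivative f (at x) v)"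
proof -
  have "((\<lambda>y. L (f y)) has_derivative (\<lambda>v. L (frechet_derivative f (at x) v))) (at x)"
    by (rule bounded_linear.has_derivative[OF assms(1) assms(2)[THEN frechet_derivative_works[THEN iffD1]]])
  from frechet_derivative_at[OF this, symmetric] show ?thesis by simp
qed

lemma frechet_derivative_commute:
  fixes f :: "'a::real_normed_vector \<Rightarrow> 'b::euclidean_space"
  assumes S: "open S" "x \<in> S" and f: "smooth_on S f"
  shows "frechet_derivative (\<lambda>y. frechet_derivative f (at y) u) (at x) v =
    frechet_derivative (\<lambda>y. frechet_derivative f (at y) v) (at x) u"
proof (rule euclidean_eqI)
  fix i :: 'b
  let ?D = "\<lambda>y. frechet_derivative f (at y)"
  have "frechet_derivative (\<lambda>y. ?D y u) (at x) v \<bullet> i =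
    frechet_derivative (\<lambda>y. frechet_derivative (\<lambda>y. f y \<bullet> i) (at y) u) (at x) v" for u v
  proof -
    have "frechet_derivative (\<lambda>y. ?D y u) (at x) v \<bullet> i = frechet_derivative (\<lambda>y. ?D y u \<bullet> i) (at x) v"
      by (rule frechet_derivative_bounded_linear[OF bounded_linear_inner_left, symmetric])
        (rule smooth_on_differentiable[OF smooth_on_frechet_derivative[OF f] S(2)])
    also have "frechet_derivative (\<lambda>y. ?D y u \<bullet> i) (at x) =
        frechet_derivative (\<lambda>y. frechet_derivative (\<lambda>y. f y \<bullet> i) (at y) u) (at x)"
    proof (rule frechet_derivative_transform_within_open[OF _ S])
      show "(\<lambda>y. ?D y u \<bullet> i) differentiable at x"
        by (rule smooth_on_differentiable[OF bounded_linear.smooth_on[OF bounded_linear_inner_left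
                S(1) smooth_on_frechet_derivative[OF f]] S(2)])
      show "?D y u \<bullet> i = frechet_derivative (\<lambda>y. f y \<bullet> i) (at y) u" if "y \<in> S" for y
        by (rule frechet_derivative_bounded_linear[OF bounded_linear_inner_left, symmetric])
          (rule smooth_on_differentiable[OF f that])
    qed
    finally show ?thesis .
  qed
  moreover have "smooth_on S (\<lambda>y. f y \<bullet> i)"
    by (rule bounded_linear.smooth_on[OF bounded_linear_inner_left S(1) f])
  ultimately show "frechet_derivative (\<lambda>y. ?D y u) (at x) v \<bullet> i
      = frechet_derivative (\<lambda>y. ?D y v) (at x) u \<bullet> i"
    using frechet_derivative_commute_real[OF S] by metis
qed

section \<open>Integral curves\<close>

text \<open>The bootstrapping: the derivative of \<open>f (z t)\<close> is
  \<open>(Df H) (z t)\<close>, a smooth function along the same curve, so induction over all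
  \<open>f\<close> applies. A general \<open>f\<close> is allowed in order to read the curve in
  other charts as well.\<close>

lemma smooth_on_compose_integral_curve:
  fixes z :: "real \<Rightarrow> 'a::euclidean_space"
  assumes T: "open T" and Z: "open Z" "smooth_on Z H" "smooth_on Z f"
    and z: "\<And>t. t \<in> T \<Longrightarrow> z t \<in> Z"
    and z': "\<And>t. t \<in> T \<Longrightarrow> (z has_vector_derivative H (z t)) (at t)"
  shows "smooth_on T (\<lambda>t. f (z t))"
proof (rule smooth_onI)
  fix n
  show "higher_differentiable_on T (\<lambda>t. f (z t)) n"
    using Z(3)
  proof (induction n arbitrary: f)
    case 0
    have "continuous_on T z"
      using z' by (meson continuous_at_imp_continuous_on has_vector_derivative_continuous)
    then show ?case
      using z smooth_on_continuous_on[OF 0] by (auto intro: continuous_on_compose2)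
  next
    case (Suc n)
    let ?g = "\<lambda>x. frechet_derivative f (at x) (H x)"
    show ?case
    proof (rule higher_differentiable_on_SucI[OF T])
      show "((\<lambda>t. f (z t)) has_derivative (\<lambda>s. s *\<^sub>R ?g (z t))) (at t)" if "t \<in> T" for t
        using vector_derivative_diff_chain_within[OF z'[OF that], of f]
          smooth_on_has_derivative[OF Suc.prems z[OF that]]
        by (simp add: o_def has_derivative_at_withinI has_vector_derivative_def)
      show "higher_differentiable_on T (\<lambda>t. s *\<^sub>R ?g (z t)) n" for s
        by (intro bounded_linear.higher_differentiable_on[OF bounded_linear_scaleR_right T]
            Suc.IH smooth_on_directional Z Suc.prems)
    qed
  qed
qed

lemma smooth_on_lipschitz_on_compact_convex:
  fixes f :: "'a::euclidean_space \<Rightarrow> 'b::real_normed_vector"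
  assumes f: "smooth_on S f" and K: "compact K" "convex K" "K \<subseteq> S"
  shows "\<exists>L\<ge>0. \<forall>x\<in>K. \<forall>y\<in>K. norm (f x - f y) \<le> L * norm (x - y)"
proof -
  let ?D = "\<lambda>x. frechet_derivative f (at x)"
  have "continuous_on K (\<lambda>x. \<Sum>i\<in>Basis. norm (?D x i))"
    by (intro continuous_on_sum continuous_on_norm
        continuous_on_subset[OF smooth_on_continuous_on[OF smooth_on_frechet_derivative[OF f]] K(3)])
  then have "bounded ((\<lambda>x. \<Sum>i\<in>Basis. norm (?D x i)) ` K)"
    by (simp add: compact_continuous_image compact_imp_bounded K)
  then obtain L where "L > 0" "\<And>x. x \<in> K \<Longrightarrow> norm (\<Sum>i\<in>Basis. norm (?D x i)) \<le> L"
    unfolding bounded_pos by blast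
  then have L: "L > 0" "\<And>x. x \<in> K \<Longrightarrow> (\<Sum>i\<in>Basis. norm (?D x i)) \<le> L"
    by (simp_all add: sum_nonneg)
  have "norm (f x - f y) \<le> L * norm (x - y)" if "x \<in> K" "y \<in> K" for x y
  proof (rule differentiable_bound[OF K(2) _ _ that])
    fix x assume x: "x \<in> K"
    show d: "(f has_derivative ?D x) (at x within K)"
      using smooth_on_has_derivative[OF f] x K(3) has_derivative_at_withinI by blast
    show "onorm (?D x) \<le> L"
    proof (rule onorm_le)
      fix v
      have "?D x v = (\<Sum>i\<in>Basis. (v \<bullet> i) *\<^sub>R ?D x i)"
        using d has_derivative_linear linear_eq_sum_Basis by blast
      also have "norm \<dots> \<le> (\<Sum>i\<in>Basis. norm ((v \<bullet> i) *\<^sub>R ?D x i))" by (rule norm_sum)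
      also have "\<dots> \<le> (\<Sum>i\<in>Basis. norm (?D x i) * norm v)"
        by (rule sum_mono) (simp add: Basis_le_norm mult_right_mono mult.commute[of _ "norm v"])
      also have "\<dots> = (\<Sum>i\<in>Basis. norm (?D x i)) * norm v" by (simp add: sum_distrib_right)
      also have "\<dots> \<le> L * norm v" using L(2)[OF x] by (simp add: mult_right_mono)
      finally show "norm (?D x v) \<le> L * norm v" .
    qed
  qed
  then show ?thesis using L(1) by (intro exI[of _ L]) auto
qed

section \<open>Local existence and extension of integral curves\<close>

text \<open>Contraction principle for the integral operator. The interval starts at \<open>b\<close>
  because the solution is attached to a curve that already covers the time before
  \<open>b\<close>.\<close>

lemma picard_local_existence:
  fixes H :: "'a::euclidean_space \<Rightarrow> 'a"
  assumes Z: "open Z" "z0 \<in> Z" and H: "smooth_on Z H"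
  shows "\<exists>T>0. \<exists>z. z b = z0 \<and> (\<forall>t\<in>{b..b + T}. z t \<in> Z \<and>
           (z has_vector_derivative H (z t)) (at t within {b..b + T}))"
proof -
  obtain r where r: "r > 0" "cball z0 r \<subseteq> Z" using Z open_contains_cball by blast
  obtain L where L: "L \<ge> 0" "\<And>x y. \<lbrakk>x \<in> cball z0 r; y \<in> cball z0 r\<rbrakk> \<Longrightarrow> norm (H x - H y) \<le> L * norm (x - y)"
    using smooth_on_lipschitz_on_compact_convex[OF H compact_cball convex_cball r(2)] by blast
  have Hc: "continuous_on (cball z0 r) H"
    using smooth_on_continuous_on[OF H] r(2) continuous_on_subset by blast
  then have "bounded (H ` cball z0 r)"
    by (simp add: compact_continuous_image compact_imp_bounded)
  then obtain B where B: "B > 0" "\<And>x. x \<in> cball z0 r \<Longrightarrow> norm (H x) \<le> B"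
    unfolding bounded_pos by blast
  \<comment> \<open>The first bound keeps the image of the operator within the ball of radius
    \<open>r\<close>, the second makes the contraction factor at most \<open>1 / 2\<close>; the
    summand 1 covers \<open>L = 0\<close>.\<close>
  define T where "T = min (r / B) (1 / (2 * L + 1))"
  have T: "T > 0" "B * T \<le> r" "L * T \<le> 1 / 2"
  proof -
    show "T > 0" using r B L by (simp add: T_def)
    have "B * T \<le> B * (r / B)" using B by (intro mult_left_mono) (auto simp: T_def)
    then show "B * T \<le> r" using B by simp
    have "L * T \<le> L * (1 / (2 * L + 1))" using L by (intro mult_left_mono) (auto simp: T_def)
    also have "\<dots> \<le> 1 / 2" using L by (simp add: field_simps)
    finally show "L * T \<le> 1 / 2" .
  qed
  \<comment> \<open>A closed subset of a complete space of bounded continuous functions. These live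
    on all of the real line, although only the times in \<open>{b..b + T}\<close> matter.\<close>
  define X :: "(real \<Rightarrow>\<^sub>C 'a) set" where "X = PiC UNIV (\<lambda>_. cball z0 r)"
  have X: "x \<in> X \<longleftrightarrow> (\<forall>t. apply_bcontfun x t \<in> cball z0 r)" for x
    by (auto simp: X_def mem_PiC_iff)
  have Hx: "continuous_on A (\<lambda>s. H (apply_bcontfun x s))" if "x \<in> X" for x A
    by (rule continuous_on_compose2[OF Hc continuous_on_apply_bcontfun]) (use that in \<open>auto simp: X\<close>)
  let ?I = "\<lambda>x t. z0 + integral {b..t} (\<lambda>s. H (apply_bcontfun x s))"
  have Ic: "continuous_on (cbox b (b + T)) (?I x)" if "x \<in> X" for x
    by (intro continuous_intros, simp)
      (intro indefinite_integral_continuous_1 integrable_continuous_real Hx that)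
  \<comment> \<open>Outside \<open>{b..b + T}\<close> the integral is frozen at its end values by
    \<open>clamp\<close>, which makes it a bounded continuous function on the line.\<close>
  have "\<exists>g. \<forall>t. apply_bcontfun g t = ?I x (clamp b (b + T) t)" if "x \<in> X" for x
    using continuous_on_cbox_bcontfunE[OF Ic[OF that]] by metis
  then obtain \<Phi> where \<Phi>: "\<And>x t. x \<in> X \<Longrightarrow> apply_bcontfun (\<Phi> x) t = ?I x (clamp b (b + T) t)"
    by metis
  have clamp: "clamp b (b + T) t \<in> {b..b + T}" for t
    using clamp_in_interval[of b "b + T" t] T(1) by simp
  have "\<exists>!x\<in>X. \<Phi> x = x"
  proof (rule Banach_fix[of X "1 / 2"])
    show "complete X" unfolding X_def complete_eq_closed by (intro closed_PiC closed_cball)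
    have "const_bcontfun z0 \<in> X" using r by (simp add: X)
    then show "X \<noteq> {}" by blast
    show "\<Phi> ` X \<subseteq> X"
    proof
      fix y assume "y \<in> \<Phi> ` X"
      then obtain x where x: "x \<in> X" "y = \<Phi> x" by blast
      show "y \<in> X" unfolding X
      proof
        fix t
        let ?t = "clamp b (b + T) t"
        have "norm (integral {b..?t} (\<lambda>s. H (apply_bcontfun x s))) \<le> B * (?t - b)"
          by (rule integral_bound) (use clamp[of t] Hx x B X in auto)
        also have "\<dots> \<le> B * T" using clamp[of t] B by (intro mult_left_mono) auto
        also have "\<dots> \<le> r" by (rule T)
        finally show "apply_bcontfun y t \<in> cball z0 r"
          using \<Phi>[OF x(1)] x(2) by (simp add: dist_norm)
      qed
    qed
    fix x y assume x: "x \<in> X" and y: "y \<in> X"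
    show "dist (\<Phi> x) (\<Phi> y) \<le> 1 / 2 * dist x y"
    proof (rule dist_bound)
      fix t
      let ?t = "clamp b (b + T) t"
      have "dist (apply_bcontfun (\<Phi> x) t) (apply_bcontfun (\<Phi> y) t) =
          norm (integral {b..?t} (\<lambda>s. H (apply_bcontfun x s)) - integral {b..?t} (\<lambda>s. H (apply_bcontfun y s)))"
        by (simp add: \<Phi> x y dist_norm)
      also have "\<dots> = norm (integral {b..?t} (\<lambda>s. H (apply_bcontfun x s) - H (apply_bcontfun y s)))"
        by (subst Henstock_Kurzweil_Integration.integral_diff)
          (auto intro!: integrable_continuous_real Hx x y)
      also have "\<dots> \<le> (L * dist x y) * (?t - b)"
      proof (rule integral_bound)
        fix s
        have "norm (H (apply_bcontfun x s) - H (apply_bcontfun y s))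
            \<le> L * norm (apply_bcontfun x s - apply_bcontfun y s)"
          using L(2) x y X by blast
        also have "\<dots> \<le> L * dist x y"
          using L(1) dist_bounded[of x s y] by (intro mult_left_mono) (auto simp: dist_norm)
        finally show "norm (H (apply_bcontfun x s) - H (apply_bcontfun y s)) \<le> L * dist x y" .
      qed (use clamp[of t] Hx x y in \<open>auto intro: continuous_on_diff\<close>)
      also have "\<dots> \<le> (L * dist x y) * T"
        using clamp[of t] L(1) by (intro mult_left_mono) auto
      also have "\<dots> = (L * T) * dist x y" by simp
      also have "\<dots> \<le> 1 / 2 * dist x y" using T(3) by (intro mult_right_mono) auto
      finally show "dist (apply_bcontfun (\<Phi> x) t) (apply_bcontfun (\<Phi> y) t) \<le> 1 / 2 * dist x y" .
    qed
  qed auto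
  then obtain x where x: "x \<in> X" "\<Phi> x = x" by blast
  have fix_eq: "?I x t = apply_bcontfun x t" if "t \<in> {b..b + T}" for t
  proof -
    have "clamp b (b + T) t = t" using that by simp
    then show ?thesis using \<Phi>[OF x(1), of t] x(2) by simp
  qed
  have "(apply_bcontfun x has_vector_derivative H (apply_bcontfun x t)) (at t within {b..b + T})"
    if t: "t \<in> {b..b + T}" for t
  proof -
    have "((\<lambda>u. integral {b..u} (\<lambda>s. H (apply_bcontfun x s))) has_vector_derivative
        H (apply_bcontfun x t)) (at t within {b..b + T})"
      by (rule integral_has_vector_derivative[OF Hx[OF x(1)] t])
    then have "(?I x has_vector_derivative (0 + H (apply_bcontfun x t))) (at t within {b..b + T})"
      by (intro has_vector_derivative_add has_vector_derivative_const)
    then show ?thesis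
      using has_vector_derivative_transform[OF t, of "apply_bcontfun x" "?I x"] fix_eq by simp
  qed
  moreover have "apply_bcontfun x t \<in> Z" for t using x(1) r(2) X by blast
  moreover have "apply_bcontfun x b = z0" using fix_eq[of b] T(1) by simp
  ultimately show ?thesis using T(1) by blast
qed

text \<open>Meant for a gluing point \<open>b\<close>, where continuity of the curve and of the
  expected derivative is known. The fundamental theorem of calculus tolerates one exceptional point,
  so \<open>z\<close> is an integral of \<open>q\<close>, and this integral is differentiable at
  \<open>b\<close> too.\<close>

lemma has_vector_derivative_exceptional_point:
  fixes z :: "real \<Rightarrow> 'a::banach"
  assumes z: "continuous_on {a..d} z" and q: "continuous_on {a..d} q"
    and z': "\<And>t. t \<in> {a<..<d} - {b} \<Longrightarrow> (z has_vector_derivative q t) (at t)"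
    and t: "t \<in> {a<..<d}"
  shows "(z has_vector_derivative q t) (at t)"
proof -
  have hi: "(q has_integral z s - z a) {a..s}" if "s \<in> {a..d}" for s
    by (rule fundamental_theorem_of_calculus_interior_strong[of "{b}"])
      (use that z' in \<open>auto intro: continuous_on_subset[OF z]\<close>)
  then have eq: "z a + integral {a..s} q = z s" if "s \<in> {a..d}" for s
    using integral_unique[OF hi[OF that]] by simp
  have "((\<lambda>s. integral {a..s} q) has_vector_derivative q t) (at t within {a..d})"
    by (rule integral_has_vector_derivative[OF q]) (use t in auto)
  then have "((\<lambda>s. z a + integral {a..s} q) has_vector_derivative 0 + q t) (at t within {a..d})"
    by (intro has_vector_derivative_add has_vector_derivative_const)
  then have "(z has_vector_derivative q t) (at t within {a..d})"
    using has_vector_derivative_transform[of t "{a..d}" z, OF _ eq[symmetric]] t by auto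
  then have "(z has_vector_derivative q t) (at t within {a<..<d})"
    using has_vector_derivative_within_subset by (meson greaterThanLessThan_subseteq_atLeastAtMost_iff order_refl)
  then show ?thesis by (simp only: at_within_open[OF t open_greaterThanLessThan])
qed

text \<open>Bounded speed makes the curve Lipschitz, hence uniformly continuous, and completeness of
  the target provides the limit at the end point.\<close>

lemma lipschitz_limit_at_left:
  fixes x :: "real \<Rightarrow> 'a::banach"
  assumes ab: "a < b"
    and x': "\<And>t. t \<in> {a<..<b} \<Longrightarrow> (x has_vector_derivative x' t) (at t)"
    and B: "\<And>t. t \<in> {a<..<b} \<Longrightarrow> norm (x' t) \<le> B"
  shows "\<exists>l. (x \<longlongrightarrow> l) (at b within {a<..<b})"
proof -
  have "B \<ge> 0" by (rule order_trans[OF norm_ge_zero B[of "(a + b) / 2"]]) (use ab in simp)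
  have lip: "norm (x s - x t) \<le> B * norm (s - t)" if "s \<in> {a<..<b}" "t \<in> {a<..<b}" for s t
  proof (rule differentiable_bound[OF _ _ _ that])
    fix t assume t: "t \<in> {a<..<b}"
    show "(x has_derivative (\<lambda>h. h *\<^sub>R x' t)) (at t within {a<..<b})"
      using x'[OF t] by (simp add: has_vector_derivative_def has_derivative_at_withinI)
    show "onorm (\<lambda>h. h *\<^sub>R x' t) \<le> B"
      by (rule onorm_le) (use B[OF t] in \<open>simp add: mult.commute[of B] mult_left_mono\<close>)
  qed auto
  have "uniformly_continuous_on {a<..<b} x"
  proof (rule lipschitz_on_uniformly_continuous)
    show "B-lipschitz_on {a<..<b} x"
      by (rule lipschitz_onI) (use lip \<open>B \<ge> 0\<close> in \<open>auto simp: dist_norm\<close>)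
  qed
  moreover have "b \<in> closure {a<..<b}" using ab by simp
  ultimately show ?thesis using uniformly_continuous_on_extension_at_closure by metis
qed

text \<open>The escape criterion for integral curves: one that stays in a compact part of the domain
  does not end at a finite time. The field is bounded on \<open>C\<close>, the limit at
  \<open>b\<close> belongs to the closed set \<open>C\<close>, and the field can be integrated anew
  from there.\<close>

lemma integral_curve_extends:
  fixes z :: "real \<Rightarrow> 'a::euclidean_space"
  assumes Z: "open Z" "smooth_on Z H" and C: "compact C" "C \<subseteq> Z" and ab: "a < b"
    and zC: "\<And>t. t \<in> {a<..<b} \<Longrightarrow> z t \<in> C"
    and z': "\<And>t. t \<in> {a<..<b} \<Longrightarrow> (z has_vector_derivative H (z t)) (at t)"
  shows "\<exists>d>b. \<exists>w. (\<forall>t\<in>{a<..<b}. w t = z t) \<and>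
    (\<forall>t\<in>{a<..<d}. w t \<in> Z \<and> (w has_vector_derivative H (w t)) (at t))"
proof -
  have Hc: "continuous_on Z H" using Z(2) by (rule smooth_on_continuous_on)
  then have "bounded (H ` C)"
    using C by (meson compact_continuous_image compact_imp_bounded continuous_on_subset)
  then obtain B where "\<And>x. x \<in> C \<Longrightarrow> norm (H x) \<le> B" unfolding bounded_pos by blast
  then have "norm (H (z t)) \<le> B" if "t \<in> {a<..<b}" for t using zC that by blast
  then obtain l where l: "(z \<longlongrightarrow> l) (at b within {a<..<b})"
    using lipschitz_limit_at_left[of a b z "\<lambda>t. H (z t)" B] ab z' by blast
  have nb: "at b within {a<..<b} \<noteq> bot"
    using ab by (simp add: trivial_limit_within islimpt_greaterThanLessThan2)
  have "l \<in> C"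
    by (rule Lim_in_closed_set[OF compact_imp_closed[OF C(1)] _ nb l])
      (auto simp: eventually_at_filter zC)
  then have "l \<in> Z" using C by blast
  then obtain T y where T: "T > 0" and y: "y b = l"
    "\<And>t. t \<in> {b..b + T} \<Longrightarrow> y t \<in> Z"
    "\<And>t. t \<in> {b..b + T} \<Longrightarrow> (y has_vector_derivative H (y t)) (at t within {b..b + T})"
    using picard_local_existence[OF Z(1) _ Z(2), of l b] by blast
  define w where "w t = (if t < b then z t else y t)" for t
  have wZ: "w t \<in> Z" if "t \<in> {a<..b + T}" for t
    using that y(2) zC C(2) by (auto simp: w_def)
  have w1: "(w has_vector_derivative H (w t)) (at t)" if t: "t \<in> {a<..<b}" for t
    by (rule has_vector_derivative_transform_within_open[of z _ _ "{a<..<b}"])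
      (use z'[OF t] t in \<open>auto simp: w_def\<close>)
  have w2: "(w has_vector_derivative H (w t)) (at t)" if t: "t \<in> {b<..<b + T}" for t
  proof -
    have "(y has_vector_derivative H (y t)) (at t within {b<..<b + T})"
      by (rule has_vector_derivative_within_subset[OF y(3)]) (use t in auto)
    then have "(y has_vector_derivative H (y t)) (at t)"
      by (simp only: at_within_open[OF t open_greaterThanLessThan])
    moreover have "w t = y t" using t by (simp add: w_def)
    ultimately show ?thesis
      using has_vector_derivative_transform_within_open[of y "H (y t)" t "{b<..<b + T}" w] t
      by (simp add: w_def)
  qed
  have wc: "continuous_on {a'..b + T} w" if "a < a'" "a' < b" for a'
  proof -
    have 1: "continuous_on {a'..b} w"
      unfolding continuous_on_eq_continuous_within
    proof
      fix t assume t: "t \<in> {a'..b}"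
      show "continuous (at t within {a'..b}) w"
      proof (cases "t = b")
        case False
        then show ?thesis
          using t that w1[of t] has_vector_derivative_continuous continuous_at_imp_continuous_within
          by fastforce
      next
        case True
        have "(w \<longlongrightarrow> l) (at b within {a<..<b})"
          by (rule Lim_transform_eventually[OF l]) (auto simp: eventually_at_filter w_def)
        moreover have "at b within {a<..<b} = at b within {a'..b}"
          by (rule at_within_nhd[of _ "{a'<..}"]) (use that in auto)
        ultimately show ?thesis using True y(1) by (simp add: continuous_within w_def)
      qed
    qed
    have "continuous_on {b..b + T} y"
      using y(3) by (meson continuous_on_eq_continuous_within has_vector_derivative_continuous)
    then have 2: "continuous_on {b..b + T} w"
      by (rule continuous_on_eq) (simp add: w_def)
    have "{a'..b + T} = {a'..b} \<union> {b..b + T}" using that T by auto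
    then show ?thesis using continuous_on_closed_Un[OF _ _ 1 2] by simp
  qed
  have "(w has_vector_derivative H (w t)) (at t)" if t: "t \<in> {a<..<b + T}" for t
  proof -
    \<comment> \<open>A left end strictly inside the interval, below both \<open>t\<close> and
      \<open>b\<close>: nothing is known about the curve at \<open>a\<close> itself, whereas the
      exceptional-point argument works on a closed interval.\<close>
    define a' where "a' = (a + min t b) / 2"
    have a': "a < a'" "a' < b" "a' < t" using t ab by (auto simp: a'_def min_def)
    show ?thesis
    proof (rule has_vector_derivative_exceptional_point[where a=a' and d="b + T" and b=b])
      show "continuous_on {a'..b + T} (\<lambda>t. H (w t))"
        by (rule continuous_on_compose2[OF Hc wc[OF a'(1,2)]]) (use wZ a' in auto)
      show "(w has_vector_derivative H (w s)) (at s)" if "s \<in> {a'<..<b + T} - {b}" for s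
        using that a' w1[of s] w2[of s] by (cases "s < b") auto
    qed (use wc a' t in auto)
  qed
  moreover have "\<forall>t\<in>{a<..<b}. w t = z t" by (simp add: w_def)
  ultimately show ?thesis using wZ T by (intro exI[of _ "b + T"]) (auto intro!: exI[of _ w])
qed

section \<open>Bilinear forms\<close>

text \<open>Product rule for a moving linear map applied to a moving vector, when the map is known
  to be differentiable only on fixed vectors. Expansion in the basis reduces it to products with
  real coefficients.\<close>

lemma has_derivative_linear_field:
  fixes L :: "'a::real_normed_vector \<Rightarrow> 'e::euclidean_space \<Rightarrow> 'b::real_normed_vector"
  assumes lin: "\<forall>\<^sub>F s in nhds t. linear (L s)"
    and L': "\<And>u. ((\<lambda>s. L s u) has_derivative L' u) (at t)"
    and a: "(a has_derivative a') (at t)"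
  shows "((\<lambda>s. L s (a s)) has_derivative (\<lambda>h. L' (a t) h + L t (a' h))) (at t)"
proof -
  have lt: "linear (L t)" using lin by (rule eventually_nhds_x_imp_x)
  have ev: "\<forall>\<^sub>F s in at t. (\<Sum>i\<in>Basis. (b s \<bullet> i) *\<^sub>R L s i) = L s (b s)" for b
    using lin[unfolded eventually_nhds_conv_at, THEN conjunct1] by eventually_elim (rule linear_eq_sum_Basis[symmetric])
  \<comment> \<open>Linearity of \<open>L'\<close> in its vector argument is not among the
    assumptions; it follows here from uniqueness of the derivative.\<close>
  have "((\<lambda>s. \<Sum>i\<in>Basis. (a t \<bullet> i) *\<^sub>R L s i) has_derivative
      (\<lambda>h. \<Sum>i\<in>Basis. (a t \<bullet> i) *\<^sub>R L' i h)) (at t)"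
    by (intro has_derivative_sum has_derivative_scaleR_right L')
  then have "((\<lambda>s. L s (a t)) has_derivative (\<lambda>h. \<Sum>i\<in>Basis. (a t \<bullet> i) *\<^sub>R L' i h)) (at t)"
    by (rule has_derivative_transform_eventually[OF _ ev[of "\<lambda>_. a t"]])
      (simp_all add: linear_eq_sum_Basis[OF lt, symmetric])
  then have L'at: "L' (a t) = (\<lambda>h. \<Sum>i\<in>Basis. (a t \<bullet> i) *\<^sub>R L' i h)"
    using L' has_derivative_unique by blast
  have "((\<lambda>s. \<Sum>i\<in>Basis. (a s \<bullet> i) *\<^sub>R L s i) has_derivative
      (\<lambda>h. \<Sum>i\<in>Basis. (a t \<bullet> i) *\<^sub>R L' i h + (a' h \<bullet> i) *\<^sub>R L t i)) (at t)"
    by (intro has_derivative_sum has_derivative_scaleR has_derivative_inner_left L' a)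
  then have "((\<lambda>s. \<Sum>i\<in>Basis. (a s \<bullet> i) *\<^sub>R L s i) has_derivative
      (\<lambda>h. L' (a t) h + L t (a' h))) (at t)"
    by (simp add: L'at sum.distrib linear_eq_sum_Basis[OF lt, symmetric])
  then show ?thesis
    by (rule has_derivative_transform_eventually[OF _ ev])
      (simp_all add: linear_eq_sum_Basis[OF lt, symmetric])
qed

text \<open>The linear rule applied twice: to the second argument with the linear maps
  \<open>M s (a s)\<close>, and within it to the first argument.\<close>

lemma has_derivative_bilinear_field:
  fixes M :: "'a::real_normed_vector \<Rightarrow> 'e::euclidean_space \<Rightarrow> 'f::euclidean_space \<Rightarrow> 'b::real_normed_vector"
  assumes bil: "\<forall>\<^sub>F s in nhds t. bilinear (M s)"
    and M': "\<And>u w. ((\<lambda>s. M s u w) has_derivative M' u w) (at t)"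
    and a: "(a has_derivative a') (at t)" and b: "(b has_derivative b') (at t)"
  shows "((\<lambda>s. M s (a s) (b s)) has_derivative
    (\<lambda>h. M' (a t) (b t) h + M t (a' h) (b t) + M t (a t) (b' h))) (at t)"
proof (rule has_derivative_linear_field[OF _ _ b])
  show "\<forall>\<^sub>F s in nhds t. linear (M s (a s))"
    using bil by eventually_elim (simp add: bilinear_def)
  show "((\<lambda>s. M s (a s) w) has_derivative (\<lambda>h. M' (a t) w h + M t (a' h) w)) (at t)" for w
  proof (rule has_derivative_linear_field[OF _ M' a])
    show "\<forall>\<^sub>F s in nhds t. linear (\<lambda>u. M s u w)"
      using bil by eventually_elim (simp add: bilinear_def)
  qed
qed

text \<open>The operator that represents \<open>b\<close> through the inner product,
  \<open>form_operator b u \<bullet> w = b u w\<close>. It turns nondegeneracy into injectivity and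
  the representation of functionals into a linear system.\<close>

definition form_operator :: "('e::euclidean_space \<Rightarrow> 'e \<Rightarrow> real) \<Rightarrow> 'e \<Rightarrow> 'e" where
  "form_operator b u = (\<Sum>i\<in>Basis. b u i *\<^sub>R i)"

definition nondegenerate :: "('e::euclidean_space \<Rightarrow> 'e \<Rightarrow> real) \<Rightarrow> bool" where
  "nondegenerate b \<longleftrightarrow> (\<forall>u. (\<forall>w. b u w = 0) \<longrightarrow> u = 0)"

lemma linear_eq_inner:
  fixes l :: "'e::euclidean_space \<Rightarrow> real"
  assumes "linear l"
  shows "l w = (\<Sum>i\<in>Basis. l i *\<^sub>R i) \<bullet> w"
  by (subst linear_eq_sum_Basis[OF assms]) (simp add: inner_sum_left inner_commute[of w] mult.commute)

lemma form_operator_inner: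
  assumes "bilinear b"
  shows "form_operator b u \<bullet> w = b u w"
  using linear_eq_inner[of "b u" w] assms by (simp add: form_operator_def bilinear_def)

lemma linear_form_operator:
  assumes "bilinear b"
  shows "linear (form_operator b)"
  unfolding form_operator_def
  by (intro linear_compose_sum ballI linear_compose_scale linear_iff[THEN iffD2])
    (simp add: bilinear_ladd[OF assms] bilinear_lmul[OF assms] algebra_simps)

lemma inj_form_operator:
  assumes "bilinear b" and "nondegenerate b"
  shows "inj (form_operator b)"
  unfolding linear_injective_0[OF linear_form_operator[OF assms(1)]]
  using assms(2) form_operator_inner[OF assms(1)] unfolding nondegenerate_def
  by (metis inner_zero_left)

lemma nondegenerate_eqI:
  assumes "bilinear b" and "nondegenerate b" and "\<And>w. b u w = b v w"
  shows "u = v"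
  using inj_form_operator[OF assms(1,2)] by (simp add: form_operator_def assms(3) injD)

lemma nondegenerate_representation:
  fixes b :: "'e::euclidean_space \<Rightarrow> 'e \<Rightarrow> real"
  assumes "bilinear b" and "nondegenerate b" and l: "linear l"
  shows "\<exists>z. \<forall>w. b z w = l w"
proof -
  have "surj (form_operator b)"
    using linear_form_operator inj_form_operator assms linear_injective_imp_surjective by blast
  then obtain z where "form_operator b z = (\<Sum>i\<in>Basis. l i *\<^sub>R i)" by (metis surjD)
  then show ?thesis
    using form_operator_inner[OF assms(1), of z] linear_eq_inner[OF l] by metis
qed

text \<open>Minkowski coordinates, written with coefficient functions on the basis so that the facts
  about Lorentz forms below become computations with finite sums.\<close>

lemma lorentz_form_coordinates:
  assumes "lorentz_form (b :: 'e::euclidean_space \<Rightarrow> 'e \<Rightarrow> real)"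
  shows "\<exists>B e0. finite B \<and> e0 \<in> B \<and> (\<forall>u. \<exists>r. u = (\<Sum>e\<in>B. r e *\<^sub>R e)) \<and>
    (\<forall>r s. b (\<Sum>e\<in>B. r e *\<^sub>R e) (\<Sum>e\<in>B. s e *\<^sub>R e) =
      (\<Sum>e\<in>B - {e0}. r e * s e) - r e0 * s e0)"
proof -
  obtain B e0 where bil: "bilinear b" and B: "independent B" "span B = UNIV" "e0 \<in> B" "b e0 e0 = -1"
    "\<And>e. e \<in> B - {e0} \<Longrightarrow> b e e = 1" "\<And>e e'. \<lbrakk>e \<in> B; e' \<in> B; e \<noteq> e'\<rbrakk> \<Longrightarrow> b e e' = 0"
    using assms unfolding lorentz_form_def by blast
  have fin: "finite B" using B(1) by (rule finiteI_independent)
  show ?thesis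
  proof (rule exI[of _ B], rule exI[of _ e0], intro conjI allI)
    show "finite B" "e0 \<in> B" by fact+
    show "\<exists>r. u = (\<Sum>e\<in>B. r e *\<^sub>R e)" for u
    proof -
      have "u \<in> span B" using B(2) by simp
      then show ?thesis unfolding span_finite[OF fin] by auto
    qed
    fix r s
    have "b (\<Sum>e\<in>B. r e *\<^sub>R e) (\<Sum>e\<in>B. s e *\<^sub>R e) = (\<Sum>e\<in>B. \<Sum>e'\<in>B. b (r e *\<^sub>R e) (s e' *\<^sub>R e'))"
      by (simp add: bilinear_sum[OF bil] sum.cartesian_product)
    also have "\<dots> = (\<Sum>e\<in>B. \<Sum>e'\<in>B. if e' = e then r e * s e * b e e else 0)"
      by (intro sum.cong refl) (auto simp: bilinear_lmul[OF bil] bilinear_rmul[OF bil] B(6))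
    also have "\<dots> = (\<Sum>e\<in>B. r e * s e * b e e)" using fin by simp
    also have "\<dots> = r e0 * s e0 * b e0 e0 + (\<Sum>e\<in>B - {e0}. r e * s e * b e e)"
      by (rule sum.remove[OF fin B(3)])
    also have "(\<Sum>e\<in>B - {e0}. r e * s e * b e e) = (\<Sum>e\<in>B - {e0}. r e * s e)"
      by (intro sum.cong refl) (simp add: B(5))
    finally show "b (\<Sum>e\<in>B. r e *\<^sub>R e) (\<Sum>e\<in>B. s e *\<^sub>R e) = (\<Sum>e\<in>B - {e0}. r e * s e) - r e0 * s e0"
      by (simp add: B(4))
  qed
qed

lemma lorentz_form_nondegenerate:
  assumes "lorentz_form b"
  shows "nondegenerate b"
  unfolding nondegenerate_def
proof (intro allI impI)
  obtain B e0 where B: "finite B" "e0 \<in> B" "\<And>u. \<exists>r. u = (\<Sum>e\<in>B. r e *\<^sub>R e)"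
    and b: "\<And>r s. b (\<Sum>e\<in>B. r e *\<^sub>R e) (\<Sum>e\<in>B. s e *\<^sub>R e) = (\<Sum>e\<in>B - {e0}. r e * s e) - r e0 * s e0"
    using lorentz_form_coordinates[OF assms] by blast
  fix u assume u: "\<forall>w. b u w = 0"
  obtain r where r: "u = (\<Sum>e\<in>B. r e *\<^sub>R e)" using B(3) by blast
  \<comment> \<open>The vector is tested against its reflection in \<open>e0\<close>; this turns the
    Lorentz form into the Euclidean sum of squares.\<close>
  define s where "s e = (if e = e0 then - r e else r e)" for e
  have "b u (\<Sum>e\<in>B. s e *\<^sub>R e) = 0" using u by blast
  then have "0 = (\<Sum>e\<in>B - {e0}. r e * s e) - r e0 * s e0" unfolding r b by simp
  also have "(\<Sum>e\<in>B - {e0}. r e * s e) = (\<Sum>e\<in>B - {e0}. (r e)\<^sup>2)"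
    by (intro sum.cong refl) (auto simp: s_def power2_eq_square)
  also have "\<dots> - r e0 * s e0 = (\<Sum>e\<in>B. (r e)\<^sup>2)"
    by (simp add: sum.remove[OF B(1,2)] s_def power2_eq_square)
  finally have "\<forall>e\<in>B. (r e)\<^sup>2 = 0" using sum_nonneg_eq_0_iff[OF B(1), of "\<lambda>e. (r e)\<^sup>2"] by simp
  then show "u = 0" using r by simp
qed

text \<open>The reversed Cauchy-Schwarz inequality. Orthogonality makes the product of the time
  components equal to the Euclidean product of the space components; if the time component of
  \<open>u\<close> were nonzero, Cauchy-Schwarz would contradict that \<open>k\<close> has the
  larger time component. With it equal to 0, all space components vanish too.\<close>

lemma lorentz_form_timelike_orthogonal:
  assumes "lorentz_form b" and k: "b k k < 0" and ku: "b k u = 0" and uu: "b u u \<le> 0"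
  shows "u = 0"
proof -
  obtain B e0 where B: "finite B" "e0 \<in> B" "\<And>u. \<exists>r. u = (\<Sum>e\<in>B. r e *\<^sub>R e)"
    and b: "\<And>r s. b (\<Sum>e\<in>B. r e *\<^sub>R e) (\<Sum>e\<in>B. s e *\<^sub>R e) = (\<Sum>e\<in>B - {e0}. r e * s e) - r e0 * s e0"
    using lorentz_form_coordinates[OF assms(1)] by blast
  obtain p where p: "k = (\<Sum>e\<in>B. p e *\<^sub>R e)" using B(3)[of k] ..
  obtain q where q: "u = (\<Sum>e\<in>B. q e *\<^sub>R e)" using B(3)[of u] ..
  let ?S = "\<lambda>f. \<Sum>e\<in>B - {e0}. f e"
  have pp: "?S (\<lambda>e. (p e)\<^sup>2) < (p e0)\<^sup>2" using k unfolding p b by (simp add: power2_eq_square)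
  have pq: "?S (\<lambda>e. p e * q e) = p e0 * q e0" using ku unfolding p q b by simp
  have qq: "?S (\<lambda>e. (q e)\<^sup>2) \<le> (q e0)\<^sup>2" using uu unfolding q b by (simp add: power2_eq_square)
  have "(p e0)\<^sup>2 * (q e0)\<^sup>2 = (?S (\<lambda>e. p e * q e))\<^sup>2" by (simp add: pq power_mult_distrib)
  also have "\<dots> \<le> ?S (\<lambda>e. (p e)\<^sup>2) * ?S (\<lambda>e. (q e)\<^sup>2)" by (rule Cauchy_Schwarz_ineq_sum)
  also have "\<dots> \<le> ?S (\<lambda>e. (p e)\<^sup>2) * (q e0)\<^sup>2" by (intro mult_left_mono qq sum_nonneg) simp
  finally have le: "(p e0)\<^sup>2 * (q e0)\<^sup>2 \<le> ?S (\<lambda>e. (p e)\<^sup>2) * (q e0)\<^sup>2" .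
  have q0: "q e0 = 0"
  proof (rule ccontr)
    assume "q e0 \<noteq> 0"
    then have "(q e0)\<^sup>2 > 0" by simp
    then show False using le pp by simp
  qed
  then have "?S (\<lambda>e. (q e)\<^sup>2) = 0" using qq by (simp add: sum_nonneg order_antisym)
  then have "\<forall>e\<in>B - {e0}. q e = 0"
    using sum_nonneg_eq_0_iff[of "B - {e0}" "\<lambda>e. (q e)\<^sup>2"] B(1) by simp
  then have "\<forall>e\<in>B. q e = 0" using q0 by blast
  then show ?thesis using q by simp
qed

section \<open>Christoffel symbols\<close>

text \<open>The conditions under the description operator in \<open>levi_civita_rep\<close>,
  isolated for an arbitrary field of forms, so that uniqueness can also be applied to symbols pulled
  back from another chart.\<close>

definition christoffel ::
  "('e::euclidean_space \<Rightarrow> 'e \<Rightarrow> 'e \<Rightarrow> real) \<Rightarrow> 'e \<Rightarrow> ('e \<Rightarrow> 'e \<Rightarrow> 'e) \<Rightarrow> bool" where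
  "christoffel G x \<Gamma> \<longleftrightarrow> bilinear \<Gamma> \<and> (\<forall>u v. \<Gamma> u v = \<Gamma> v u) \<and>
     (\<forall>u v w. frechet_derivative (\<lambda>y. G y v w) (at x) u = G x (\<Gamma> u v) w + G x v (\<Gamma> u w))"

text \<open>The right-hand side of the Koszul formula for constant coordinate fields, whose brackets
  vanish: the Christoffel symbols of the first kind.\<close>

definition koszul :: "('e::euclidean_space \<Rightarrow> 'e \<Rightarrow> 'e \<Rightarrow> real) \<Rightarrow> 'e \<Rightarrow> 'e \<Rightarrow> 'e \<Rightarrow> 'e \<Rightarrow> real" where
  "koszul G x u v w = (frechet_derivative (\<lambda>y. G y v w) (at x) u +
     frechet_derivative (\<lambda>y. G y u w) (at x) v - frechet_derivative (\<lambda>y. G y u v) (at x) w) / 2"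

text \<open>The metric as seen in one chart; the signature enters through nondegeneracy.\<close>

locale metric_field =
  fixes S :: "'e::euclidean_space set" and G :: "'e \<Rightarrow> 'e \<Rightarrow> 'e \<Rightarrow> real"
  assumes open_S: "open S"
    and bil: "x \<in> S \<Longrightarrow> bilinear (G x)"
    and sym: "x \<in> S \<Longrightarrow> G x u v = G x v u"
    and nondeg: "x \<in> S \<Longrightarrow> nondegenerate (G x)"
    and smooth: "smooth_on S (\<lambda>x. G x u v)"
begin

lemma has_derivative_metric:
  assumes "x \<in> S"
  shows "((\<lambda>y. G y u v) has_derivative frechet_derivative (\<lambda>y. G y u v) (at x)) (at x)"
  by (rule smooth_on_has_derivative[OF smooth assms])

text \<open>Algebraic identities between the forms \<open>G y\<close> hold throughout the open set
  \<open>S\<close> and hence survive differentiation in \<open>y\<close>. Bilinearity and symmetry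
  of the derivatives of the metric are obtained in this way.\<close>

lemma frechet_derivative_metric_eqI:
  assumes x: "x \<in> S" and "(f has_derivative f') (at x)" and "\<And>y. y \<in> S \<Longrightarrow> f y = G y u v"
  shows "frechet_derivative (\<lambda>y. G y u v) (at x) h = f' h"
  using has_derivative_transform_within_open[OF assms(2) open_S x assms(3)]
    frechet_derivative_at by metis

lemma koszul_linear:
  assumes x: "x \<in> S"
  shows "linear (koszul G x u v)" "linear (\<lambda>u. koszul G x u v w)" "linear (\<lambda>v. koszul G x u v w)"
proof -
  let ?D = "\<lambda>u v. frechet_derivative (\<lambda>y. G y u v) (at x)"
  note h = has_derivative_metric[OF x]
  have 1: "linear (?D u v)" for u v using h has_derivative_linear by blast
  have 2: "?D (u + u') v h = ?D u v h + ?D u' v h" for u u' v h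
    by (rule frechet_derivative_metric_eqI[OF x has_derivative_add[OF h h]])
      (simp add: bilinear_ladd[OF bil])
  have 3: "?D (r *\<^sub>R u) v h = r * ?D u v h" for r u v h
    by (rule frechet_derivative_metric_eqI[OF x has_derivative_mult_right[OF h]])
      (simp add: bilinear_lmul[OF bil])
  have 4: "?D u (v + v') h = ?D u v h + ?D u v' h" for u v v' h
    by (rule frechet_derivative_metric_eqI[OF x has_derivative_add[OF h h]])
      (simp add: bilinear_radd[OF bil])
  have 5: "?D u (r *\<^sub>R v) h = r * ?D u v h" for r u v h
    by (rule frechet_derivative_metric_eqI[OF x has_derivative_mult_right[OF h]])
      (simp add: bilinear_rmul[OF bil])
  note ls = linear_add[OF 1] linear_scale[OF 1] 2 3 4 5
  show "linear (koszul G x u v)" "linear (\<lambda>u. koszul G x u v w)" "linear (\<lambda>v. koszul G x u v w)"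
    by (intro linearI; simp add: koszul_def ls algebra_simps add_divide_distrib diff_divide_distrib)+
qed

lemma koszul_commute: "x \<in> S \<Longrightarrow> koszul G x u v w = koszul G x v u w"
  using frechet_derivative_metric_eqI[OF _ has_derivative_metric, of x u v v u] sym
  by (simp add: koszul_def)

text \<open>The cyclic trick: in the signed sum of three permuted metric conditions, symmetry of
  \<open>\<Gamma>\<close> and of the metric cancels everything except
  \<open>2 * G x (\<Gamma> u v) w\<close>.\<close>

lemma christoffel_koszul:
  assumes x: "x \<in> S" and c: "christoffel G x \<Gamma>"
  shows "G x (\<Gamma> u v) w = koszul G x u v w"
proof -
  have s: "\<Gamma> a b = \<Gamma> b a" for a b using c by (simp add: christoffel_def)
  have m: "frechet_derivative (\<lambda>y. G y v w) (at x) u = G x (\<Gamma> u v) w + G x v (\<Gamma> u w)" for u v w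
    using c by (simp add: christoffel_def)
  show ?thesis
    unfolding koszul_def m
    using s[of v u] s[of w u] s[of w v] sym[OF x, of u "\<Gamma> v w"] sym[OF x, of v "\<Gamma> u w"] by simp
qed

text \<open>Nondegeneracy is used in both directions: it represents the Koszul functional by a
  vector \<open>\<Gamma> u v\<close>, and it determines every other solution, which satisfies the
  same Koszul formula.\<close>

lemma christoffel_exists:
  assumes x: "x \<in> S"
  shows "\<exists>!\<Gamma>. christoffel G x \<Gamma>"
proof -
  note rep = nondegenerate_representation[OF bil[OF x] nondeg[OF x]]
  note eqI = nondegenerate_eqI[OF bil[OF x] nondeg[OF x]]
  have "\<exists>z. \<forall>w. G x z w = koszul G x u v w" for u v
    by (rule rep) (rule koszul_linear[OF x])
  then obtain \<Gamma> where \<Gamma>: "\<And>u v w. G x (\<Gamma> u v) w = koszul G x u v w" by metis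
  note lin = bilinear_ladd[OF bil[OF x]] bilinear_lmul[OF bil[OF x]]
  have "bilinear \<Gamma>"
    unfolding bilinear_def
    by (intro conjI allI linearI eqI)
      (simp_all add: \<Gamma> lin linear_add[OF koszul_linear(2)[OF x]] linear_add[OF koszul_linear(3)[OF x]]
        linear_scale[OF koszul_linear(2)[OF x]] linear_scale[OF koszul_linear(3)[OF x]])
  moreover have "\<Gamma> u v = \<Gamma> v u" for u v
    by (rule eqI) (simp add: \<Gamma> koszul_commute[OF x])
  moreover have "frechet_derivative (\<lambda>y. G y v w) (at x) u = G x (\<Gamma> u v) w + G x v (\<Gamma> u w)" for u v w
  proof -
    have c: "frechet_derivative (\<lambda>y. G y w v) (at x) u = frechet_derivative (\<lambda>y. G y v w) (at x) u"
      for u v w by (rule frechet_derivative_metric_eqI[OF x has_derivative_metric[OF x]]) (rule sym)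
    show ?thesis
      using sym[OF x, of v "\<Gamma> u w"] c[of w v u] by (simp add: \<Gamma> koszul_def add_divide_distrib diff_divide_distrib)
  qed
  ultimately have ex: "christoffel G x \<Gamma>" by (simp add: christoffel_def)
  have "\<Gamma>' = \<Gamma>" if "christoffel G x \<Gamma>'" for \<Gamma>'
    by (intro ext eqI) (simp add: christoffel_koszul[OF x that] \<Gamma>)
  with ex show ?thesis by blast
qed

text \<open>A field \<open>z\<close> dual to a smooth covector field solves a linear system whose
  operator is smooth and injective. Both the Christoffel symbols and the gradient are of this
  kind.\<close>

lemma smooth_on_representation:
  assumes "\<And>i. i \<in> Basis \<Longrightarrow> smooth_on S (\<lambda>x. l x i)"
    and "\<And>x w. x \<in> S \<Longrightarrow> G x (z x) w = l x w"
  shows "smooth_on S z"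
proof (rule smooth_on_linear_system[OF open_S])
  show "linear (form_operator (G x))" if "x \<in> S" for x
    by (rule linear_form_operator[OF bil[OF that]])
  show "inj (form_operator (G x))" if "x \<in> S" for x
    by (rule inj_form_operator[OF bil[OF that] nondeg[OF that]])
  show "smooth_on S (\<lambda>x. form_operator (G x) u)" for u
    unfolding form_operator_def
    by (intro smooth_on_sum open_S bounded_linear.smooth_on[OF bounded_linear_scaleR_left] smooth)
  show "smooth_on S (\<lambda>x. \<Sum>i\<in>Basis. l x i *\<^sub>R i)"
    by (intro smooth_on_sum open_S bounded_linear.smooth_on[OF bounded_linear_scaleR_left] assms)
  show "form_operator (G x) (z x) = (\<Sum>i\<in>Basis. l x i *\<^sub>R i)" if "x \<in> S" for x
    using assms(2)[OF that] by (simp add: form_operator_def)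
qed

lemma smooth_on_christoffel:
  assumes "\<And>x. x \<in> S \<Longrightarrow> christoffel G x (\<Gamma> x)"
  shows "smooth_on S (\<lambda>x. \<Gamma> x u v)"
proof (rule smooth_on_representation)
  show "smooth_on S (\<lambda>x. koszul G x u v i)" for i
    unfolding koszul_def divide_inverse
    by (intro bounded_linear.smooth_on[OF bounded_linear_mult_left] open_S smooth_on_diff smooth_on_add
        smooth_on_frechet_derivative smooth)
qed (rule christoffel_koszul[OF _ assms])

end

section \<open>Charts and tangent vectors\<close>

locale smooth_manifold =
  fixes A :: "('a::t2_space, 'e::euclidean_space) chart set"
  assumes atlas: "smooth_atlas A"
begin

lemma open_chart_dom: "c \<in> A \<Longrightarrow> open (chart_dom c)"
  and open_chart_image: "c \<in> A \<Longrightarrow> open (chart_image c)"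
  and chart_homeomorphism:
    "c \<in> A \<Longrightarrow> homeomorphism (chart_dom c) (chart_image c) (chart_map c) (chart_inv c)"
  using atlas by (simp_all add: smooth_atlas_def is_chart_def)

lemma chart_inv_map: "c \<in> A \<Longrightarrow> p \<in> chart_dom c \<Longrightarrow> chart_inv c (chart_map c p) = p"
  using chart_homeomorphism by (simp add: homeomorphism_def)

lemma chart_map_inv: "c \<in> A \<Longrightarrow> x \<in> chart_image c \<Longrightarrow> chart_map c (chart_inv c x) = x"
  using chart_homeomorphism unfolding homeomorphism_def by blast

lemma chart_inv_dom: "c \<in> A \<Longrightarrow> x \<in> chart_image c \<Longrightarrow> chart_inv c x \<in> chart_dom c"
  using chart_homeomorphism unfolding homeomorphism_def by blast

lemma continuous_on_chart_map: "c \<in> A \<Longrightarrow> continuous_on (chart_dom c) (chart_map c)"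
  and continuous_on_chart_inv: "c \<in> A \<Longrightarrow> continuous_on (chart_image c) (chart_inv c)"
  using chart_homeomorphism unfolding homeomorphism_def by blast+

lemma chart_cover: "\<exists>c\<in>A. p \<in> chart_dom c"
proof -
  have "p \<in> (\<Union>c\<in>A. chart_dom c)" using atlas by (simp add: smooth_atlas_def)
  then show ?thesis by blast
qed

lemma open_overlap:
  assumes c: "c \<in> A" and U: "open U"
  shows "open (chart_map c ` (chart_dom c \<inter> U))"
proof -
  have "chart_map c ` (chart_dom c \<inter> U) = chart_image c \<inter> chart_inv c -` U"
    using chart_inv_map[OF c] chart_map_inv[OF c] chart_inv_dom[OF c]
    by (auto simp: image_iff)
  then show ?thesis
    using continuous_open_preimage[OF continuous_on_chart_inv[OF c] open_chart_image[OF c] U] by simp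
qed

lemma smooth_on_transition:
  "c \<in> A \<Longrightarrow> d \<in> A \<Longrightarrow>
    smooth_on (chart_map c ` (chart_dom c \<inter> chart_dom d)) (chart_map d \<circ> chart_inv c)"
  using atlas by (simp add: smooth_atlas_def)

text \<open>Indexed by the point of the manifold instead of its coordinates, so that the cocycle
  rule can be stated without transition maps.\<close>

definition jac :: "('a, 'e) chart \<Rightarrow> ('a, 'e) chart \<Rightarrow> 'a \<Rightarrow> 'e \<Rightarrow> 'e" where
  "jac c d p = frechet_derivative (chart_map d \<circ> chart_inv c) (at (chart_map c p))"

lemma jac_has_derivative:
  assumes "c \<in> A" "d \<in> A" "p \<in> chart_dom c" "p \<in> chart_dom d"
  shows "((chart_map d \<circ> chart_inv c) has_derivative jac c d p) (at (chart_map c p))"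
  unfolding jac_def
  by (rule smooth_on_has_derivative[OF smooth_on_transition[OF assms(1,2)]]) (use assms in blast)

lemma linear_jac:
  assumes "c \<in> A" "d \<in> A" "p \<in> chart_dom c" "p \<in> chart_dom d"
  shows "linear (jac c d p)"
  using jac_has_derivative[OF assms] by (rule has_derivative_linear)

lemma jac_compose:
  assumes A: "c \<in> A" "d \<in> A" "e \<in> A" and p: "p \<in> chart_dom c" "p \<in> chart_dom d" "p \<in> chart_dom e"
  shows "jac d e p (jac c d p u) = jac c e p u"
proof -
  have x: "(chart_map d \<circ> chart_inv c) (chart_map c p) = chart_map d p"
    using A p by (simp add: chart_inv_map)
  have "((chart_map e \<circ> chart_inv d) \<circ> (chart_map d \<circ> chart_inv c) has_derivative
      jac d e p \<circ> jac c d p) (at (chart_map c p))"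
    by (rule diff_chain_at[OF jac_has_derivative[OF A(1,2) p(1,2)]])
      (simp only: x jac_has_derivative[OF A(2,3) p(2,3)])
  then have "((chart_map e \<circ> chart_inv c) has_derivative jac d e p \<circ> jac c d p) (at (chart_map c p))"
    by (rule has_derivative_transform_within_open[OF _ open_overlap[OF A(1) open_chart_dom[OF A(2)]]])
      (use A p in \<open>auto simp: chart_inv_map\<close>)
  from has_derivative_unique[OF this jac_has_derivative[OF A(1,3) p(1,3)]]
  show ?thesis by (simp add: fun_eq_iff)
qed

lemma jac_same:
  assumes c: "c \<in> A" and p: "p \<in> chart_dom c"
  shows "jac c c p u = u"
proof -
  have "((\<lambda>x. x) has_derivative (\<lambda>x. x)) (at (chart_map c p))" by (rule has_derivative_ident)
  then have "((chart_map c \<circ> chart_inv c) has_derivative (\<lambda>x. x)) (at (chart_map c p))"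
    by (rule has_derivative_transform_within_open[OF _ open_chart_image[OF c]])
      (use c p in \<open>auto simp: chart_inv_map\<close>)
  from has_derivative_unique[OF this jac_has_derivative[OF c c p p]] show ?thesis
    by (simp add: fun_eq_iff)
qed

lemma tangent_space_jac:
  "v \<in> tangent_space A p \<Longrightarrow> c \<in> A \<Longrightarrow> d \<in> A \<Longrightarrow> p \<in> chart_dom c \<Longrightarrow> p \<in> chart_dom d \<Longrightarrow>
    v d = jac c d p (v c)"
  unfolding tangent_space_def jac_def by blast

lemma tangent_space_outside:
  "v \<in> tangent_space A p \<Longrightarrow> \<not> (c \<in> A \<and> p \<in> chart_dom c) \<Longrightarrow> v c = 0"
  unfolding tangent_space_def by blast

lemma tangent_spaceI:
  assumes "\<And>c d. \<lbrakk>c \<in> A; d \<in> A; p \<in> chart_dom c; p \<in> chart_dom d\<rbrakk> \<Longrightarrow> v d = jac c d p (v c)"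
    and "\<And>c. \<not> (c \<in> A \<and> p \<in> chart_dom c) \<Longrightarrow> v c = 0"
  shows "v \<in> tangent_space A p"
  using assms unfolding tangent_space_def jac_def by blast

lemma tangent_space_eqI:
  assumes v: "v \<in> tangent_space A p" and w: "w \<in> tangent_space A p"
    and c: "c \<in> A" "p \<in> chart_dom c" and eq: "v c = w c"
  shows "v = w"
proof
  fix d
  show "v d = w d"
  proof (cases "d \<in> A \<and> p \<in> chart_dom d")
    case True
    then show ?thesis using tangent_space_jac[OF v, of c d] tangent_space_jac[OF w, of c d] c eq by simp
  next
    case False
    then show ?thesis using tangent_space_outside[OF v] tangent_space_outside[OF w] by simp
  qed
qed

lemma tangent_space_diff:
  assumes "v \<in> tangent_space A p" and "w \<in> tangent_space A p"
  shows "(\<lambda>c. v c - w c) \<in> tangent_space A p"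
proof (rule tangent_spaceI)
  fix c d assume *: "c \<in> A" "d \<in> A" "p \<in> chart_dom c" "p \<in> chart_dom d"
  show "v d - w d = jac c d p (v c - w c)"
    using tangent_space_jac[OF assms(1) *] tangent_space_jac[OF assms(2) *] linear_diff[OF linear_jac[OF *]]
    by simp
next
  fix c assume c: "\<not> (c \<in> A \<and> p \<in> chart_dom c)"
  show "v c - w c = 0"
    using tangent_space_outside[OF assms(1) c] tangent_space_outside[OF assms(2) c] by simp
qed

text \<open>\<open>of_coords\<close> inverts a map that first has to be seen to be surjective.
  Spreading \<open>u\<close> to all charts around \<open>p\<close> by the Jacobians yields a
  preimage, and the cocycle rule makes this family a tangent vector.\<close>

lemma of_coords:
  assumes c: "c \<in> A" and p: "p \<in> chart_dom c"
  shows of_coords_tangent: "of_coords A c p u \<in> tangent_space A p"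
    and of_coords_apply: "of_coords A c p u c = u"
proof -
  define w where "w d = (if d \<in> A \<and> p \<in> chart_dom d then jac c d p u else 0)" for d
  have "w \<in> tangent_space A p"
    by (rule tangent_spaceI) (use c p jac_compose in \<open>auto simp: w_def\<close>)
  moreover have "w c = u" using c p by (simp add: w_def jac_same)
  ultimately have "u \<in> (\<lambda>v. v c) ` tangent_space A p" by blast
  then show "of_coords A c p u \<in> tangent_space A p" "of_coords A c p u c = u"
    unfolding of_coords_def by (rule inv_into_into, rule f_inv_into_f)
qed

lemma of_coords_eq:
  "c \<in> A \<Longrightarrow> p \<in> chart_dom c \<Longrightarrow> v \<in> tangent_space A p \<Longrightarrow> of_coords A c p (v c) = v"
  by (rule tangent_space_eqI[OF of_coords_tangent _ _ _ of_coords_apply])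

lemma of_coords_jac:
  assumes "c \<in> A" "d \<in> A" "p \<in> chart_dom c" "p \<in> chart_dom d"
  shows "of_coords A d p (jac c d p u) = of_coords A c p u"
  by (rule tangent_space_eqI[of _ p _ d])
    (use assms tangent_space_jac[OF of_coords_tangent assms] in \<open>simp_all add: of_coords\<close>)

lemma chart_image_inv:
  assumes "c \<in> A" and "x \<in> chart_image c"
  obtains p where "p \<in> chart_dom c" "x = chart_map c p" "chart_inv c x = p"
  using assms chart_inv_map by blast

lemma continuous_on_UNIV_chartwise:
  fixes f :: "'a \<Rightarrow> 'b::topological_space"
  assumes "\<And>c. c \<in> A \<Longrightarrow> continuous_on (chart_image c) (f \<circ> chart_inv c)"
  shows "continuous_on UNIV f"
proof -
  have "continuous (at p) f" for p
  proof -
    obtain c where c: "c \<in> A" "p \<in> chart_dom c" using chart_cover by blast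
    have "continuous_on (chart_dom c) ((f \<circ> chart_inv c) \<circ> chart_map c)"
      by (intro continuous_on_compose continuous_on_chart_map assms c)
    then have "continuous_on (chart_dom c) f"
      by (rule continuous_on_eq) (simp add: chart_inv_map[OF c(1)])
    then show ?thesis using c open_chart_dom continuous_on_eq_continuous_at by blast
  qed
  then show ?thesis by (simp add: continuous_at_imp_continuous_on)
qed

text \<open>The chain rule for the transition map shows that the arbitrarily chosen chart in
  \<open>differential\<close> has no influence on the value.\<close>

lemma differential_chart:
  assumes f: "smooth_function A f" and v: "v \<in> tangent_space A p"
    and c: "c \<in> A" "p \<in> chart_dom c"
  shows "differential A f p v = frechet_derivative (f \<circ> chart_inv c) (at (chart_map c p)) (v c)"
proof -
  define d where "d = (SOME c. c \<in> A \<and> p \<in> chart_dom c)"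
  have d: "d \<in> A" "p \<in> chart_dom d"
    using someI[of "\<lambda>c. c \<in> A \<and> p \<in> chart_dom c" c] c by (simp_all add: d_def)
  let ?D = "\<lambda>c. frechet_derivative (f \<circ> chart_inv c) (at (chart_map c p))"
  have "((f \<circ> chart_inv d) has_derivative ?D d) (at (chart_map d p))"
    by (rule smooth_on_has_derivative[of "chart_image d"]) (use f d in \<open>auto simp: smooth_function_def\<close>)
  then have "((f \<circ> chart_inv d) \<circ> (chart_map d \<circ> chart_inv c) has_derivative
      ?D d \<circ> jac c d p) (at (chart_map c p))"
    by (intro diff_chain_at[OF jac_has_derivative[OF c(1) d(1) c(2) d(2)]])
      (simp add: chart_inv_map c)
  then have "((f \<circ> chart_inv c) has_derivative ?D d \<circ> jac c d p) (at (chart_map c p))"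
    by (rule has_derivative_transform_within_open[OF _ open_overlap[OF c(1) open_chart_dom[OF d(1)]]])
      (use c d in \<open>auto simp: chart_inv_map\<close>)
  from fun_cong[OF frechet_derivative_at[OF this], of "v c"]
  have "?D c (v c) = ?D d (jac c d p (v c))" by simp
  also have "jac c d p (v c) = v d" using tangent_space_jac[OF v c(1) d(1) c(2) d(2)] by simp
  finally show ?thesis by (simp only: differential_def Let_def d_def[symmetric])
qed

end

section \<open>The Levi-Civita connection\<close>

locale lorentzian_manifold = smooth_manifold A
  for A :: "('a::t2_space, 'e::euclidean_space) chart set" +
  fixes g :: "'a \<Rightarrow> ('a, 'e) tvec \<Rightarrow> ('a, 'e) tvec \<Rightarrow> real"
  assumes lorentzian: "lorentzian_metric A g"
begin

lemma lorentz_form_metric_rep: "c \<in> A \<Longrightarrow> x \<in> chart_image c \<Longrightarrow> lorentz_form (metric_rep A g c x)"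
  using lorentzian unfolding lorentzian_metric_def by blast

lemma metric_field_chart:
  assumes c: "c \<in> A"
  shows "metric_field (chart_image c) (metric_rep A g c)"
proof
  show "open (chart_image c)" by (rule open_chart_image[OF c])
  show "smooth_on (chart_image c) (\<lambda>x. metric_rep A g c x u v)" for u v
    using c lorentzian by (simp add: lorentzian_metric_def)
  fix x assume "x \<in> chart_image c"
  then have l: "lorentz_form (metric_rep A g c x)" by (rule lorentz_form_metric_rep[OF c])
  then show "bilinear (metric_rep A g c x)" "metric_rep A g c x u v = metric_rep A g c x v u" for u v
    unfolding lorentz_form_def by blast+
  show "nondegenerate (metric_rep A g c x)" using l by (rule lorentz_form_nondegenerate)
qed

lemma metric_rep_tangent:
  assumes "c \<in> A" "p \<in> chart_dom c" "v \<in> tangent_space A p" "w \<in> tangent_space A p"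
  shows "metric_rep A g c (chart_map c p) (v c) (w c) = g p v w"
  using assms by (simp add: metric_rep_def chart_inv_map of_coords_eq)

lemma metric_rep_jac:
  assumes "c \<in> A" "d \<in> A" "p \<in> chart_dom c" "p \<in> chart_dom d"
  shows "metric_rep A g c (chart_map c p) u w =
    metric_rep A g d (chart_map d p) (jac c d p u) (jac c d p w)"
  using assms by (simp add: metric_rep_def chart_inv_map of_coords_jac)

lemma christoffel_levi_civita:
  assumes "c \<in> A" and "x \<in> chart_image c"
  shows "christoffel (metric_rep A g c) x (levi_civita_rep A g c x)"
proof -
  have "levi_civita_rep A g c x = (THE \<Gamma>. christoffel (metric_rep A g c) x \<Gamma>)"
    by (simp add: levi_civita_rep_def christoffel_def)
  with theI'[OF metric_field.christoffel_exists[OF metric_field_chart[OF assms(1)] assms(2)]]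
  show ?thesis by simp
qed

text \<open>The pulled back symbols are again torsion-free and metric, so uniqueness applies.\<close>

lemma levi_civita_jac:
  assumes A: "c \<in> A" "d \<in> A" and p: "p \<in> chart_dom c" "p \<in> chart_dom d"
  shows "jac c d p (levi_civita_rep A g c (chart_map c p) u v) =
    frechet_derivative (\<lambda>z. frechet_derivative (chart_map d \<circ> chart_inv c) (at z) v) (at (chart_map c p)) u +
    levi_civita_rep A g d (chart_map d p) (jac c d p u) (jac c d p v)"
proof -
  let ?\<phi> = "chart_map d \<circ> chart_inv c" and ?x = "chart_map c p" and ?y = "chart_map d p"
  let ?W = "chart_map c ` (chart_dom c \<inter> chart_dom d)"
  let ?P = "jac c d p" and ?Q = "jac d c p"
  let ?Gc = "metric_rep A g c" and ?Gd = "metric_rep A g d"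
  let ?\<Gamma> = "levi_civita_rep A g d ?y"
  define B where "B u v = frechet_derivative (\<lambda>z. frechet_derivative ?\<phi> (at z) v) (at ?x) u" for u v
  \<comment> \<open>The classical inhomogeneous transformation law, read as a definition of pulled
    back symbols. The extra term \<open>B\<close> is the second derivative of the transition map;
    its symmetry is what keeps \<open>\<Gamma>'\<close> torsion-free.\<close>
  define \<Gamma>' where "\<Gamma>' u v = ?Q (B u v + ?\<Gamma> (?P u) (?P v))" for u v
  have W: "open ?W" "?x \<in> ?W" using open_overlap[OF A(1) open_chart_dom[OF A(2)]] p by auto
  have x: "?x \<in> chart_image c" and y: "?y \<in> chart_image d" using p by auto
  note \<phi> = smooth_on_transition[OF A]
  note mc = metric_field_chart[OF A(1)] and md = metric_field_chart[OF A(2)]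
  note ch = christoffel_levi_civita[OF A(2) y]
  have \<Gamma>b: "bilinear ?\<Gamma>" and \<Gamma>s: "?\<Gamma> u v = ?\<Gamma> v u" for u v using ch by (auto simp: christoffel_def)
  have \<Gamma>m: "frechet_derivative (\<lambda>y. ?Gd y v w) (at ?y) u = ?Gd ?y (?\<Gamma> u v) w + ?Gd ?y v (?\<Gamma> u w)"
    for u v w using ch by (simp add: christoffel_def)
  have Bd: "((\<lambda>z. frechet_derivative ?\<phi> (at z) v) has_derivative (\<lambda>u. B u v)) (at ?x)" for v
    unfolding B_def by (rule smooth_on_has_derivative[OF smooth_on_frechet_derivative[OF \<phi>] W(2)])
  have Bs: "B u v = B v u" for u v unfolding B_def by (rule frechet_derivative_commute[OF W \<phi>])
  have Bl: "linear (\<lambda>u. B u v)" for v using Bd has_derivative_linear by blast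
  have P: "linear ?P" "linear ?Q" using linear_jac A p by blast+
  have PQ: "?P (?Q u) = u" for u using jac_compose[OF A(2,1,2)] jac_same A p by simp
  have lin: "linear (\<lambda>u. \<Gamma>' u v)" for v
    unfolding \<Gamma>'_def
    by (intro linearI) (simp_all add: linear_add[OF P(1)] linear_scale[OF P(1)] linear_add[OF P(2)]
      linear_scale[OF P(2)] linear_add[OF Bl] linear_scale[OF Bl] bilinear_ladd[OF \<Gamma>b]
      bilinear_lmul[OF \<Gamma>b] scaleR_add_right)
  have s: "\<Gamma>' u v = \<Gamma>' v u" for u v unfolding \<Gamma>'_def using Bs[of u v] \<Gamma>s[of "?P u" "?P v"] by simp
  then have eq: "(\<lambda>v. \<Gamma>' v u) = \<Gamma>' u" for u by (rule ext)
  have bil: "bilinear \<Gamma>'" unfolding bilinear_def using lin lin[unfolded eq] by blast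
  have Gd: "bilinear (?Gd z)" if "z \<in> chart_image d" for z by (rule metric_field.bil[OF md that])
  have met: "frechet_derivative (\<lambda>z. ?Gc z v w) (at ?x) u = ?Gc ?x (\<Gamma>' u v) w + ?Gc ?x v (\<Gamma>' u w)" for u v w
  proof -
    have \<phi>x: "?\<phi> ?x = ?y" using A p by (simp add: chart_inv_map)
    \<comment> \<open>The metric condition in \<open>c\<close> comes from differentiating the pulled
      back metric. The base point and both vector arguments move with \<open>z\<close>, and the
      latter two produce the terms with \<open>B\<close>.\<close>
    have "((\<lambda>z. ?Gd (?\<phi> z) (frechet_derivative ?\<phi> (at z) v) (frechet_derivative ?\<phi> (at z) w)) has_derivative
       (\<lambda>h. frechet_derivative (\<lambda>y. ?Gd y (frechet_derivative ?\<phi> (at ?x) v) (frechet_derivative ?\<phi> (at ?x) w)) (at ?y) (?P h) +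
         ?Gd (?\<phi> ?x) (B h v) (frechet_derivative ?\<phi> (at ?x) w) +
         ?Gd (?\<phi> ?x) (frechet_derivative ?\<phi> (at ?x) v) (B h w))) (at ?x)"
    proof (rule has_derivative_bilinear_field[OF _ _ Bd Bd])
      show "\<forall>\<^sub>F z in nhds ?x. bilinear (?Gd (?\<phi> z))"
        unfolding eventually_nhds using W Gd
        by (intro exI[of _ ?W]) (auto simp: chart_inv_map[OF A(1)])
      show "((\<lambda>z. ?Gd (?\<phi> z) a b) has_derivative
          (\<lambda>h. frechet_derivative (\<lambda>y. ?Gd y a b) (at ?y) (?P h))) (at ?x)" for a b
        using diff_chain_at[OF jac_has_derivative[OF A p], of "\<lambda>y. ?Gd y a b"]
          metric_field.has_derivative_metric[OF md y, of a b] \<phi>x by (simp add: o_def)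
    qed
    then have "((\<lambda>z. ?Gc z v w) has_derivative
       (\<lambda>h. frechet_derivative (\<lambda>y. ?Gd y (?P v) (?P w)) (at ?y) (?P h) +
         ?Gd ?y (B h v) (?P w) + ?Gd ?y (?P v) (B h w))) (at ?x)"
      unfolding \<phi>x jac_def[symmetric]
    proof (rule has_derivative_transform_within_open[OF _ W])
      fix z assume "z \<in> ?W"
      then obtain q where q: "q \<in> chart_dom c" "q \<in> chart_dom d" "z = chart_map c q" by blast
      show "?Gd (?\<phi> z) (frechet_derivative ?\<phi> (at z) v) (frechet_derivative ?\<phi> (at z) w) = ?Gc z v w"
        using metric_rep_jac[OF A q(1,2), of v w] q A by (simp add: jac_def chart_inv_map)
    qed
    from frechet_derivative_at[OF this, symmetric]
    have "frechet_derivative (\<lambda>z. ?Gc z v w) (at ?x) u =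
        ?Gd ?y (?\<Gamma> (?P u) (?P v)) (?P w) + ?Gd ?y (?P v) (?\<Gamma> (?P u) (?P w)) +
        ?Gd ?y (B u v) (?P w) + ?Gd ?y (?P v) (B u w)" by (simp add: \<Gamma>m)
    moreover have "?Gc ?x (\<Gamma>' u v) w = ?Gd ?y (B u v) (?P w) + ?Gd ?y (?\<Gamma> (?P u) (?P v)) (?P w)"
      by (simp add: metric_rep_jac[OF A p] \<Gamma>'_def PQ bilinear_ladd[OF Gd[OF y]])
    moreover have "?Gc ?x v (\<Gamma>' u w) = ?Gd ?y (?P v) (B u w) + ?Gd ?y (?P v) (?\<Gamma> (?P u) (?P w))"
      by (simp add: metric_rep_jac[OF A p] \<Gamma>'_def PQ bilinear_radd[OF Gd[OF y]])
    ultimately show ?thesis by simp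
  qed
  have "christoffel ?Gc ?x \<Gamma>'" using bil s met by (simp add: christoffel_def)
  then have "levi_civita_rep A g c ?x = \<Gamma>'"
    using metric_field.christoffel_exists[OF mc x] christoffel_levi_civita[OF A(1) x] by blast
  then show ?thesis by (simp add: \<Gamma>'_def PQ B_def)
qed

text \<open>Resolves the definite description: a vector representing the differential exists in one
  chart by nondegeneracy, and it is unique because a tangent vector is determined by its coordinates
  in that chart.\<close>

lemma gradient:
  assumes f: "smooth_function A f"
  shows gradient_tangent: "gradient A g f p \<in> tangent_space A p"
    and metric_gradient: "\<And>w. w \<in> tangent_space A p \<Longrightarrow> g p (gradient A g f p) w = differential A f p w"
proof -
  obtain c where c: "c \<in> A" "p \<in> chart_dom c" using chart_cover by blast
  let ?x = "chart_map c p" and ?G = "metric_rep A g c"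
  have x: "?x \<in> chart_image c" using c by simp
  note m = metric_field_chart[OF c(1)]
  note nd = metric_field.bil[OF m x] metric_field.nondeg[OF m x]
  have "linear (frechet_derivative (f \<circ> chart_inv c) (at ?x))"
    using f c x by (intro linear_frechet_derivative smooth_on_differentiable)
      (auto simp: smooth_function_def)
  then obtain u where u: "\<And>w. ?G ?x u w = frechet_derivative (f \<circ> chart_inv c) (at ?x) w"
    using nondegenerate_representation[OF nd] by blast
  define z where "z = of_coords A c p u"
  have z: "z \<in> tangent_space A p" "z c = u" using of_coords[OF c] by (auto simp: z_def)
  have key: "g p y w = ?G ?x (y c) (w c)" if "y \<in> tangent_space A p" "w \<in> tangent_space A p" for y w
    using metric_rep_tangent[OF c that] by simp
  have zw: "\<forall>w\<in>tangent_space A p. g p z w = differential A f p w"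
    using key[OF z(1)] z(2) u differential_chart[OF f _ c] by simp
  have "y = z" if y: "y \<in> tangent_space A p" "\<forall>w\<in>tangent_space A p. g p y w = differential A f p w" for y
  proof (rule tangent_space_eqI[OF y(1) z(1) c], rule nondegenerate_eqI[OF nd])
    fix w
    let ?w = "of_coords A c p w"
    have w: "?w \<in> tangent_space A p" "?w c = w" using of_coords[OF c] by auto
    have "g p y ?w = g p z ?w" using y(2) zw w(1) by simp
    then show "?G ?x (y c) w = ?G ?x (z c) w" using key[OF y(1) w(1)] key[OF z(1) w(1)] w(2) by simp
  qed
  then have "gradient A g f p = z"
    unfolding gradient_def by (intro the_equality conjI z(1) zw) (elim conjE)
  then show "gradient A g f p \<in> tangent_space A p"
    "\<And>w. w \<in> tangent_space A p \<Longrightarrow> g p (gradient A g f p) w = differential A f p w"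
    using z(1) zw by simp_all
qed

lemma metric_rep_gradient:
  assumes f: "smooth_function A f" and c: "c \<in> A" "p \<in> chart_dom c"
  shows "metric_rep A g c (chart_map c p) (gradient A g f p c) w =
    frechet_derivative (f \<circ> chart_inv c) (at (chart_map c p)) w"
proof -
  let ?w = "of_coords A c p w"
  have w: "?w \<in> tangent_space A p" "?w c = w" using of_coords[OF c] by auto
  show ?thesis
    using metric_rep_tangent[OF c gradient_tangent[OF f] w(1)] metric_gradient[OF f w(1)]
      differential_chart[OF f w(1) c] w(2) by simp
qed

lemma smooth_on_gradient:
  assumes f: "smooth_function A f" and c: "c \<in> A"
  shows "smooth_on (chart_image c) (\<lambda>x. gradient A g f (chart_inv c x) c)"
proof (rule metric_field.smooth_on_representation[OF metric_field_chart[OF c]])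
  show "smooth_on (chart_image c) (\<lambda>x. frechet_derivative (f \<circ> chart_inv c) (at x) i)" for i
    using f c by (intro smooth_on_frechet_derivative) (simp add: smooth_function_def)
  fix x w assume "x \<in> chart_image c"
  then obtain p where p: "p \<in> chart_dom c" "x = chart_map c p" "chart_inv c x = p"
    using chart_image_inv[OF c] by blast
  show "metric_rep A g c x (gradient A g f (chart_inv c x) c) w =
      frechet_derivative (f \<circ> chart_inv c) (at x) w"
    using metric_rep_gradient[OF f c p(1)] p by simp
qed

section \<open>Curves\<close>

lemma open_curve_chart:
  assumes "open I" and "smooth_curve A I \<gamma>" and "c \<in> A"
  shows "open {t \<in> I. \<gamma> t \<in> chart_dom c}"
proof -
  have "continuous_on I \<gamma>" using assms(2) by (simp add: smooth_curve_def)
  from continuous_open_preimage[OF this assms(1) open_chart_dom[OF assms(3)]]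
  show ?thesis by (simp add: vimage_def Int_def)
qed

context
  fixes I \<gamma>
  assumes I: "open I" and \<gamma>: "smooth_curve A I \<gamma>"
begin

lemma velocity_has_vector_derivative:
  assumes "c \<in> A" "t \<in> I" "\<gamma> t \<in> chart_dom c"
  shows "((chart_map c \<circ> \<gamma>) has_vector_derivative velocity A \<gamma> t c) (at t)"
proof -
  have "smooth_on {t \<in> I. \<gamma> t \<in> chart_dom c} (chart_map c \<circ> \<gamma>)"
    using \<gamma> assms by (simp add: smooth_curve_def)
  then have "(chart_map c \<circ> \<gamma>) differentiable (at t)"
    by (rule smooth_on_differentiable) (use assms in simp)
  then show ?thesis using assms by (simp add: velocity_def vector_derivative_works)
qed

lemma smooth_on_velocity:
  assumes c: "c \<in> A"
  shows "smooth_on {t \<in> I. \<gamma> t \<in> chart_dom c} (\<lambda>t. velocity A \<gamma> t c)"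
proof (rule smooth_on_cong[OF open_curve_chart[OF I \<gamma> c]])
  show "smooth_on {t \<in> I. \<gamma> t \<in> chart_dom c} (\<lambda>t. frechet_derivative (chart_map c \<circ> \<gamma>) (at t) 1)"
    by (rule smooth_on_frechet_derivative) (use \<gamma> c in \<open>simp add: smooth_curve_def\<close>)
  fix t assume t: "t \<in> {t \<in> I. \<gamma> t \<in> chart_dom c}"
  then have "((chart_map c \<circ> \<gamma>) has_derivative (\<lambda>h. h *\<^sub>R velocity A \<gamma> t c)) (at t)"
    using velocity_has_vector_derivative[OF c] by (simp add: has_vector_derivative_def)
  from frechet_derivative_at[OF this, symmetric]
  show "frechet_derivative (chart_map c \<circ> \<gamma>) (at t) 1 = velocity A \<gamma> t c" by simp
qed

lemma acceleration_has_vector_derivative: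
  assumes "c \<in> A" "t \<in> I" "\<gamma> t \<in> chart_dom c"
  shows "((\<lambda>t. velocity A \<gamma> t c) has_vector_derivative
    vector_derivative (\<lambda>t. velocity A \<gamma> t c) (at t)) (at t)"
  using smooth_on_differentiable[OF smooth_on_velocity[OF assms(1)], of t] assms
  by (simp add: vector_derivative_works)

lemma velocity_jac:
  assumes A: "c \<in> A" "d \<in> A" and t: "t \<in> I" "\<gamma> t \<in> chart_dom c" "\<gamma> t \<in> chart_dom d"
  shows "velocity A \<gamma> t d = jac c d (\<gamma> t) (velocity A \<gamma> t c)"
proof -
  have "((chart_map d \<circ> chart_inv c) \<circ> (chart_map c \<circ> \<gamma>) has_derivative
      jac c d (\<gamma> t) \<circ> (\<lambda>h. h *\<^sub>R velocity A \<gamma> t c)) (at t)"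
    by (rule diff_chain_at[OF velocity_has_vector_derivative[OF A(1) t(1,2),
            unfolded has_vector_derivative_def]])
      (simp only: comp_apply jac_has_derivative[OF A t(2,3)])
  then have "((chart_map d \<circ> chart_inv c) \<circ> (chart_map c \<circ> \<gamma>) has_vector_derivative
      jac c d (\<gamma> t) (velocity A \<gamma> t c)) (at t)"
    by (simp only: has_vector_derivative_def comp_def linear_scale[OF linear_jac[OF A t(2,3)]])
  then have "((chart_map d \<circ> \<gamma>) has_vector_derivative jac c d (\<gamma> t) (velocity A \<gamma> t c)) (at t)"
    by (rule has_vector_derivative_transform_within_open[OF _ open_curve_chart[OF I \<gamma> A(1)]])
      (use t A in \<open>auto simp: chart_inv_map\<close>)
  then show ?thesis
    using vector_derivative_unique_at[OF velocity_has_vector_derivative[OF A(2) t(1,3)]] by blast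
qed

lemma velocity_tangent: "t \<in> I \<Longrightarrow> velocity A \<gamma> t \<in> tangent_space A (\<gamma> t)"
  by (rule tangent_spaceI) (rule velocity_jac, assumption+, auto simp: velocity_def)

text \<open>The coordinate acceleration alone is no tangent vector: differentiating
  \<open>velocity_jac\<close> along the curve leaves a second derivative of the transition map. The
  inhomogeneous term in \<open>levi_civita_jac\<close> cancels it exactly.\<close>

lemma covariant_derivative_velocity_tangent:
  assumes t: "t \<in> I"
  shows "covariant_derivative A g \<gamma> (velocity A \<gamma>) t \<in> tangent_space A (\<gamma> t)"
proof (rule tangent_spaceI)
  fix c d assume A: "c \<in> A" "d \<in> A" and p: "\<gamma> t \<in> chart_dom c" "\<gamma> t \<in> chart_dom d"
  let ?\<phi> = "chart_map d \<circ> chart_inv c" and ?x = "chart_map c \<circ> \<gamma>"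
  let ?W = "chart_map c ` (chart_dom c \<inter> chart_dom d)"
  let ?T = "{t \<in> I. \<gamma> t \<in> chart_dom c} \<inter> {t \<in> I. \<gamma> t \<in> chart_dom d}"
  let ?v = "\<lambda>c t. velocity A \<gamma> t c"
  let ?acc = "\<lambda>c. vector_derivative (\<lambda>t. velocity A \<gamma> t c) (at t)"
  let ?D2 = "\<lambda>u. frechet_derivative (\<lambda>z. frechet_derivative ?\<phi> (at z) u) (at (?x t))"
  have T: "open ?T" "t \<in> ?T" 
    using open_curve_chart[OF I \<gamma> A(1)] open_curve_chart[OF I \<gamma> A(2)] t p by auto
  note \<phi> = smooth_on_transition[OF A]
  have "((\<lambda>s. frechet_derivative ?\<phi> (at (?x s)) (?v c s)) has_derivative
     (\<lambda>h. ?D2 (?v c t) (h *\<^sub>R ?v c t) + frechet_derivative ?\<phi> (at (?x t)) (h *\<^sub>R ?acc c))) (at t)"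
  proof (rule has_derivative_linear_field[where L="\<lambda>s. frechet_derivative ?\<phi> (at (?x s))"
        and a="\<lambda>t. ?v c t" and L'="\<lambda>u h. ?D2 u (h *\<^sub>R ?v c t)"])
    show "\<forall>\<^sub>F s in nhds t. linear (frechet_derivative ?\<phi> (at (?x s)))"
      unfolding eventually_nhds
    proof (rule exI[of _ ?T], intro conjI T ballI)
      fix s assume "s \<in> ?T"
      then show "linear (frechet_derivative ?\<phi> (at (?x s)))"
        using linear_jac[OF A, of "\<gamma> s"] by (simp add: jac_def)
    qed
    show "((\<lambda>s. frechet_derivative ?\<phi> (at (?x s)) u) has_derivative (\<lambda>h. ?D2 u (h *\<^sub>R ?v c t))) (at t)" for u
    proof -
      have "((\<lambda>z. frechet_derivative ?\<phi> (at z) u) has_derivative ?D2 u) (at (?x t))"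
        by (rule smooth_on_has_derivative[OF smooth_on_frechet_derivative[OF \<phi>]]) (use p in simp)
      from diff_chain_at[OF velocity_has_vector_derivative[OF A(1) t p(1), unfolded has_vector_derivative_def] this]
      show ?thesis by (simp add: o_def)
    qed
    show "((\<lambda>t. ?v c t) has_derivative (\<lambda>h. h *\<^sub>R ?acc c)) (at t)"
      using acceleration_has_vector_derivative[OF A(1) t p(1)] by (simp add: has_vector_derivative_def)
  qed
  then have "((\<lambda>s. ?v d s) has_derivative
     (\<lambda>h. ?D2 (?v c t) (h *\<^sub>R ?v c t) + frechet_derivative ?\<phi> (at (?x t)) (h *\<^sub>R ?acc c))) (at t)"
    by (rule has_derivative_transform_within_open[OF _ T])
      (use velocity_jac[OF A] in \<open>simp add: jac_def\<close>)
  moreover have "((\<lambda>s. ?v d s) has_derivative (\<lambda>h. h *\<^sub>R ?acc d)) (at t)"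
    using acceleration_has_vector_derivative[OF A(2) t p(2)] by (simp add: has_vector_derivative_def)
  ultimately have "(\<lambda>h. h *\<^sub>R ?acc d) =
     (\<lambda>h. ?D2 (?v c t) (h *\<^sub>R ?v c t) + frechet_derivative ?\<phi> (at (?x t)) (h *\<^sub>R ?acc c))"
    by (rule has_derivative_unique[rotated])
  from fun_cong[OF this, of 1]
  have "?acc d = ?D2 (?v c t) (?v c t) + jac c d (\<gamma> t) (?acc c)" by (simp add: jac_def)
  then show "covariant_derivative A g \<gamma> (velocity A \<gamma>) t d =
      jac c d (\<gamma> t) (covariant_derivative A g \<gamma> (velocity A \<gamma>) t c)"
    using A p levi_civita_jac[OF A p, of "?v c t" "?v c t"] velocity_jac[OF A t p]
    by (simp add: covariant_derivative_def linear_add[OF linear_jac[OF A p]])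
qed (auto simp: covariant_derivative_def)

end

end

section \<open>Trajectories as integral curves\<close>

text \<open>Differentiability is not assumed: \<open>vector_derivative\<close> chooses a value
  satisfying a predicate, and the predicates of \<open>f\<close> and \<open>h\<close>
  coincide.\<close>

lemma vector_derivative_cong_open:
  assumes "open T" "t \<in> T" and "\<And>s. s \<in> T \<Longrightarrow> f s = h s"
  shows "vector_derivative f (at t) = vector_derivative h (at t)"
proof -
  have "(f has_vector_derivative D) (at t) \<longleftrightarrow> (h has_vector_derivative D) (at t)" for D
    using has_vector_derivative_transform_within_open[OF _ assms(1,2), of f D h]
      has_vector_derivative_transform_within_open[OF _ assms(1,2), of h D f] assms(3) by auto
  then show ?thesis by (simp add: vector_derivative_def)
qed

lemma smooth_on_Pair:
  fixes f :: "'a::real_normed_vector \<Rightarrow> 'b::real_normed_vector" and h :: "'a \<Rightarrow> 'c::real_normed_vector"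
  assumes "open S" "smooth_on S f" "smooth_on S h"
  shows "smooth_on S (\<lambda>x. (f x, h x))"
proof -
  have 1: "bounded_linear (\<lambda>y. (y, 0 :: 'c))" and 2: "bounded_linear (\<lambda>y. (0 :: 'b, y))"
    by (intro bounded_linear_Pair bounded_linear_ident bounded_linear_zero)+
  have "smooth_on S (\<lambda>x. (f x, 0) + (0, h x))"
    by (intro smooth_on_add assms bounded_linear.smooth_on[OF 1] bounded_linear.smooth_on[OF 2])
  then show ?thesis by simp
qed

context smooth_manifold
begin

lemma tangent_space_uminus:
  assumes v: "v \<in> tangent_space A p"
  shows "(\<lambda>c. - v c) \<in> tangent_space A p"
  using tangent_space_diff[OF tangent_space_diff[OF v v] v] by simp

lemma velocity_cong:
  assumes "open T" "t \<in> T" and eq: "\<And>s. s \<in> T \<Longrightarrow> \<gamma> s = \<delta> s"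
  shows "velocity A \<gamma> t = velocity A \<delta> t"
proof
  fix c :: "('a, 'e) chart"
  have "vector_derivative (chart_map c \<circ> \<gamma>) (at t) = vector_derivative (chart_map c \<circ> \<delta>) (at t)"
    by (rule vector_derivative_cong_open[OF assms(1,2)]) (simp add: eq)
  then show "velocity A \<gamma> t c = velocity A \<delta> t c" using eq[OF assms(2)] by (simp add: velocity_def)
qed

lemma covariant_derivative_velocity_cong:
  assumes "open T" "t \<in> T" and eq: "\<And>s. s \<in> T \<Longrightarrow> \<gamma> s = \<delta> s"
  shows "covariant_derivative A g \<gamma> (velocity A \<gamma>) t = covariant_derivative A g \<delta> (velocity A \<delta>) t"
proof
  fix c
  have v: "velocity A \<gamma> s = velocity A \<delta> s" if "s \<in> T" for s by (rule velocity_cong[OF assms(1) that eq])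
  have "vector_derivative (\<lambda>s. velocity A \<gamma> s c) (at t) = vector_derivative (\<lambda>s. velocity A \<delta> s c) (at t)"
    by (rule vector_derivative_cong_open[OF assms(1,2)]) (simp add: v)
  then show "covariant_derivative A g \<gamma> (velocity A \<gamma>) t c = covariant_derivative A g \<delta> (velocity A \<delta>) t c"
    by (simp add: covariant_derivative_def v[OF assms(2)] eq[OF assms(2)])
qed

lemma smooth_curve_cong:
  assumes I: "open I" and \<gamma>: "smooth_curve A I \<gamma>" and eq: "\<And>s. s \<in> I \<Longrightarrow> \<gamma> s = \<delta> s"
  shows "smooth_curve A I \<delta>"
proof -
  have c\<gamma>: "continuous_on I \<gamma>" using \<gamma> by (simp add: smooth_curve_def)
  then have "continuous_on I \<delta>" by (rule continuous_on_eq) (rule eq)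
  moreover have "smooth_on {t \<in> I. \<delta> t \<in> chart_dom c} (chart_map c \<circ> \<delta>)" if c: "c \<in> A" for c
  proof -
    have T: "{t \<in> I. \<delta> t \<in> chart_dom c} = {t \<in> I. \<gamma> t \<in> chart_dom c}" using eq by auto
    have "open {t \<in> I. \<gamma> t \<in> chart_dom c}"
      using continuous_open_preimage[OF c\<gamma> I open_chart_dom[OF c]] by (simp add: vimage_def Int_def)
    moreover have "smooth_on {t \<in> I. \<gamma> t \<in> chart_dom c} (chart_map c \<circ> \<gamma>)"
      using \<gamma> c by (simp add: smooth_curve_def)
    ultimately show ?thesis unfolding T by (rule smooth_on_cong) (simp add: eq)
  qed
  ultimately show ?thesis by (simp add: smooth_curve_def)
qed

lemma smooth_curve_Un:
  assumes I: "open I" "open J" and \<gamma>: "smooth_curve A I \<gamma>" "smooth_curve A J \<gamma>"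
  shows "smooth_curve A (I \<union> J) \<gamma>"
proof -
  have cont: "continuous_on I \<gamma>" "continuous_on J \<gamma>" using \<gamma> by (simp_all add: smooth_curve_def)
  then have "continuous_on (I \<union> J) \<gamma>" using I by (intro continuous_on_open_Un) auto
  moreover have "smooth_on {t \<in> I \<union> J. \<gamma> t \<in> chart_dom c} (chart_map c \<circ> \<gamma>)" if c: "c \<in> A" for c
  proof (rule smooth_on_locally)
    fix t assume "t \<in> {t \<in> I \<union> J. \<gamma> t \<in> chart_dom c}"
    then have "t \<in> {t \<in> I. \<gamma> t \<in> chart_dom c} \<or> t \<in> {t \<in> J. \<gamma> t \<in> chart_dom c}" by blast
    moreover have "open {t \<in> I. \<gamma> t \<in> chart_dom c}" "open {t \<in> J. \<gamma> t \<in> chart_dom c}"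
      using continuous_open_preimage[OF cont(1) I(1) open_chart_dom[OF c]]
        continuous_open_preimage[OF cont(2) I(2) open_chart_dom[OF c]] by (simp_all add: vimage_def Int_def)
    moreover have "smooth_on {t \<in> I. \<gamma> t \<in> chart_dom c} (chart_map c \<circ> \<gamma>)"
      "smooth_on {t \<in> J. \<gamma> t \<in> chart_dom c} (chart_map c \<circ> \<gamma>)"
      using \<gamma> c by (simp_all add: smooth_curve_def)
    ultimately show "\<exists>U. open U \<and> t \<in> U \<and> smooth_on U (chart_map c \<circ> \<gamma>)" by blast
  qed
  ultimately show ?thesis by (simp add: smooth_curve_def)
qed

lemma trajectory_on_cong:
  assumes \<gamma>: "trajectory_on A g F V I \<gamma>" and eq: "\<And>s. s \<in> I \<Longrightarrow> \<gamma> s = \<delta> s"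
  shows "trajectory_on A g F V I \<delta>"
proof -
  have I: "open I" "is_interval I" "I \<noteq> {}" and s: "smooth_curve A I \<gamma>"
    and e: "\<And>t. t \<in> I \<Longrightarrow> covariant_derivative A g \<gamma> (velocity A \<gamma>) t =
        (\<lambda>c. F (\<gamma> t) (velocity A \<gamma> t) c - gradient A g V (\<gamma> t) c)"
    using \<gamma> by (simp_all add: trajectory_on_def)
  have "covariant_derivative A g \<delta> (velocity A \<delta>) t =
        (\<lambda>c. F (\<delta> t) (velocity A \<delta> t) c - gradient A g V (\<delta> t) c)" if t: "t \<in> I" for t
    using e[OF t] covariant_derivative_velocity_cong[OF I(1) t eq, where g=g] velocity_cong[OF I(1) t eq] eq[OF t]
    by simp
  then show ?thesis using I smooth_curve_cong[OF I(1) s eq] by (simp add: trajectory_on_def)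
qed

lemma trajectory_on_Un:
  assumes "trajectory_on A g F V I \<gamma>" and "trajectory_on A g F V J \<gamma>" and "I \<inter> J \<noteq> {}"
  shows "trajectory_on A g F V (I \<union> J) \<gamma>"
proof -
  have "is_interval (I \<union> J)"
    using assms connected_Un[of I J] by (simp add: trajectory_on_def is_interval_connected_1)
  then show ?thesis
    using assms smooth_curve_Un[of I J \<gamma>] by (auto simp: trajectory_on_def)
qed

end

locale dynamics = lorentzian_manifold A g
  for A :: "('a::t2_space, 'e::euclidean_space) chart set" and g +
  fixes F :: "'a \<Rightarrow> ('a, 'e) tvec \<Rightarrow> ('a, 'e) tvec" and V :: "'a \<Rightarrow> real"
  assumes smooth_F: "smooth_endo_field A F" and smooth_V: "smooth_function A V"
begin

text \<open>The coordinate acceleration prescribed by the equation, with the Christoffel term moved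
  to the right-hand side.\<close>

definition force :: "('a, 'e) chart \<Rightarrow> 'e \<Rightarrow> 'e \<Rightarrow> 'e" where
  "force c x v = endo_rep A F c x v - gradient A g V (chart_inv c x) c - levi_civita_rep A g c x v v"

definition phase_field :: "('a, 'e) chart \<Rightarrow> 'e \<times> 'e \<Rightarrow> 'e \<times> 'e" where
  "phase_field c z = (snd z, force c (fst z) (snd z))"

lemma F_tangent: "v \<in> tangent_space A p \<Longrightarrow> F p v \<in> tangent_space A p"
  using smooth_F by (simp add: smooth_endo_field_def)

lemma linear_endo_rep: "c \<in> A \<Longrightarrow> x \<in> chart_image c \<Longrightarrow> linear (endo_rep A F c x)"
  using smooth_F unfolding smooth_endo_field_def by blast

lemma endo_rep_tangent:
  "c \<in> A \<Longrightarrow> p \<in> chart_dom c \<Longrightarrow> v \<in> tangent_space A p \<Longrightarrow>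
    endo_rep A F c (chart_map c p) (v c) = F p v c"
  by (simp add: endo_rep_def chart_inv_map of_coords_eq)

lemma bilinear_levi_civita:
  "c \<in> A \<Longrightarrow> x \<in> chart_image c \<Longrightarrow> bilinear (levi_civita_rep A g c x)"
  using christoffel_levi_civita by (simp add: christoffel_def)

text \<open>The fields are known to be smooth in the point for fixed vectors. Joint smoothness holds
  because \<open>force\<close> is polynomial in the velocity, with smooth coefficients found by
  expansion in the basis.\<close>

lemma smooth_on_phase_field:
  assumes c: "c \<in> A"
  shows "smooth_on (chart_image c \<times> UNIV) (phase_field c)"
proof -
  let ?S = "chart_image c" let ?Z = "?S \<times> (UNIV :: 'e set)"
  have S: "open ?S" by (rule open_chart_image[OF c])
  then have Z: "open ?Z" by (rule open_Times) simp
  have snd: "smooth_on ?Z snd"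
    using bounded_linear.smooth_on[OF bounded_linear_snd Z smooth_on_ident[OF Z]] .
  have fst: "smooth_on ?Z (\<lambda>z. f (fst z))" if "smooth_on ?S f" for f :: "'e \<Rightarrow> 'e"
    using smooth_on_compose_linear[OF bounded_linear_fst S that]
    by (rule smooth_on_subset) auto
  have coord: "smooth_on ?Z (\<lambda>z. snd z \<bullet> i)" for i
    by (rule bounded_linear.smooth_on[OF bounded_linear_inner_left Z snd])
  have endo: "smooth_on ?Z (\<lambda>z. endo_rep A F c (fst z) (snd z))"
  proof (rule smooth_on_cong[OF Z])
    show "smooth_on ?Z (\<lambda>z. \<Sum>i\<in>Basis. (snd z \<bullet> i) *\<^sub>R endo_rep A F c (fst z) i)"
      by (intro smooth_on_sum Z bounded_bilinear.smooth_on[OF bounded_bilinear_scaleR] coord fst)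
        (use smooth_F c in \<open>simp add: smooth_endo_field_def\<close>)
    show "(\<Sum>i\<in>Basis. (snd z \<bullet> i) *\<^sub>R endo_rep A F c (fst z) i) = endo_rep A F c (fst z) (snd z)"
      if "z \<in> ?Z" for z
      by (rule linear_eq_sum_Basis[symmetric], rule linear_endo_rep[OF c]) (use that in auto)
  qed
  have lc: "smooth_on ?Z (\<lambda>z. levi_civita_rep A g c (fst z) (snd z) (snd z))"
  proof (rule smooth_on_cong[OF Z])
    show "smooth_on ?Z (\<lambda>z. \<Sum>i\<in>Basis. (snd z \<bullet> i) *\<^sub>R
        (\<Sum>j\<in>Basis. (snd z \<bullet> j) *\<^sub>R levi_civita_rep A g c (fst z) i j))"
      by (intro smooth_on_sum Z bounded_bilinear.smooth_on[OF bounded_bilinear_scaleR] coord fst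
          metric_field.smooth_on_christoffel[OF metric_field_chart[OF c]] christoffel_levi_civita[OF c])
    fix z assume "z \<in> ?Z"
    then have b: "bilinear (levi_civita_rep A g c (fst z))" by (intro bilinear_levi_civita[OF c]) auto
    then have 1: "linear (levi_civita_rep A g c (fst z) i)" and
      2: "linear (\<lambda>u. levi_civita_rep A g c (fst z) u w)" for i w by (simp_all add: bilinear_def)
    show "(\<Sum>i\<in>Basis. (snd z \<bullet> i) *\<^sub>R (\<Sum>j\<in>Basis. (snd z \<bullet> j) *\<^sub>R levi_civita_rep A g c (fst z) i j)) =
        levi_civita_rep A g c (fst z) (snd z) (snd z)"
      by (simp only: linear_eq_sum_Basis[OF 1, symmetric] linear_eq_sum_Basis[OF 2, symmetric])
  qed
  have "smooth_on ?Z (\<lambda>z. (snd z, endo_rep A F c (fst z) (snd z) -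
      gradient A g V (chart_inv c (fst z)) c - levi_civita_rep A g c (fst z) (snd z) (snd z)))"
    by (intro smooth_on_Pair smooth_on_diff Z snd endo lc fst smooth_on_gradient[OF smooth_V c])
  then show ?thesis by (simp add: phase_field_def[abs_def] force_def)
qed

lemma covariant_derivative_eq_iff_force:
  assumes I: "open I" and \<gamma>: "smooth_curve A I \<gamma>" and t: "t \<in> I"
    and c: "c \<in> A" "\<gamma> t \<in> chart_dom c"
  shows "covariant_derivative A g \<gamma> (velocity A \<gamma>) t =
      (\<lambda>c. F (\<gamma> t) (velocity A \<gamma> t) c - gradient A g V (\<gamma> t) c) \<longleftrightarrow>
    vector_derivative (\<lambda>s. velocity A \<gamma> s c) (at t) = force c (chart_map c (\<gamma> t)) (velocity A \<gamma> t c)"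
    (is "?l = ?r \<longleftrightarrow> _")
proof -
  have l: "?l \<in> tangent_space A (\<gamma> t)" by (rule covariant_derivative_velocity_tangent[OF I \<gamma> t])
  have v: "velocity A \<gamma> t \<in> tangent_space A (\<gamma> t)" by (rule velocity_tangent[OF I \<gamma> t])
  have r: "?r \<in> tangent_space A (\<gamma> t)"
    by (intro tangent_space_diff F_tangent v gradient_tangent smooth_V)
  have "?l = ?r \<longleftrightarrow> ?l c = ?r c" using tangent_space_eqI[OF l r c] by metis
  also have "\<dots> \<longleftrightarrow> vector_derivative (\<lambda>s. velocity A \<gamma> s c) (at t) =
      force c (chart_map c (\<gamma> t)) (velocity A \<gamma> t c)"
    using c endo_rep_tangent[OF c v]
    by (auto simp: covariant_derivative_def force_def chart_inv_map algebra_simps)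
  finally show ?thesis .
qed

lemma trajectory_onI:
  assumes I: "open I" "is_interval I" "I \<noteq> {}" and \<gamma>: "smooth_curve A I \<gamma>"
    and "\<And>t. t \<in> I \<Longrightarrow> \<exists>c\<in>A. \<gamma> t \<in> chart_dom c \<and>
      ((\<lambda>s. velocity A \<gamma> s c) has_vector_derivative force c (chart_map c (\<gamma> t)) (velocity A \<gamma> t c)) (at t)"
  shows "trajectory_on A g F V I \<gamma>"
proof -
  have "covariant_derivative A g \<gamma> (velocity A \<gamma>) t =
      (\<lambda>c. F (\<gamma> t) (velocity A \<gamma> t) c - gradient A g V (\<gamma> t) c)" if t: "t \<in> I" for t
  proof -
    obtain c where c: "c \<in> A" "\<gamma> t \<in> chart_dom c" and
      d: "((\<lambda>s. velocity A \<gamma> s c) has_vector_derivative force c (chart_map c (\<gamma> t)) (velocity A \<gamma> t c)) (at t)"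
      using assms(5)[OF t] by blast
    show ?thesis
      unfolding covariant_derivative_eq_iff_force[OF I(1) \<gamma> t c] using d by (rule vector_derivative_at)
  qed
  then show ?thesis using I \<gamma> by (simp add: trajectory_on_def)
qed

lemma trajectory_on_velocity:
  assumes \<gamma>: "trajectory_on A g F V I \<gamma>" and t: "t \<in> I" and c: "c \<in> A" "\<gamma> t \<in> chart_dom c"
  shows "((\<lambda>s. velocity A \<gamma> s c) has_vector_derivative
    force c (chart_map c (\<gamma> t)) (velocity A \<gamma> t c)) (at t)"
proof -
  have I: "open I" and s: "smooth_curve A I \<gamma>"
    and e: "covariant_derivative A g \<gamma> (velocity A \<gamma>) t =
        (\<lambda>c. F (\<gamma> t) (velocity A \<gamma> t) c - gradient A g V (\<gamma> t) c)"
    using \<gamma> t by (simp_all add: trajectory_on_def)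
  from e have "vector_derivative (\<lambda>s. velocity A \<gamma> s c) (at t) =
      force c (chart_map c (\<gamma> t)) (velocity A \<gamma> t c)"
    by (simp only: covariant_derivative_eq_iff_force[OF I s t c])
  then show ?thesis using acceleration_has_vector_derivative[OF I s c(1) t c(2)] by simp
qed

lemma trajectory_on_phase_field:
  assumes \<gamma>: "trajectory_on A g F V I \<gamma>" and t: "t \<in> I" and c: "c \<in> A" "\<gamma> t \<in> chart_dom c"
  shows "((\<lambda>s. (chart_map c (\<gamma> s), velocity A \<gamma> s c)) has_vector_derivative
    phase_field c (chart_map c (\<gamma> t), velocity A \<gamma> t c)) (at t)"
proof -
  have I: "open I" and s: "smooth_curve A I \<gamma>" using \<gamma> by (simp_all add: trajectory_on_def)
  show ?thesis
    using has_vector_derivative_Pair[OF velocity_has_vector_derivative[OF I s c(1) t c(2)]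
        trajectory_on_velocity[OF assms]]
    by (simp add: phase_field_def)
qed

lemma trajectory_of_integral_curve:
  assumes c: "c \<in> A" and T: "open T" "is_interval T" "T \<noteq> {}"
    and z: "\<And>t. t \<in> T \<Longrightarrow> z t \<in> chart_image c \<times> UNIV"
    and z': "\<And>t. t \<in> T \<Longrightarrow> (z has_vector_derivative phase_field c (z t)) (at t)"
  shows "trajectory_on A g F V T (\<lambda>t. chart_inv c (fst (z t)))"
proof -
  define \<gamma> where "\<gamma> t = chart_inv c (fst (z t))" for t
  have zx: "fst (z t) \<in> chart_image c" if "t \<in> T" for t using z[OF that] by (simp add: mem_Times_iff)
  have dom: "\<gamma> t \<in> chart_dom c" and x: "chart_map c (\<gamma> t) = fst (z t)" if "t \<in> T" for t
    using chart_inv_dom[OF c zx[OF that]] chart_map_inv[OF c zx[OF that]] by (simp_all add: \<gamma>_def)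
  have "continuous_on T z"
    using z' by (meson continuous_at_imp_continuous_on has_vector_derivative_continuous)
  then have cf: "continuous_on T (\<lambda>t. fst (z t))" by (intro continuous_intros)
  have cont: "continuous_on T \<gamma>"
    unfolding \<gamma>_def by (rule continuous_on_compose2[OF continuous_on_chart_inv[OF c] cf]) (use zx in blast)
  have "smooth_on {t \<in> T. \<gamma> t \<in> chart_dom d} (chart_map d \<circ> \<gamma>)" if d: "d \<in> A" for d
  proof -
    let ?T = "{t \<in> T. \<gamma> t \<in> chart_dom d}"
    let ?W = "chart_map c ` (chart_dom c \<inter> chart_dom d)"
    have W: "open ?W" by (rule open_overlap[OF c open_chart_dom[OF d]])
    have oT: "open ?T"
      using continuous_open_preimage[OF cont T(1) open_chart_dom[OF d]] by (simp add: vimage_def Int_def)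
    have Z: "open (fst -` ?W :: ('e \<times> 'e) set)"
      by (rule open_vimage[OF W]) (intro continuous_intros)
    \<comment> \<open>In another chart \<open>d\<close> the curve is a smooth function on phase
      space, the transition map after \<open>fst\<close>, evaluated along the integral
      curve.\<close>
    have "smooth_on ?T (\<lambda>t. (chart_map d \<circ> chart_inv c) (fst (z t)))"
    proof (rule smooth_on_compose_integral_curve[OF oT Z])
      show "smooth_on (fst -` ?W) (phase_field c)"
        by (rule smooth_on_subset[OF smooth_on_phase_field[OF c]]) auto
      show "smooth_on (fst -` ?W) (\<lambda>z. (chart_map d \<circ> chart_inv c) (fst z))"
        by (rule smooth_on_compose_linear[OF bounded_linear_fst W smooth_on_transition[OF c d]])
      fix t assume t: "t \<in> ?T"
      then show "(z has_vector_derivative phase_field c (z t)) (at t)" using z' by simp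
      have "chart_map c (\<gamma> t) \<in> ?W" using dom[of t] t by blast
      then show "z t \<in> fst -` ?W" using x[of t] t by simp
    qed
    then show ?thesis by (simp add: \<gamma>_def comp_def)
  qed
  then have s: "smooth_curve A T \<gamma>" using cont by (simp add: smooth_curve_def)
  have v: "velocity A \<gamma> t c = snd (z t)" if t: "t \<in> T" for t
  proof -
    have "((\<lambda>t. fst (z t)) has_vector_derivative snd (z t)) (at t)"
      using bounded_linear.has_vector_derivative[OF bounded_linear_fst z'[OF t]]
      by (simp add: phase_field_def)
    then have "((chart_map c \<circ> \<gamma>) has_vector_derivative snd (z t)) (at t)"
      by (rule has_vector_derivative_transform_within_open[OF _ T(1) t]) (simp add: x)
    then show ?thesis
      using vector_derivative_unique_at[OF velocity_has_vector_derivative[OF T(1) s c t dom[OF t]]] by blast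
  qed
  have "trajectory_on A g F V T \<gamma>"
  proof (rule trajectory_onI[OF T s], rule bexI[OF _ c], rule conjI)
    fix t assume t: "t \<in> T"
    show "\<gamma> t \<in> chart_dom c" by (rule dom[OF t])
    have "((\<lambda>t. snd (z t)) has_vector_derivative force c (fst (z t)) (snd (z t))) (at t)"
      using bounded_linear.has_vector_derivative[OF bounded_linear_snd z'[OF t]]
      by (simp add: phase_field_def)
    then have "((\<lambda>t. velocity A \<gamma> t c) has_vector_derivative force c (fst (z t)) (snd (z t))) (at t)"
      by (rule has_vector_derivative_transform_within_open[OF _ T(1) t]) (simp add: v)
    then show "((\<lambda>s. velocity A \<gamma> s c) has_vector_derivative
        force c (chart_map c (\<gamma> t)) (velocity A \<gamma> t c)) (at t)" using v[OF t] x[OF t] by simp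
  qed
  then show ?thesis by (simp add: \<gamma>_def[abs_def])
qed

section \<open>Extension of trajectories and reversal of time\<close>

lemma trajectory_extends:
  assumes \<gamma>: "trajectory_on A g F V I \<gamma>" and ab: "a < b" "{a<..<b} \<subseteq> I" "I \<subseteq> {..<b}"
    and c: "c \<in> A" and C: "compact C" "C \<subseteq> chart_image c \<times> UNIV"
    and dom: "\<And>t. t \<in> {a<..<b} \<Longrightarrow> \<gamma> t \<in> chart_dom c"
    and inC: "\<And>t. t \<in> {a<..<b} \<Longrightarrow> (chart_map c (\<gamma> t), velocity A \<gamma> t c) \<in> C"
  shows "\<exists>J \<delta>. trajectory_on A g F V J \<delta> \<and> I \<subseteq> J \<and> (\<forall>t\<in>I. \<delta> t = \<gamma> t) \<and> J \<noteq> I"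
proof -
  have oZ: "open (chart_image c \<times> (UNIV :: 'e set))" by (rule open_Times[OF open_chart_image[OF c]]) simp
  define z where "z t = (chart_map c (\<gamma> t), velocity A \<gamma> t c)" for t
  have z': "(z has_vector_derivative phase_field c (z t)) (at t)" if "t \<in> {a<..<b}" for t
    unfolding z_def by (rule trajectory_on_phase_field[OF \<gamma> _ c dom[OF that]]) (use ab that in blast)
  have zC: "z t \<in> C" if "t \<in> {a<..<b}" for t using inC[OF that] by (simp add: z_def)
  obtain d w where d: "d > b" and w: "\<And>t. t \<in> {a<..<b} \<Longrightarrow> w t = z t"
    "\<And>t. t \<in> {a<..<d} \<Longrightarrow> w t \<in> chart_image c \<times> UNIV"
    "\<And>t. t \<in> {a<..<d} \<Longrightarrow> (w has_vector_derivative phase_field c (w t)) (at t)"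
    using integral_curve_extends[where z=z, OF oZ smooth_on_phase_field[OF c] C ab(1) zC z'] by blast
  let ?T = "{a<..<d}"
  have "trajectory_on A g F V ?T (\<lambda>t. chart_inv c (fst (w t)))"
    by (rule trajectory_of_integral_curve[OF c _ _ _ w(2,3)])
      (use ab d in \<open>auto simp: is_interval_oo\<close>)
  moreover have eq: "chart_inv c (fst (w t)) = \<gamma> t" if "t \<in> ?T \<inter> I" for t
  proof -
    have t: "t \<in> {a<..<b}" using that ab(3) by auto
    then show ?thesis using w(1)[OF t] chart_inv_map[OF c dom[OF t]] by (simp add: z_def)
  qed
  \<comment> \<open>The old curve has to be kept on all of \<open>I\<close>, which may reach back
    beyond \<open>a\<close> and outside the chart. On the overlap with \<open>?T\<close> both curves
    agree, since \<open>I\<close> lies to the left of \<open>b\<close>.\<close>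
  define \<delta> where "\<delta> t = (if t \<in> I then \<gamma> t else chart_inv c (fst (w t)))" for t
  have 1: "trajectory_on A g F V I \<delta>" by (rule trajectory_on_cong[OF \<gamma>]) (simp add: \<delta>_def)
  have 2: "trajectory_on A g F V ?T \<delta>"
    by (rule trajectory_on_cong[OF calculation]) (use eq in \<open>simp add: \<delta>_def\<close>)
  have "(a + b) / 2 \<in> I \<inter> ?T" using ab d by auto
  then have "trajectory_on A g F V (I \<union> ?T) \<delta>" by (intro trajectory_on_Un[OF 1 2]) blast
  moreover have "b \<in> ?T" "b \<notin> I" using ab d by auto
  moreover have "\<forall>t\<in>I. \<delta> t = \<gamma> t" by (simp add: \<delta>_def)
  ultimately show ?thesis
    by (intro exI[of _ "I \<union> ?T"] exI[of _ \<delta>]) blast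
qed

lemma dynamics_uminus: "dynamics A g (\<lambda>p v c. - F p v c) V"
proof
  let ?F = "\<lambda>p v c. - F p v c"
  have rep: "endo_rep A ?F c x = (\<lambda>u. - endo_rep A F c x u)" for c x
    by (simp add: endo_rep_def fun_eq_iff)
  have "linear (endo_rep A ?F c x)" if "c \<in> A" "x \<in> chart_image c" for c x
    unfolding rep by (rule linear_compose_neg[OF linear_endo_rep[OF that]])
  moreover have "smooth_on (chart_image c) (\<lambda>x. endo_rep A ?F c x u)" if "c \<in> A" for c u
    unfolding rep by (rule smooth_on_uminus[OF open_chart_image[OF that]])
      (use smooth_F that in \<open>simp add: smooth_endo_field_def\<close>)
  ultimately show "smooth_endo_field A ?F"
    unfolding smooth_endo_field_def using tangent_space_uminus[OF F_tangent] by blast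
qed (rule smooth_V)

text \<open>Under \<open>t \<mapsto> - t\<close> the velocity changes sign and the acceleration does
  not. The Christoffel term is quadratic in the velocity and the gradient independent of it, so only
  the term with \<open>F\<close>, linear in the velocity, changes sign.\<close>

lemma trajectory_on_reverse:
  assumes \<gamma>: "trajectory_on A g F V I \<gamma>"
  shows "trajectory_on A g (\<lambda>p v c. - F p v c) V (uminus ` I) (\<lambda>t. \<gamma> (- t))"
proof -
  interpret r: dynamics A g "\<lambda>p v c. - F p v c" V by (rule dynamics_uminus)
  let ?\<delta> = "\<lambda>t. \<gamma> (- t)"
  have I: "open I" "is_interval I" "I \<noteq> {}" and s: "smooth_curve A I \<gamma>"
    using \<gamma> by (simp_all add: trajectory_on_def)
  have inv: "uminus -` I = uminus ` I" by force
  have bl: "bounded_linear (uminus :: real \<Rightarrow> real)" by (intro bounded_linear_minus bounded_linear_ident)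
  have J: "open (uminus ` I)" "is_interval (uminus ` I)" "uminus ` I \<noteq> {}"
    using I open_negations[of I] by (auto simp: is_interval_neg_translationI)
  have cont: "continuous_on (uminus ` I) ?\<delta>"
    by (rule continuous_on_compose2[of I \<gamma>]) (use s in \<open>auto simp: smooth_curve_def intro: continuous_intros\<close>)
  have "smooth_on {t \<in> uminus ` I. ?\<delta> t \<in> chart_dom c} (chart_map c \<circ> ?\<delta>)" if c: "c \<in> A" for c
  proof -
    have "smooth_on {t \<in> I. \<gamma> t \<in> chart_dom c} (chart_map c \<circ> \<gamma>)"
      using s c by (simp add: smooth_curve_def)
    from smooth_on_compose_linear[OF bl open_curve_chart[OF I(1) s c] this]
    have "smooth_on (uminus -` {t \<in> I. \<gamma> t \<in> chart_dom c}) (chart_map c \<circ> ?\<delta>)"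
      by (simp only: comp_def)
    then show ?thesis by (rule smooth_on_subset) auto
  qed
  then have s': "smooth_curve A (uminus ` I) ?\<delta>" using cont by (simp add: smooth_curve_def)
  have chain: "((\<lambda>s. f (- s)) has_vector_derivative - D) (at t)"
    if "(f has_vector_derivative D) (at (- t))" for f :: "real \<Rightarrow> 'e" and D t
    using vector_derivative_diff_chain_within[of uminus "-1" t UNIV f "\<lambda>h. h *\<^sub>R D"] that
    by (auto simp: has_vector_derivative_def comp_def has_derivative_at_withinI intro!: derivative_eq_intros)
  have v: "velocity A ?\<delta> t c = - velocity A \<gamma> (- t) c"
    if t: "t \<in> uminus ` I" and c: "c \<in> A" "\<gamma> (- t) \<in> chart_dom c" for t c
  proof -
    have "- t \<in> I" using t by auto
    from chain[OF velocity_has_vector_derivative[OF I(1) s c(1) this c(2)]]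
    have "((chart_map c \<circ> ?\<delta>) has_vector_derivative - velocity A \<gamma> (- t) c) (at t)" by (simp add: comp_def)
    then show ?thesis
      using vector_derivative_unique_at[OF velocity_has_vector_derivative[OF J(1) s' c(1) t c(2)]] by blast
  qed
  show ?thesis
  proof (rule r.trajectory_onI[OF J s'])
    fix t assume t: "t \<in> uminus ` I"
    then have mt: "- t \<in> I" by auto
    obtain c where c: "c \<in> A" "\<gamma> (- t) \<in> chart_dom c" using chart_cover by blast
    let ?x = "chart_map c (\<gamma> (- t))" let ?v = "velocity A \<gamma> (- t) c"
    have x: "?x \<in> chart_image c" using c by simp
    let ?T = "{t \<in> uminus ` I. ?\<delta> t \<in> chart_dom c}"
    have T: "open ?T" "t \<in> ?T" using open_curve_chart[OF J(1) s' c(1)] t c by auto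
    \<comment> \<open>One sign stems from the reversed velocity, the other from the chain rule;
      together they leave the acceleration unchanged.\<close>
    have "((\<lambda>s. - velocity A \<gamma> (- s) c) has_vector_derivative - (- force c ?x ?v)) (at t)"
      by (intro has_vector_derivative_minus chain trajectory_on_velocity[OF \<gamma> mt c])
    then have "((\<lambda>s. velocity A ?\<delta> s c) has_vector_derivative - (- force c ?x ?v)) (at t)"
      by (rule has_vector_derivative_transform_within_open[OF _ T]) (use v c in simp)
    moreover have "r.force c ?x (velocity A ?\<delta> t c) = force c ?x ?v"
    proof -
      have "endo_rep A (\<lambda>p v c. - F p v c) c ?x (- ?v) = - endo_rep A F c ?x (- ?v)"
        by (simp add: endo_rep_def)
      then show ?thesis
        using linear_neg[OF linear_endo_rep[OF c(1) x]] bilinear_levi_civita[OF c(1) x]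
        by (simp add: v[OF t c] r.force_def force_def bilinear_lneg bilinear_rneg)
    qed
    ultimately show "\<exists>c\<in>A. ?\<delta> t \<in> chart_dom c \<and> ((\<lambda>s. velocity A ?\<delta> s c) has_vector_derivative
        r.force c (chart_map c (?\<delta> t)) (velocity A ?\<delta> t c)) (at t)"
      using c by (intro bexI[of _ c]) auto
  qed
qed

end

section \<open>A priori bounds\<close>

lemma continuous_on_bilinear_field:
  fixes M :: "'c::topological_space \<Rightarrow> 'e::euclidean_space \<Rightarrow> 'f::euclidean_space \<Rightarrow> real"
  assumes bil: "\<And>x. x \<in> S \<Longrightarrow> bilinear (M x)"
    and M: "\<And>u w. continuous_on S (\<lambda>x. M x u w)"
    and X: "continuous_on T X" "\<And>t. t \<in> T \<Longrightarrow> X t \<in> S"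
    and a: "continuous_on T a" and b: "continuous_on T b"
  shows "continuous_on T (\<lambda>t. M (X t) (a t) (b t))"
proof (rule continuous_on_eq)
  have "continuous_on T (\<lambda>t. M (X t) u w)" for u w
    by (rule continuous_on_compose2[OF M X(1)]) (use X(2) in blast)
  then show "continuous_on T (\<lambda>t. \<Sum>i\<in>Basis. (a t \<bullet> i) *\<^sub>R (\<Sum>j\<in>Basis. (b t \<bullet> j) *\<^sub>R M (X t) i j))"
    by (intro continuous_intros a b)
  fix t assume "t \<in> T"
  then have "bilinear (M (X t))" using bil X(2) by blast
  then have 1: "linear (M (X t) i)" and 2: "linear (\<lambda>u. M (X t) u w)" for i w
    by (simp_all add: bilinear_def)
  show "(\<Sum>i\<in>Basis. (a t \<bullet> i) *\<^sub>R (\<Sum>j\<in>Basis. (b t \<bullet> j) *\<^sub>R M (X t) i j)) = M (X t) (a t) (b t)"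
    by (simp only: linear_eq_sum_Basis[OF 1, symmetric] linear_eq_sum_Basis[OF 2, symmetric])
qed

context lorentzian_manifold
begin

lemma metric_sym:
  assumes v: "v \<in> tangent_space A p" and w: "w \<in> tangent_space A p"
  shows "g p v w = g p w v"
proof -
  obtain c where c: "c \<in> A" "p \<in> chart_dom c" using chart_cover by blast
  have "chart_map c p \<in> chart_image c" using c by simp
  from metric_field.sym[OF metric_field_chart[OF c(1)] this, of "v c" "w c"]
  show ?thesis by (simp only: metric_rep_tangent[OF c v w] metric_rep_tangent[OF c w v])
qed

text \<open>Compatibility of the connection with the metric for vector fields along a curve:
  \<open>levi_civita_rep A g c (x t) v (a t) + a'\<close> is the coordinate form of the covariant
  derivative of \<open>a\<close>, likewise for \<open>b\<close>.\<close>

lemma metric_rep_along_curve: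
  assumes c: "c \<in> A" and xt: "x t \<in> chart_image c" and x: "(x has_vector_derivative v) (at t)"
    and a: "(a has_vector_derivative a') (at t)" and b: "(b has_vector_derivative b') (at t)"
  shows "((\<lambda>s. metric_rep A g c (x s) (a s) (b s)) has_vector_derivative
    metric_rep A g c (x t) (levi_civita_rep A g c (x t) v (a t) + a') (b t) +
    metric_rep A g c (x t) (a t) (levi_civita_rep A g c (x t) v (b t) + b')) (at t)"
proof -
  let ?G = "metric_rep A g c" and ?\<Gamma> = "levi_civita_rep A g c (x t)"
  note m = metric_field_chart[OF c]
  have bil: "bilinear (?G (x t))" by (rule metric_field.bil[OF m xt])
  have "isCont x t" using has_vector_derivative_continuous[OF x] .
  then have "(x \<longlongrightarrow> x t) (nhds t)" by (simp only: tendsto_at_iff_tendsto_nhds[symmetric] isCont_def)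
  then have ev: "\<forall>\<^sub>F s in nhds t. x s \<in> chart_image c"
    by (rule topological_tendstoD[OF _ open_chart_image[OF c] xt])
  have "((\<lambda>s. ?G (x s) (a s) (b s)) has_derivative
      (\<lambda>h. frechet_derivative (\<lambda>y. ?G y (a t) (b t)) (at (x t)) (h *\<^sub>R v) +
        ?G (x t) (h *\<^sub>R a') (b t) + ?G (x t) (a t) (h *\<^sub>R b'))) (at t)"
  proof (rule has_derivative_bilinear_field[where M="\<lambda>s. ?G (x s)" and a=a and b=b
        and M'="\<lambda>u w h. frechet_derivative (\<lambda>y. ?G y u w) (at (x t)) (h *\<^sub>R v)"])
    show "\<forall>\<^sub>F s in nhds t. bilinear (?G (x s))"
      using ev by eventually_elim (rule metric_field.bil[OF m])
    show "((\<lambda>s. ?G (x s) u w) has_derivative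
        (\<lambda>h. frechet_derivative (\<lambda>y. ?G y u w) (at (x t)) (h *\<^sub>R v))) (at t)" for u w
      using diff_chain_at[OF x[unfolded has_vector_derivative_def]
          metric_field.has_derivative_metric[OF m xt, of u w]] by (simp only: comp_def)
  qed (use a b in \<open>simp_all only: has_vector_derivative_def\<close>)
  moreover have "linear (frechet_derivative (\<lambda>y. ?G y (a t) (b t)) (at (x t)))"
    using metric_field.has_derivative_metric[OF m xt] has_derivative_linear by blast
  ultimately have "((\<lambda>s. ?G (x s) (a s) (b s)) has_vector_derivative
      frechet_derivative (\<lambda>y. ?G y (a t) (b t)) (at (x t)) v + ?G (x t) a' (b t) + ?G (x t) (a t) b') (at t)"
    by (simp add: has_vector_derivative_def linear_scale bilinear_lmul[OF bil] bilinear_rmul[OF bil]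
        distrib_left)
  moreover have "frechet_derivative (\<lambda>y. ?G y (a t) (b t)) (at (x t)) v =
      ?G (x t) (?\<Gamma> v (a t)) (b t) + ?G (x t) (a t) (?\<Gamma> v (b t))"
    using christoffel_levi_civita[OF c xt] by (simp add: christoffel_def)
  ultimately show ?thesis
    by (simp add: bilinear_ladd[OF bil] bilinear_radd[OF bil] algebra_simps)
qed

end

locale killing_dynamics = dynamics A g F V
  for A :: "('a::t2_space, 'e::euclidean_space) chart set" and g F V +
  fixes K :: "'a \<Rightarrow> ('a, 'e) tvec"
  assumes skew: "skew_adjoint A g F" and killing: "conformal_killing A g K"
    and timelike: "timelike_field g K" and F_K: "F p (K p) = (\<lambda>_. 0)"
    and compact_UNIV: "compact (UNIV :: 'a set)"
begin

lemma K_tangent: "K p \<in> tangent_space A p"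
  using killing by (simp add: conformal_killing_def smooth_vector_field_def)

lemma smooth_K: "c \<in> A \<Longrightarrow> smooth_on (chart_image c) (vector_field_rep c K)"
  using killing by (simp add: conformal_killing_def smooth_vector_field_def)

lemma vector_field_rep_K:
  "c \<in> A \<Longrightarrow> p \<in> chart_dom c \<Longrightarrow> vector_field_rep c K (chart_map c p) = K p c"
  by (simp add: vector_field_rep_def chart_inv_map)

lemma bounded_function:
  fixes f :: "'a \<Rightarrow> real"
  assumes "\<And>c. c \<in> A \<Longrightarrow> continuous_on (chart_image c) (f \<circ> chart_inv c)"
  shows "\<exists>B. \<forall>p. \<bar>f p\<bar> \<le> B"
proof -
  have "compact (range f)"
    by (rule compact_continuous_image[OF continuous_on_UNIV_chartwise[OF assms] compact_UNIV])
  then have "bounded (range f)" by (rule compact_imp_bounded)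
  then show ?thesis by (auto simp: bounded_iff)
qed

lemma bounded_smooth_function: "smooth_function A f \<Longrightarrow> \<exists>B. \<forall>p. \<bar>f p\<bar> \<le> B"
  by (rule bounded_function, rule smooth_on_continuous_on) (simp only: smooth_function_def)

lemma bounded_differential_K: "\<exists>B. \<forall>p. \<bar>differential A V p (K p)\<bar> \<le> B"
proof (rule bounded_function)
  fix c assume c: "c \<in> A"
  have "smooth_on (chart_image c) (\<lambda>x. frechet_derivative (V \<circ> chart_inv c) (at x) (vector_field_rep c K x))"
    by (rule smooth_on_directional[OF open_chart_image[OF c] _ smooth_K[OF c]])
      (use smooth_V c in \<open>simp add: smooth_function_def\<close>)
  then have "continuous_on (chart_image c)
      (\<lambda>x. frechet_derivative (V \<circ> chart_inv c) (at x) (vector_field_rep c K x))"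
    by (rule smooth_on_continuous_on)
  then show "continuous_on (chart_image c) ((\<lambda>p. differential A V p (K p)) \<circ> chart_inv c)"
  proof (rule continuous_on_eq)
    fix x assume "x \<in> chart_image c"
    then obtain p where p: "p \<in> chart_dom c" "x = chart_map c p" "chart_inv c x = p"
      using chart_image_inv[OF c] by blast
    show "frechet_derivative (V \<circ> chart_inv c) (at x) (vector_field_rep c K x) =
        ((\<lambda>p. differential A V p (K p)) \<circ> chart_inv c) x"
      using differential_chart[OF smooth_V K_tangent c p(1)] p vector_field_rep_K[OF c p(1)] by simp
  qed
qed

text \<open>These two cancellations remove \<open>F\<close> from the derivatives of the energy and
  of \<open>g(K, \<gamma>')\<close>. In the first, skewness and symmetry make a number equal to its
  negative; in the second, skewness moves \<open>F\<close> onto \<open>K\<close>.\<close>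

lemma metric_F:
  assumes v: "v \<in> tangent_space A p"
  shows "g p (F p v) v = 0" and "g p (K p) (F p v) = 0"
proof -
  have "g p (F p v) v = - g p v (F p v)" using skew v by (simp add: skew_adjoint_def)
  then show "g p (F p v) v = 0" using metric_sym[OF v F_tangent[OF v]] by simp
  obtain c where c: "c \<in> A" "p \<in> chart_dom c" using chart_cover by blast
  then have x: "chart_map c p \<in> chart_image c" by simp
  \<comment> \<open>Bilinearity is available for the coordinate representative, so the product with
    the zero vector is evaluated in a chart.\<close>
  have "metric_rep A g c (chart_map c p) (F p (K p) c) (v c) = 0"
    using bilinear_lzero[OF metric_field.bil[OF metric_field_chart[OF c(1)] x]] by (simp add: F_K)
  then have "g p (F p (K p)) v = 0"
    by (simp only: metric_rep_tangent[OF c F_tangent[OF K_tangent] v])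
  then show "g p (K p) (F p v) = 0" using skew v K_tangent by (simp add: skew_adjoint_def)
qed

section \<open>Energy and momentum along a trajectory\<close>

context
  fixes I \<gamma>
  assumes traj: "trajectory_on A g F V I \<gamma>"
begin

lemma trajectory_open: "open I" and trajectory_smooth: "smooth_curve A I \<gamma>"
  using traj by (simp_all add: trajectory_on_def)

lemmas trajectory_velocity_tangent = velocity_tangent[OF trajectory_open trajectory_smooth]

text \<open>The vector on the left is the covariant acceleration in coordinates; this is the
  equation of motion paired with \<open>w\<close>.\<close>

lemma metric_rep_acceleration:
  assumes t: "t \<in> I" and c: "c \<in> A" "\<gamma> t \<in> chart_dom c" and w: "w \<in> tangent_space A (\<gamma> t)"
  defines "x \<equiv> chart_map c (\<gamma> t)" and "v \<equiv> velocity A \<gamma> t c"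
  shows "metric_rep A g c x (w c) (levi_civita_rep A g c x v v + force c x v) =
    g (\<gamma> t) w (F (\<gamma> t) (velocity A \<gamma> t)) - differential A V (\<gamma> t) w"
proof -
  let ?p = "\<gamma> t"
  have vt: "velocity A \<gamma> t \<in> tangent_space A ?p" by (rule trajectory_velocity_tangent[OF t])
  have x: "x \<in> chart_image c" using c by (simp add: x_def)
  note bil = metric_field.bil[OF metric_field_chart[OF c(1)] x]
  note grad = gradient_tangent[OF smooth_V, of ?p]
  have "levi_civita_rep A g c x v v + force c x v = F ?p (velocity A \<gamma> t) c - gradient A g V ?p c"
    using endo_rep_tangent[OF c vt] by (simp add: force_def x_def v_def chart_inv_map[OF c])
  then have "metric_rep A g c x (w c) (levi_civita_rep A g c x v v + force c x v) =
      metric_rep A g c x (w c) (F ?p (velocity A \<gamma> t) c) - metric_rep A g c x (w c) (gradient A g V ?p c)"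
    by (simp only: bilinear_rsub[OF bil])
  also have "\<dots> = g ?p w (F ?p (velocity A \<gamma> t)) - g ?p w (gradient A g V ?p)"
    by (simp only: x_def metric_rep_tangent[OF c w F_tangent[OF vt]] metric_rep_tangent[OF c w grad])
  also have "g ?p w (gradient A g V ?p) = differential A V ?p w"
    using metric_sym[OF w grad] metric_gradient[OF smooth_V w] by simp
  finally show ?thesis .
qed

lemma energy_derivative:
  assumes t: "t \<in> I"
  shows "((\<lambda>s. g (\<gamma> s) (velocity A \<gamma> s) (velocity A \<gamma> s) / 2 + V (\<gamma> s)) has_vector_derivative 0) (at t)"
proof -
  obtain c where c: "c \<in> A" "\<gamma> t \<in> chart_dom c" using chart_cover by blast
  let ?x = "chart_map c \<circ> \<gamma>" and ?v = "\<lambda>s. velocity A \<gamma> s c" and ?G = "metric_rep A g c"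
  let ?T = "{t \<in> I. \<gamma> t \<in> chart_dom c}"
  have T: "open ?T" "t \<in> ?T" using open_curve_chart[OF trajectory_open trajectory_smooth c(1)] t c by auto
  note x' = velocity_has_vector_derivative[OF trajectory_open trajectory_smooth c(1) t c(2)]
  note v' = trajectory_on_velocity[OF traj t c]
  note vt = trajectory_velocity_tangent[OF t]
  have xt: "?x t \<in> chart_image c" using c by simp
  let ?q = "levi_civita_rep A g c (?x t) (?v t) (?v t) + force c (chart_map c (\<gamma> t)) (?v t)"
  have "((\<lambda>s. ?G (?x s) (?v s) (?v s)) has_vector_derivative
      ?G (?x t) ?q (?v t) + ?G (?x t) (?v t) ?q) (at t)"
    by (rule metric_rep_along_curve[OF c(1) xt x' v' v'])
  moreover have "?G (?x t) ?q (?v t) = ?G (?x t) (?v t) ?q"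
    by (rule metric_field.sym[OF metric_field_chart[OF c(1)] xt])
  moreover have "?G (?x t) (?v t) ?q = - differential A V (\<gamma> t) (velocity A \<gamma> t)"
    using metric_rep_acceleration[OF t c vt] metric_F(1)[OF vt] metric_sym[OF vt F_tangent[OF vt]] by simp
  ultimately have G: "((\<lambda>s. ?G (?x s) (?v s) (?v s)) has_vector_derivative
      - 2 * differential A V (\<gamma> t) (velocity A \<gamma> t)) (at t)" by simp
  have "((V \<circ> chart_inv c) has_derivative frechet_derivative (V \<circ> chart_inv c) (at (?x t))) (at (?x t))"
    by (rule smooth_on_has_derivative[OF _ xt]) (use smooth_V c in \<open>simp add: smooth_function_def\<close>)
  from vector_derivative_diff_chain_within[OF x' has_derivative_at_withinI[OF this]]
  have "((V \<circ> chart_inv c) \<circ> ?x has_vector_derivative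
      frechet_derivative (V \<circ> chart_inv c) (at (?x t)) (?v t)) (at t)" .
  then have W: "((V \<circ> chart_inv c) \<circ> ?x has_vector_derivative differential A V (\<gamma> t) (velocity A \<gamma> t)) (at t)"
    using differential_chart[OF smooth_V vt c] by simp
  have "((\<lambda>s. ?G (?x s) (?v s) (?v s) / 2 + ((V \<circ> chart_inv c) \<circ> ?x) s) has_vector_derivative
      (- 2 * differential A V (\<gamma> t) (velocity A \<gamma> t)) / 2 + differential A V (\<gamma> t) (velocity A \<gamma> t)) (at t)"
    by (intro has_vector_derivative_add has_vector_derivative_divide G W)
  then have "((\<lambda>s. ?G (?x s) (?v s) (?v s) / 2 + ((V \<circ> chart_inv c) \<circ> ?x) s) has_vector_derivative 0) (at t)"
    by simp
  then show ?thesis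
  proof (rule has_vector_derivative_transform_within_open[OF _ T])
    fix s assume s: "s \<in> ?T"
    then have "s \<in> I" "\<gamma> s \<in> chart_dom c" by auto
    then show "?G (?x s) (?v s) (?v s) / 2 + ((V \<circ> chart_inv c) \<circ> ?x) s =
        g (\<gamma> s) (velocity A \<gamma> s) (velocity A \<gamma> s) / 2 + V (\<gamma> s)"
      using metric_rep_tangent[OF c(1) _ trajectory_velocity_tangent trajectory_velocity_tangent]
      by (simp add: chart_inv_map[OF c(1)])
  qed
qed

text \<open>The product rule gives \<open>g(\<nabla>_v K, v) + g(K, Dv/dt)\<close>, where
  \<open>v\<close> is the velocity. The second term is \<open>- dV(K)\<close> by the equation of
  motion. For the first, torsion-freeness turns the Lie derivative of the metric on the pair
  \<open>(v, v)\<close> into \<open>2 g(\<nabla>_v K, v)\<close>, so the conformal condition gives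
  \<open>\<sigma> g(v, v)\<close>.\<close>

lemma momentum_derivative:
  assumes t: "t \<in> I"
    and \<sigma>: "\<And>c x u v. \<lbrakk>c \<in> A; x \<in> chart_image c\<rbrakk> \<Longrightarrow>
      lie_derivative_metric_rep A g K c x u v = 2 * \<sigma> (chart_inv c x) * metric_rep A g c x u v"
  shows "((\<lambda>s. g (\<gamma> s) (K (\<gamma> s)) (velocity A \<gamma> s)) has_vector_derivative
    \<sigma> (\<gamma> t) * g (\<gamma> t) (velocity A \<gamma> t) (velocity A \<gamma> t) - differential A V (\<gamma> t) (K (\<gamma> t))) (at t)"
proof -
  obtain c where c: "c \<in> A" "\<gamma> t \<in> chart_dom c" using chart_cover by blast
  let ?x = "chart_map c \<circ> \<gamma>" and ?v = "\<lambda>s. velocity A \<gamma> s c" and ?G = "metric_rep A g c"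
  let ?k = "vector_field_rep c K"
  let ?T = "{t \<in> I. \<gamma> t \<in> chart_dom c}"
  have T: "open ?T" "t \<in> ?T" using open_curve_chart[OF trajectory_open trajectory_smooth c(1)] t c by auto
  note x' = velocity_has_vector_derivative[OF trajectory_open trajectory_smooth c(1) t c(2)]
  note v' = trajectory_on_velocity[OF traj t c]
  note vt = trajectory_velocity_tangent[OF t]
  have xt: "?x t \<in> chart_image c" using c by simp
  note m = metric_field_chart[OF c(1)]
  note bil = metric_field.bil[OF m xt] and sym = metric_field.sym[OF m xt]
  define \<Gamma> where "\<Gamma> = levi_civita_rep A g c (?x t)"
  define v where "v = ?v t"
  define k where "k = ?k (?x t)"
  define k' where "k' = frechet_derivative ?k (at (?x t)) v"
  have ch: "christoffel ?G (?x t) \<Gamma>" unfolding \<Gamma>_def by (rule christoffel_levi_civita[OF c(1) xt])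
  have "(?k has_derivative frechet_derivative ?k (at (?x t))) (at (?x t))"
    by (rule smooth_on_has_derivative[OF smooth_K[OF c(1)] xt])
  from vector_derivative_diff_chain_within[OF x' has_derivative_at_withinI[OF this]]
  have "(?k \<circ> ?x has_vector_derivative k') (at t)" unfolding k'_def v_def .
  from metric_rep_along_curve[OF c(1) xt x' this v']
  have d: "((\<lambda>s. ?G (?x s) ((?k \<circ> ?x) s) (?v s)) has_vector_derivative
      ?G (?x t) (\<Gamma> v k + k') v + ?G (?x t) k (\<Gamma> v v + force c (chart_map c (\<gamma> t)) v)) (at t)"
    by (simp add: \<Gamma>_def v_def k_def)
  have "?G (?x t) k (\<Gamma> v v + force c (chart_map c (\<gamma> t)) v) = - differential A V (\<gamma> t) (K (\<gamma> t))"
    using metric_rep_acceleration[OF t c K_tangent] metric_F(2)[OF vt] vector_field_rep_K[OF c]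
    by (simp add: \<Gamma>_def v_def k_def)
  moreover have "?G (?x t) (\<Gamma> v k + k') v = \<sigma> (\<gamma> t) * ?G (?x t) v v"
  proof -
    \<comment> \<open>The velocity is frozen to the constant coordinate field \<open>v\<close>; its
      bracket with \<open>K\<close> then contains only the derivative of \<open>K\<close>.\<close>
    have b: "lie_bracket ?k (\<lambda>_. v) (?x t) = - k'" by (simp add: lie_bracket_def k'_def)
    have "frechet_derivative (\<lambda>y. ?G y v v) (at (?x t)) k = ?G (?x t) (\<Gamma> k v) v + ?G (?x t) v (\<Gamma> k v)"
      and s: "\<Gamma> k v = \<Gamma> v k" using ch unfolding christoffel_def by blast+
    then have "lie_derivative_metric_rep A g K c (?x t) v v =
        2 * ?G (?x t) (\<Gamma> v k) v + 2 * ?G (?x t) k' v"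
      using sym[of v "\<Gamma> v k"] sym[of v k']
      by (simp add: lie_derivative_metric_rep_def Let_def b k_def[symmetric] s
          bilinear_lneg[OF bil] bilinear_rneg[OF bil] del: o_apply)
    moreover have "chart_inv c (?x t) = \<gamma> t" by (simp add: chart_inv_map[OF c])
    ultimately show ?thesis 
      using \<sigma>[OF c(1) xt, of v v] by (simp add: bilinear_ladd[OF bil[unfolded o_apply]])
  qed
  moreover have "?G (?x t) v v = g (\<gamma> t) (velocity A \<gamma> t) (velocity A \<gamma> t)"
    using metric_rep_tangent[OF c vt vt] by (simp add: v_def)
  ultimately have "((\<lambda>s. ?G (?x s) ((?k \<circ> ?x) s) (?v s)) has_vector_derivative
      \<sigma> (\<gamma> t) * g (\<gamma> t) (velocity A \<gamma> t) (velocity A \<gamma> t) - differential A V (\<gamma> t) (K (\<gamma> t))) (at t)"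
    using d by simp
  then show ?thesis
  proof (rule has_vector_derivative_transform_within_open[OF _ T])
    fix s assume s: "s \<in> ?T"
    then have s: "s \<in> I" "\<gamma> s \<in> chart_dom c" by auto
    show "?G (?x s) ((?k \<circ> ?x) s) (?v s) = g (\<gamma> s) (K (\<gamma> s)) (velocity A \<gamma> s)"
      using metric_rep_tangent[OF c(1) s(2) K_tangent trajectory_velocity_tangent[OF s(1)]]
        vector_field_rep_K[OF c(1) s(2)] by simp
  qed
qed

text \<open>The energy comes first, because the derivative of the momentum involves
  \<open>g(\<gamma>', \<gamma>')\<close>. Once this is bounded by \<open>M1\<close>, the momentum is
  Lipschitz with constant \<open>L\<close>, hence bounded over the finite length
  \<open>b - a\<close>.\<close>

lemma velocity_bounds:
  assumes ab: "a \<in> I" "a < b" "{a..<b} \<subseteq> I"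
  shows "\<exists>M. \<forall>t\<in>{a..<b}. \<bar>g (\<gamma> t) (velocity A \<gamma> t) (velocity A \<gamma> t)\<bar> \<le> M \<and>
    \<bar>g (\<gamma> t) (K (\<gamma> t)) (velocity A \<gamma> t)\<bar> \<le> M"
proof -
  let ?q = "\<lambda>t. g (\<gamma> t) (velocity A \<gamma> t) (velocity A \<gamma> t)"
  let ?P = "\<lambda>t. g (\<gamma> t) (K (\<gamma> t)) (velocity A \<gamma> t)"
  let ?d = "\<lambda>p. differential A V p (K p)"
  obtain \<sigma> where \<sigma>s: "smooth_function A \<sigma>" and \<sigma>:
    "\<And>c x u v. \<lbrakk>c \<in> A; x \<in> chart_image c\<rbrakk> \<Longrightarrow>
      lie_derivative_metric_rep A g K c x u v = 2 * \<sigma> (chart_inv c x) * metric_rep A g c x u v"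
    using killing unfolding conformal_killing_def by blast
  obtain BV where BV: "\<And>p. \<bar>V p\<bar> \<le> BV" using bounded_smooth_function[OF smooth_V] by blast
  obtain BS where BS: "\<And>p. \<bar>\<sigma> p\<bar> \<le> BS" using bounded_smooth_function[OF \<sigma>s] by blast
  obtain BD where BD: "\<And>p. \<bar>?d p\<bar> \<le> BD" using bounded_differential_K by blast
  have "((\<lambda>s. ?q s / 2 + V (\<gamma> s)) has_derivative (\<lambda>h. 0)) (at t within {a..<b})" if "t \<in> {a..<b}" for t
  proof -
    have "t \<in> I" using that ab by blast
    from has_vector_derivative_at_within[OF energy_derivative[OF this]]
    show ?thesis by (simp add: has_vector_derivative_def)
  qed
  then obtain E where E: "\<And>t. t \<in> {a..<b} \<Longrightarrow> ?q t / 2 + V (\<gamma> t) = E"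
    using has_derivative_zero_constant[of "{a..<b}" "\<lambda>s. ?q s / 2 + V (\<gamma> s)"] by (auto simp: convex_real_interval)
  define M1 where "M1 = 2 * (\<bar>E\<bar> + BV)"
  have q: "\<bar>?q t\<bar> \<le> M1" if "t \<in> {a..<b}" for t
  proof -
    have "?q t = 2 * (E - V (\<gamma> t))" using E[OF that] by (simp add: field_simps)
    then show ?thesis using BV[of "\<gamma> t"] by (simp add: M1_def)
  qed
  define L where "L = BS * M1 + BD"
  have P': "\<bar>\<sigma> (\<gamma> t) * ?q t - ?d (\<gamma> t)\<bar> \<le> L" if "t \<in> {a..<b}" for t
  proof -
    have "\<bar>\<sigma> (\<gamma> t) * ?q t\<bar> \<le> BS * M1"
      unfolding abs_mult using BS[of "\<gamma> t"] q[OF that] by (intro mult_mono) auto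
    then show ?thesis using BD[of "\<gamma> t"] unfolding L_def by linarith
  qed
  have L0: "L \<ge> 0" by (rule order_trans[OF abs_ge_zero P'[of a]]) (use ab in simp)
  have P: "\<bar>?P t\<bar> \<le> \<bar>?P a\<bar> + L * (b - a)" if t: "t \<in> {a..<b}" for t
  proof -
    have "norm (?P t - ?P a) \<le> L * norm (t - a)"
    proof (rule differentiable_bound[of "{a..<b}"])
      fix s assume s: "s \<in> {a..<b}"
      then have "s \<in> I" using ab by blast
      from momentum_derivative[OF this \<sigma>]
      show "(?P has_derivative (\<lambda>h. h *\<^sub>R (\<sigma> (\<gamma> s) * ?q s - ?d (\<gamma> s)))) (at s within {a..<b})"
        by (simp add: has_vector_derivative_def has_derivative_at_withinI)
      show "onorm (\<lambda>h. h *\<^sub>R (\<sigma> (\<gamma> s) * ?q s - ?d (\<gamma> s))) \<le> L"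
      proof (rule onorm_le)
        fix h :: real
        have "\<bar>h\<bar> * \<bar>\<sigma> (\<gamma> s) * ?q s - ?d (\<gamma> s)\<bar> \<le> \<bar>h\<bar> * L" by (intro mult_left_mono P' s) simp
        then show "norm (h *\<^sub>R (\<sigma> (\<gamma> s) * ?q s - ?d (\<gamma> s))) \<le> L * norm h"
          by (simp add: abs_mult mult.commute)
      qed
    qed (use ab t in \<open>auto simp: convex_real_interval\<close>)
    also have "\<dots> \<le> L * (b - a)" using t L0 by (intro mult_left_mono) auto
    finally show ?thesis by (simp add: abs_if split: if_splits)
  qed
  show ?thesis
    by (rule exI[of _ "max M1 (\<bar>?P a\<bar> + L * (b - a))"]) (use q P in \<open>simp add: le_max_iff_disj\<close>)
qed

end

text \<open>Since \<open>K\<close> is timelike, \<open>\<bar>g(v,v)\<bar> + g(K,v)\<^sup>2\<close> vanishes only for \<open>v = 0\<close>.\<close>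

lemma coordinate_bound:
  assumes c: "c \<in> A" and Q: "compact Q" "Q \<subseteq> chart_image c"
  shows "\<exists>R\<ge>0. \<forall>p v. p \<in> chart_dom c \<longrightarrow> chart_map c p \<in> Q \<longrightarrow> v \<in> tangent_space A p \<longrightarrow>
    \<bar>g p v v\<bar> \<le> M \<longrightarrow> \<bar>g p (K p) v\<bar> \<le> M \<longrightarrow> norm (v c) \<le> R"
proof -
  let ?G = "metric_rep A g c" and ?k = "vector_field_rep c K"
  \<comment> \<open>The square makes both summands homogeneous of degree 2 in the vector, so that a
    positive minimum over unit vectors scales to all vectors.\<close>
  let ?f = "\<lambda>z. \<bar>?G (fst z) (snd z) (snd z)\<bar> + (?G (fst z) (?k (fst z)) (snd z))\<^sup>2"
  let ?D = "Q \<times> sphere (0 :: 'e) 1"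
  note m = metric_field_chart[OF c]
  note cM = smooth_on_continuous_on[OF metric_field.smooth[OF m]]
  have fst: "continuous_on ?D fst" "\<And>z. z \<in> ?D \<Longrightarrow> fst z \<in> chart_image c"
    using Q by (auto intro: continuous_intros)
  have k: "continuous_on ?D (\<lambda>z. ?k (fst z))"
    by (rule continuous_on_compose2[OF smooth_on_continuous_on[OF smooth_K[OF c]] fst(1)]) (use fst(2) in blast)
  have snd: "continuous_on ?D snd" by (intro continuous_intros)
  have G: "continuous_on ?D (\<lambda>z. ?G (fst z) (a z) (snd z))" if "continuous_on ?D a" for a
    by (rule continuous_on_bilinear_field[OF metric_field.bil[OF m] cM fst that snd])
  have f: "continuous_on ?D ?f"
    by (intro continuous_on_add continuous_on_rabs continuous_on_power G k snd)
  have pos: "?f z > 0" if z: "z \<in> ?D" for z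
  proof (rule ccontr)
    assume "\<not> ?f z > 0"
    moreover have "\<bar>?G (fst z) (snd z) (snd z)\<bar> \<ge> 0" "(?G (fst z) (?k (fst z)) (snd z))\<^sup>2 \<ge> 0" by simp_all
    ultimately have 1: "\<bar>?G (fst z) (snd z) (snd z)\<bar> = 0" "(?G (fst z) (?k (fst z)) (snd z))\<^sup>2 = 0"
      by linarith+
    have x: "fst z \<in> chart_image c" by (rule fst(2)[OF z])
    then obtain p where p: "p \<in> chart_dom c" "fst z = chart_map c p" "chart_inv c (fst z) = p"
      using chart_image_inv[OF c] by blast
    have "?G (fst z) (?k (fst z)) (?k (fst z)) = g p (K p) (K p)"
      using metric_rep_tangent[OF c p(1) K_tangent K_tangent] vector_field_rep_K[OF c p(1)] p(2) by simp
    also have "\<dots> < 0" using timelike by (simp add: timelike_field_def)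
    finally have "snd z = 0"
      by (rule lorentz_form_timelike_orthogonal[OF lorentz_form_metric_rep[OF c x]]) (use 1 in simp_all)
    then show False using z by (auto simp: mem_Times_iff)
  qed
  have "\<exists>\<mu>>0. \<forall>z\<in>?D. \<mu> \<le> ?f z"
  proof (cases "?D = {}")
    case True
    then show ?thesis by (intro exI[of _ 1]) simp
  next
    case False
    have "compact ?D" by (intro compact_Times Q compact_sphere)
    from continuous_attains_inf[OF this False f] obtain z where "z \<in> ?D" "\<forall>y\<in>?D. ?f z \<le> ?f y" by blast
    then show ?thesis using pos by blast
  qed
  then obtain \<mu> where \<mu>: "\<mu> > 0" "\<And>z. z \<in> ?D \<Longrightarrow> \<mu> \<le> ?f z" by blast
  \<comment> \<open>Solves \<open>\<mu> * R\<^sup>2 = \<bar>M\<bar> + \<bar>M\<bar>\<^sup>2\<close>,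
    the largest value that the two bounds allow. Absolute values keep the root real for every
    \<open>M\<close>.\<close>
  define R where "R = sqrt ((\<bar>M\<bar> + \<bar>M\<bar>\<^sup>2) / \<mu>)"
  have "norm (v c) \<le> R"
    if p: "p \<in> chart_dom c" "chart_map c p \<in> Q" and v: "v \<in> tangent_space A p"
      and M: "\<bar>g p v v\<bar> \<le> M" "\<bar>g p (K p) v\<bar> \<le> M" for p v
  proof (cases "v c = 0")
    case True
    then show ?thesis using \<mu>(1) by (simp add: R_def)
  next
    case False
    let ?x = "chart_map c p" and ?n = "norm (v c)" and ?u = "v c /\<^sub>R norm (v c)"
    have x: "?x \<in> chart_image c" using p by simp
    note bil = metric_field.bil[OF m x]
    have n: "?n > 0" using False by simp
    have "\<mu> \<le> ?f (?x, ?u)" by (rule \<mu>(2)) (use p n in simp)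
    also have "\<dots> = (\<bar>?G ?x (v c) (v c)\<bar> + (?G ?x (?k ?x) (v c))\<^sup>2) / ?n\<^sup>2"
      using n by (simp add: bilinear_lmul[OF bil] bilinear_rmul[OF bil] abs_mult power_mult_distrib
          power2_eq_square field_simps)
    also have "?G ?x (v c) (v c) = g p v v" by (rule metric_rep_tangent[OF c p(1) v v])
    also have "?G ?x (?k ?x) (v c) = g p (K p) v"
      using metric_rep_tangent[OF c p(1) K_tangent v] vector_field_rep_K[OF c p(1)] by simp
    finally have "\<mu> * ?n\<^sup>2 \<le> \<bar>g p v v\<bar> + (g p (K p) v)\<^sup>2" using n by (simp add: field_simps)
    also have "\<dots> \<le> \<bar>M\<bar> + \<bar>M\<bar>\<^sup>2"
      using M by (intro add_mono) (auto simp: abs_le_square_iff[symmetric])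
    finally have "?n\<^sup>2 \<le> (\<bar>M\<bar> + \<bar>M\<bar>\<^sup>2) / \<mu>" using \<mu>(1) by (simp add: field_simps)
    then show ?thesis unfolding R_def by (rule real_le_rsqrt)
  qed
  moreover have "R \<ge> 0" using \<mu>(1) by (simp add: R_def)
  ultimately show ?thesis by blast
qed

section \<open>Extension past a finite end\<close>

text \<open>Compactness in its filter form, applied to the image of the left neighbourhoods of
  \<open>b\<close>. Convergence cannot be claimed yet, only that the curve returns to every
  neighbourhood of \<open>p\<close> at times arbitrarily close to \<open>b\<close>.\<close>

lemma cluster_point:
  fixes \<gamma> :: "real \<Rightarrow> 'a"
  obtains p where "\<And>U a. \<lbrakk>open U; p \<in> U; a < b\<rbrakk> \<Longrightarrow> \<exists>t\<in>{a<..<b}. \<gamma> t \<in> U"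
proof -
  let ?F = "filtermap \<gamma> (at_left b)"
  have "?F \<noteq> bot" by (simp add: filtermap_bot_iff trivial_limit_at_left_real)
  then obtain p where p: "inf (nhds p) ?F \<noteq> bot"
    using compact_UNIV unfolding compact_filter by force
  have "\<exists>t\<in>{a<..<b}. \<gamma> t \<in> U" if U: "open U" "p \<in> U" "a < b" for U a
  proof (rule ccontr)
    assume "\<not> ?thesis"
    then have "\<forall>\<^sub>F t in at_left b. \<gamma> t \<notin> U"
      using eventually_at_left_real[OF U(3)] by (auto elim: eventually_mono)
    then have "\<forall>\<^sub>F y in ?F. y \<notin> U" by (simp add: eventually_filtermap)
    moreover have "\<forall>\<^sub>F y in nhds p. y \<in> U" using U by (simp add: eventually_nhds_in_open)
    ultimately have "\<forall>\<^sub>F y in inf (nhds p) ?F. False" unfolding eventually_inf by blast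
    then show False using p by (simp add: trivial_limit_def)
  qed
  then show ?thesis using that by blast
qed

text \<open>A first exit argument. Until the first time \<open>T\<close> outside the open set
  \<open>W\<close> the speed bound holds, so less than \<open>r\<close> is travelled from a point in
  the ball of radius \<open>r\<close>. The position at \<open>T\<close> is thus still within
  \<open>2 * r\<close>, which contradicts the exit.\<close>

lemma stays_in_chart_ball:
  assumes traj: "trajectory_on A g F V I \<gamma>" and t1b: "{t1..<b} \<subseteq> I" "t1 < b"
    and c: "c \<in> A" and Q: "cball x0 (2 * r) \<subseteq> chart_image c"
    and t1: "\<gamma> t1 \<in> chart_dom c" "chart_map c (\<gamma> t1) \<in> ball x0 r" and R: "R \<ge> 0" "R * (b - t1) < r"
    and bound: "\<And>t. \<lbrakk>t \<in> {t1..<b}; \<gamma> t \<in> chart_dom c; chart_map c (\<gamma> t) \<in> cball x0 (2 * r)\<rbrakk> \<Longrightarrow>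
      norm (velocity A \<gamma> t c) \<le> R"
    and t: "t \<in> {t1..<b}"
  shows "\<gamma> t \<in> chart_dom c \<and> chart_map c (\<gamma> t) \<in> ball x0 (2 * r)"
proof (rule ccontr)
  define W where "W = {q \<in> chart_dom c. chart_map c q \<in> ball x0 (2 * r)}"
  \<comment> \<open>A compact, hence closed, set in the Hausdorff manifold that contains
    \<open>W\<close>. It forces the position at the exit time to lie in the chart domain still, so
    that coordinates and the speed bound are available up to and including \<open>T\<close>.\<close>
  define N where "N = chart_inv c ` cball x0 (2 * r)"
  assume "\<not> ?thesis"
  then have tW: "\<gamma> t \<notin> W" by (simp add: W_def)
  have I: "open I" and s: "smooth_curve A I \<gamma>" using traj by (simp_all add: trajectory_on_def)
  have cont: "continuous_on {t1..t} \<gamma>"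
    by (rule continuous_on_subset[of I]) (use s t1b t in \<open>auto simp: smooth_curve_def\<close>)
  have "open W"
    using continuous_open_preimage[OF continuous_on_chart_map[OF c] open_chart_dom[OF c] open_ball]
    by (simp add: W_def vimage_def Int_def)
  have "compact N" unfolding N_def
    by (intro compact_continuous_image compact_cball
        continuous_on_subset[OF continuous_on_chart_inv[OF c] Q])
  then have "closed N" by (rule compact_imp_closed)
  have "closed ({t1..t} \<inter> \<gamma> -` (- W))"
    by (intro continuous_closed_preimage cont closed_atLeastAtMost closed_Compl \<open>open W\<close>)
  from compact_Int_closed[OF compact_Icc[of t1 t] this]
  have "compact ({t1..t} \<inter> \<gamma> -` (- W))" by (simp only: Int_left_absorb)
  moreover have "t \<in> {t1..t} \<inter> \<gamma> -` (- W)" using t tW by simp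
  ultimately obtain T where T: "T \<in> {t1..t} \<inter> \<gamma> -` (- W)" "\<And>s. s \<in> {t1..t} \<inter> \<gamma> -` (- W) \<Longrightarrow> T \<le> s"
    using compact_attains_inf[of "{t1..t} \<inter> \<gamma> -` (- W)"] by blast
  have Tt: "t1 \<le> T" "T \<le> t" "\<gamma> T \<notin> W" using T(1) by auto
  have "r > 0" using t1(2) by (metis ball_eq_empty empty_iff not_le)
  have "\<gamma> t1 \<in> W" using t1 \<open>r > 0\<close> by (simp add: W_def)
  then have T1: "t1 < T" using Tt by (metis order_le_less)
  have inW: "\<gamma> s \<in> W" if s: "s \<in> {t1..<T}" for s
  proof (rule ccontr)
    assume "\<gamma> s \<notin> W"
    then have "s \<in> {t1..t} \<inter> \<gamma> -` (- W)" using s Tt by simp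
    then show False using T(2)[of s] s by simp
  qed
  have WN: "W \<subseteq> N"
  proof
    fix q assume "q \<in> W"
    then have "q \<in> chart_dom c" "chart_map c q \<in> cball x0 (2 * r)" by (simp_all add: W_def)
    then show "q \<in> N" unfolding N_def using chart_inv_map[OF c] by (metis image_eqI)
  qed
  have "closed ({t1..T} \<inter> \<gamma> -` N)"
    by (intro continuous_closed_preimage continuous_on_subset[OF cont] \<open>closed N\<close> closed_atLeastAtMost)
      (use Tt in auto)
  moreover have "{t1..<T} \<subseteq> {t1..T} \<inter> \<gamma> -` N"
    by (auto intro!: subsetD[OF WN] inW)
  ultimately have "closure {t1..<T} \<subseteq> {t1..T} \<inter> \<gamma> -` N" by (intro closure_minimal)
  moreover have "T \<in> closure {t1..<T}" using T1 by simp
  ultimately have "\<gamma> T \<in> N" by blast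
  have inN: "\<gamma> s \<in> chart_dom c \<and> chart_map c (\<gamma> s) \<in> cball x0 (2 * r)" if "s \<in> {t1..T}" for s
  proof -
    have "\<gamma> s \<in> N"
      using that \<open>\<gamma> T \<in> N\<close> subsetD[OF WN inW[of s]] by (cases "s = T") auto
    then obtain x where x: "x \<in> cball x0 (2 * r)" "\<gamma> s = chart_inv c x" unfolding N_def by blast
    then have "x \<in> chart_image c" using Q by blast
    then show ?thesis using x chart_inv_dom[OF c] chart_map_inv[OF c] by simp
  qed
  have sub: "{t1..T} \<subseteq> {t1..<b}" using Tt t by auto
  let ?x = "chart_map c \<circ> \<gamma>"
  have "norm (?x T - ?x t1) \<le> R * norm (T - t1)"
  proof (rule differentiable_bound[of "{t1..T}"])
    fix s assume s': "s \<in> {t1..T}"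
    then have sb: "s \<in> {t1..<b}" using sub by blast
    then have "s \<in> I" using t1b by blast
    from velocity_has_vector_derivative[OF I s c this]
    show "(?x has_derivative (\<lambda>h. h *\<^sub>R velocity A \<gamma> s c)) (at s within {t1..T})"
      using inN[OF s'] by (simp add: has_vector_derivative_def has_derivative_at_withinI)
    have "norm (velocity A \<gamma> s c) \<le> R" by (rule bound[OF sb]) (use inN[OF s'] in auto)
    then show "onorm (\<lambda>h. h *\<^sub>R velocity A \<gamma> s c) \<le> R"
      by (intro onorm_le) (simp add: mult.commute[of R] mult_left_mono)
  qed (use T1 in auto)
  also have "\<dots> \<le> R * (b - t1)" using Tt t R by (intro mult_left_mono) auto
  also have "\<dots> < r" by (rule R)
  finally have "dist (?x t1) (?x T) < r" by (simp add: dist_norm norm_minus_commute)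
  moreover have "dist x0 (?x t1) < r" using t1(2) by simp
  ultimately have "dist x0 (?x T) < 2 * r" using dist_triangle[of x0 "?x T" "?x t1"] by linarith
  then have "\<gamma> T \<in> W" using inN[of T] T1 by (simp add: W_def)
  then show False using Tt by blast
qed

text \<open>The order of choices matters: the bounds \<open>M\<close> hold up to the end, the
  cluster point fixes the chart and the ball, these fix the speed bound \<open>R\<close>, and only
  then is the starting time \<open>t1\<close> taken close enough to \<open>b\<close> with respect to
  \<open>R\<close>.\<close>

lemma bounded_trajectory_extends:
  assumes traj: "trajectory_on A g F V I \<gamma>" and bdd: "bdd_above I"
  shows "\<exists>J \<delta>. trajectory_on A g F V J \<delta> \<and> I \<subseteq> J \<and> (\<forall>t\<in>I. \<delta> t = \<gamma> t) \<and> J \<noteq> I"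
proof -
  have I: "open I" "is_interval I" "I \<noteq> {}" and s: "smooth_curve A I \<gamma>"
    using traj by (simp_all add: trajectory_on_def)
  define b where "b = Sup I"
  have Ib: "t < b" if t: "t \<in> I" for t
  proof -
    obtain e where "e > 0" "ball t e \<subseteq> I" by (rule openE[OF I(1) t])
    moreover have "t + e / 2 \<in> ball t e" using \<open>e > 0\<close> by (simp add: dist_real_def)
    ultimately have "t + e / 2 \<le> b" unfolding b_def using cSup_upper[OF _ bdd] by blast
    then show ?thesis using \<open>e > 0\<close> by simp
  qed
  obtain a where a: "a \<in> I" using I by blast
  have aI: "{a..<b} \<subseteq> I"
  proof
    fix t assume t: "t \<in> {a..<b}"
    then obtain u where "u \<in> I" "t < u" using less_cSup_iff[OF I(3) bdd] by (auto simp: b_def)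
    then show "t \<in> I" using mem_is_interval_1_I[OF I(2) a, of u t] t by simp
  qed
  obtain M where M: "\<And>t. t \<in> {a..<b} \<Longrightarrow> \<bar>g (\<gamma> t) (velocity A \<gamma> t) (velocity A \<gamma> t)\<bar> \<le> M"
    "\<And>t. t \<in> {a..<b} \<Longrightarrow> \<bar>g (\<gamma> t) (K (\<gamma> t)) (velocity A \<gamma> t)\<bar> \<le> M"
    using velocity_bounds[OF traj a Ib[OF a] aI] by blast
  obtain p where p: "\<And>U a. \<lbrakk>open U; p \<in> U; a < b\<rbrakk> \<Longrightarrow> \<exists>t\<in>{a<..<b}. \<gamma> t \<in> U"
    using cluster_point[of b \<gamma>] by blast
  obtain c where c: "c \<in> A" "p \<in> chart_dom c" using chart_cover by blast
  let ?x0 = "chart_map c p"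
  obtain e where e: "e > 0" "cball ?x0 e \<subseteq> chart_image c"
    using open_chart_image[OF c(1)] c(2) open_contains_cball by blast
  define r where "r = e / 2"
  have r: "r > 0" "cball ?x0 (2 * r) \<subseteq> chart_image c" using e by (simp_all add: r_def)
  let ?Q = "cball ?x0 (2 * r)"
  obtain R where R: "R \<ge> 0" "\<And>p v. \<lbrakk>p \<in> chart_dom c; chart_map c p \<in> ?Q; v \<in> tangent_space A p;
      \<bar>g p v v\<bar> \<le> M; \<bar>g p (K p) v\<bar> \<le> M\<rbrakk> \<Longrightarrow> norm (v c) \<le> R"
    using coordinate_bound[OF c(1) compact_cball r(2), of M] by blast
  have bound: "norm (velocity A \<gamma> t c) \<le> R"
    if "t \<in> {a..<b}" "\<gamma> t \<in> chart_dom c" "chart_map c (\<gamma> t) \<in> ?Q" for t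
    by (rule R(2)[OF that(2,3) velocity_tangent[OF I(1) s] M(1)[OF that(1)] M(2)[OF that(1)]])
      (use that aI in blast)
  define U where "U = {q \<in> chart_dom c. chart_map c q \<in> ball ?x0 r}"
  have "open U"
    using continuous_open_preimage[OF continuous_on_chart_map[OF c(1)] open_chart_dom[OF c(1)] open_ball]
    by (simp add: U_def vimage_def Int_def)
  moreover have "p \<in> U" using c r by (simp add: U_def)
  \<comment> \<open>The second entry ensures \<open>R * (b - t1) < r\<close>; the summand 1 covers
    \<open>R = 0\<close>. The first keeps \<open>t1\<close> where the bounds \<open>M\<close> are
    valid.\<close>
  moreover have "max a (b - r / (R + 1)) < b" using Ib[OF a] r R by simp
  ultimately obtain t1 where t1: "t1 \<in> {max a (b - r / (R + 1))<..<b}" "\<gamma> t1 \<in> U" using p by blast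
  have t1': "a < t1" "t1 < b" "b - t1 < r / (R + 1)" using t1(1) by auto
  have "R * (b - t1) \<le> (R + 1) * (b - t1)" using t1' by (intro mult_right_mono) auto
  also have "\<dots> < (R + 1) * (r / (R + 1))" using t1' R by (intro mult_strict_left_mono) auto
  also have "\<dots> = r" using R by simp
  finally have Rr: "R * (b - t1) < r" .
  have sub: "{t1..<b} \<subseteq> {a..<b}" using t1' by auto
  have stay: "\<gamma> t \<in> chart_dom c \<and> chart_map c (\<gamma> t) \<in> ball ?x0 (2 * r)" if "t \<in> {t1..<b}" for t
  proof (rule stays_in_chart_ball[OF traj _ t1'(2) c(1) r(2) _ _ R(1) Rr bound that])
    show "{t1..<b} \<subseteq> I" using sub aI by blast
    show "\<gamma> t1 \<in> chart_dom c" "chart_map c (\<gamma> t1) \<in> ball ?x0 r" using t1(2) by (simp_all add: U_def)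
    show "s \<in> {a..<b}" if "s \<in> {t1..<b}" for s using that sub by blast
  qed
  show ?thesis
  proof (rule trajectory_extends[OF traj t1'(2) _ _ c(1)])
    show "{t1<..<b} \<subseteq> I" using t1' aI by auto
    show "I \<subseteq> {..<b}" using Ib by auto
    show "compact (?Q \<times> cball (0 :: 'e) R)" by (intro compact_Times compact_cball)
    show "?Q \<times> cball (0 :: 'e) R \<subseteq> chart_image c \<times> UNIV" using r(2) by blast
    fix t assume t: "t \<in> {t1<..<b}"
    then have t': "t \<in> {t1..<b}" by simp
    show "\<gamma> t \<in> chart_dom c" using stay[OF t'] by simp
    have Q: "chart_map c (\<gamma> t) \<in> ?Q" using stay[OF t'] by simp
    have "norm (velocity A \<gamma> t c) \<le> R" by (rule bound) (use t' sub stay[OF t'] Q in auto)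
    then show "(chart_map c (\<gamma> t), velocity A \<gamma> t c) \<in> ?Q \<times> cball 0 R" using Q by simp
  qed
qed

lemma inextensible_not_bdd_above:
  assumes "inextensible_trajectory A g F V I \<gamma>"
  shows "\<not> bdd_above I"
proof
  assume bdd: "bdd_above I"
  have traj: "trajectory_on A g F V I \<gamma>" using assms by (simp add: inextensible_trajectory_def)
  obtain J \<delta> where "trajectory_on A g F V J \<delta>" "I \<subseteq> J" "\<forall>t\<in>I. \<delta> t = \<gamma> t" "J \<noteq> I"
    using bounded_trajectory_extends[OF traj bdd] by (elim exE conjE)
  then show False using assms by (simp add: inextensible_trajectory_def)
qed

section \<open>Time reversal and completeness\<close>

lemma killing_dynamics_uminus: "killing_dynamics A g (\<lambda>p v c. - F p v c) V K"
proof -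
  interpret r: dynamics A g "\<lambda>p v c. - F p v c" V by (rule dynamics_uminus)
  show ?thesis
  proof
    show "skew_adjoint A g (\<lambda>p v c. - F p v c)"
      unfolding skew_adjoint_def
    proof (intro allI ballI)
      fix p v w assume v: "v \<in> tangent_space A p" and w: "w \<in> tangent_space A p"
      obtain c where c: "c \<in> A" "p \<in> chart_dom c" using chart_cover by blast
      then have x: "chart_map c p \<in> chart_image c" by simp
      note bil = metric_field.bil[OF metric_field_chart[OF c(1)] x]
      have "g p (\<lambda>c. - F p v c) w = - g p (F p v) w"
        using metric_rep_tangent[OF c tangent_space_uminus[OF F_tangent[OF v]] w]
          metric_rep_tangent[OF c F_tangent[OF v] w] by (simp add: bilinear_lneg[OF bil])
      moreover have "g p v (\<lambda>c. - F p w c) = - g p v (F p w)"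
        using metric_rep_tangent[OF c v tangent_space_uminus[OF F_tangent[OF w]]]
          metric_rep_tangent[OF c v F_tangent[OF w]] by (simp add: bilinear_rneg[OF bil])
      ultimately show "g p (\<lambda>c. - F p v c) w = - g p v (\<lambda>c. - F p w c)"
        using skew v w by (simp add: skew_adjoint_def)
    qed
    show "(\<lambda>c. - F p (K p) c) = (\<lambda>_. 0)" for p by (simp add: F_K)
  qed (rule killing timelike compact_UNIV)+
qed

text \<open>Reversal is an involution, as \<open>- (- F) = F\<close>: an extension of the reversed
  trajectory, reversed once more, extends the original one, whose maximality then applies.\<close>

lemma inextensible_reverse:
  assumes "inextensible_trajectory A g F V I \<gamma>"
  shows "inextensible_trajectory A g (\<lambda>p v c. - F p v c) V (uminus ` I) (\<lambda>t. \<gamma> (- t))"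
  unfolding inextensible_trajectory_def
proof (intro conjI allI impI)
  have traj: "trajectory_on A g F V I \<gamma>" and
    max: "\<And>J \<delta>. \<lbrakk>trajectory_on A g F V J \<delta>; I \<subseteq> J; \<forall>t\<in>I. \<delta> t = \<gamma> t\<rbrakk> \<Longrightarrow> J = I"
    using assms unfolding inextensible_trajectory_def by blast+
  show "trajectory_on A g (\<lambda>p v c. - F p v c) V (uminus ` I) (\<lambda>t. \<gamma> (- t))"
    by (rule trajectory_on_reverse[OF traj])
  interpret r: killing_dynamics A g "\<lambda>p v c. - F p v c" V K by (rule killing_dynamics_uminus)
  fix J \<delta>
  assume J: "trajectory_on A g (\<lambda>p v c. - F p v c) V J \<delta>" "uminus ` I \<subseteq> J"
    "\<forall>t\<in>uminus ` I. \<delta> t = \<gamma> (- t)"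
  have "trajectory_on A g F V (uminus ` J) (\<lambda>t. \<delta> (- t))"
    using r.trajectory_on_reverse[OF J(1)] by simp
  moreover have "I \<subseteq> uminus ` J" using J(2) by force
  moreover have "\<forall>t\<in>I. \<delta> (- t) = \<gamma> t" using J(3) by simp
  ultimately have "uminus ` J = I" by (rule max)
  then show "J = uminus ` I" by force
qed

theorem inextensible_complete:
  assumes "inextensible_trajectory A g F V I \<gamma>"
  shows "I = UNIV"
proof -
  interpret r: killing_dynamics A g "\<lambda>p v c. - F p v c" V K by (rule killing_dynamics_uminus)
  have up: "\<not> bdd_above I" by (rule inextensible_not_bdd_above[OF assms])
  have "\<not> bdd_above (uminus ` I)" by (rule r.inextensible_not_bdd_above[OF inextensible_reverse[OF assms]])
  then have down: "\<not> bdd_below I" by simp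
  have int: "is_interval I" using assms by (simp add: inextensible_trajectory_def trajectory_on_def)
  have "t \<in> I" for t
  proof -
    obtain u where "u \<in> I" "t \<le> u" using up unfolding bdd_above_def by (meson linear)
    moreover obtain l where "l \<in> I" "l \<le> t" using down unfolding bdd_below_def by (meson linear)
    ultimately show ?thesis using int unfolding is_interval_1 by blast
  qed
  then show ?thesis by blast
qed

end

theorem theorem1:
  fixes A :: "('a::{t2_space, second_countable_topology}, 'e::euclidean_space) chart set"
    and g :: "'a \<Rightarrow> ('a, 'e) tvec \<Rightarrow> ('a, 'e) tvec \<Rightarrow> real"
    and F :: "'a \<Rightarrow> ('a, 'e) tvec \<Rightarrow> ('a, 'e) tvec"
    and V :: "'a \<Rightarrow> real"
  assumes "smooth_atlas A"
    and "compact (UNIV :: 'a set)" and "connected (UNIV :: 'a set)"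
    and "lorentzian_metric A g"
    and "smooth_endo_field A F" and "skew_adjoint A g F"
    and "smooth_function A V"
    and "\<exists>K. conformal_killing A g K \<and> timelike_field g K \<and> (\<forall>p. F p (K p) = (\<lambda>_. 0))"
  shows "\<forall>I \<gamma>. inextensible_trajectory A g F V I \<gamma> \<longrightarrow> I = UNIV"
proof -
  obtain K where K: "conformal_killing A g K" "timelike_field g K" "\<And>p. F p (K p) = (\<lambda>_. 0)"
    using assms(8) by blast
  interpret killing_dynamics A g F V K
    by unfold_locales (fact assms K)+
  show ?thesis using inextensible_complete by blast
qed

end
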